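(* There exists an absolute number $\alpha\in(0,1)$ such that the following holds. Let $\Omega=\mathbb{R}^2\times(0,1)$ and let $\boldsymbol{u}$ be a smooth solution of the steady Navier-Stokes system $$-\Delta\boldsymbol{u}+(\boldsymbol{u}\cdot\nabla)\boldsymbol{u}+\nabla P=0,\qquad \nabla\cdot\boldsymbol{u}=0\qquad\text{in }\Omega,$$ with no-slip boundary conditions $\boldsymbol{u}=0$ at $x_3=0$ and $x_3=1$. For $R>0$ set $$\mathcal{E}(R)=\int_0^1\int_{\{x_1^2+x_2^2<R^2\}}|\nabla\boldsymbol{u}|^2\,dx_1\,dx_2\,dx_3 .$$ Then $\boldsymbol{u}\equiv 0$ if one of the following conditions holds: (a) $\displaystyle\liminf_{R\to+\infty}R^{-\alpha}\mathcal{E}(R)=0$; (b) for some $\beta\in[0,\frac{\alpha}{2}]$, $$\lim_{r\to\infty}r^{-\beta}\sup_{\theta\in[0,2\pi),\,z\in[0,1]}|\boldsymbol{u}(r,\theta,z)|=0\qquad\text{and}\qquad \sup_{(r,\theta,z)\in\Omega}r^{1+\beta-\frac{\alpha}{2}}|u^r(r,\theta,z)|<\infty .$$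
   Context: $\boldsymbol{u}=(u^1,u^2,u^3)$ is a real vector field (velocity) and $P$ is a scalar function (pressure); no symmetry of $\boldsymbol{u}$ is assumed. A smooth solution means that there is a smooth scalar $P$ such that the smooth field $\boldsymbol{u}$ and $P$ satisfy the system; smoothness is understood up to the boundary, i.e. on $\mathbb{R}^2\times[0,1]$. Cylindrical coordinates $(r,\theta,z)$ are $x_1=r\cos\theta$, $x_2=r\sin\theta$, $x_3=z$, and $\boldsymbol{u}=u^r\boldsymbol{e}_r+u^\theta\boldsymbol{e}_\theta+u^z\boldsymbol{e}_z$ with $\boldsymbol{e}_r=(\cos\theta,\sin\theta,0)$, $\boldsymbol{e}_\theta=(-\sin\theta,\cos\theta,0)$, $\boldsymbol{e}_z=(0,0,1)$; $u^r$ is the radial velocity. "Absolute" means that $\alpha$ does not depend on $\boldsymbol{u}$. *)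

theory Defs
  imports "HOL-Analysis.Analysis"
begin

definition slab :: "(real^3) set" where
  "slab = {x. 0 < x $ 3 \<and> x $ 3 < 1}"

definition closed_slab :: "(real^3) set" where
  "closed_slab = {x. 0 \<le> x $ 3 \<and> x $ 3 \<le> 1}"

text \<open>Differentiability class \<open>C\<^sup>k\<close> on a set, with derivatives taken within the set. On a closed set
  with nonempty interior such as the closed slab (a convex body, so that derivatives within it are
  unique), this is smoothness up to the boundary. Applying \<open>f'\<close> to a fixed direction \<open>v\<close>
  keeps the value type fixed throughout the recursion.\<close>

primrec Ck_on :: "nat \<Rightarrow> ('a::euclidean_space \<Rightarrow> 'b::real_normed_vector) \<Rightarrow> 'a set \<Rightarrow> bool" where
  "Ck_on 0 f S \<longleftrightarrow> continuous_on S f"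
| "Ck_on (Suc k) f S \<longleftrightarrow>
     (\<exists>f'. (\<forall>x\<in>S. (f has_derivative f' x) (at x within S)) \<and> (\<forall>v. Ck_on k (\<lambda>x. f' x v) S))"

definition smooth_on :: "('a::euclidean_space \<Rightarrow> 'b::real_normed_vector) \<Rightarrow> 'a set \<Rightarrow> bool" where
  "smooth_on f S \<longleftrightarrow> (\<forall>k. Ck_on k f S)"

text \<open>The differential operators below are only ever used at points of the open slab, where the
  full derivative exists; values of the fields outside the closed slab are irrelevant.\<close>

definition partial :: "'n \<Rightarrow> (real^'n::finite \<Rightarrow> 'b::real_normed_vector) \<Rightarrow> real^'n \<Rightarrow> 'b" where
  "partial j f x = frechet_derivative f (at x) (axis j 1)"

definition grad :: "(real^'n::finite \<Rightarrow> real) \<Rightarrow> real^'n \<Rightarrow> real^'n" where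
  "grad p x = (\<chi> j. partial j p x)"

definition divergence :: "(real^'n::finite \<Rightarrow> real^'n) \<Rightarrow> real^'n \<Rightarrow> real" where
  "divergence u x = (\<Sum>j\<in>UNIV. partial j u x $ j)"

definition laplacian :: "(real^'n::finite \<Rightarrow> 'b::real_normed_vector) \<Rightarrow> real^'n \<Rightarrow> 'b" where
  "laplacian f x = (\<Sum>j\<in>UNIV. partial j (partial j f) x)"

definition advect :: "(real^'n::finite \<Rightarrow> real^'n) \<Rightarrow> (real^'n \<Rightarrow> 'b::real_normed_vector) \<Rightarrow> real^'n \<Rightarrow> 'b" where
  "advect u f x = (\<Sum>j\<in>UNIV. (u x $ j) *\<^sub>R partial j f x)"

definition smooth_NS_solution :: "(real^3 \<Rightarrow> real^3) \<Rightarrow> bool" where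
  "smooth_NS_solution u \<longleftrightarrow>
     smooth_on u closed_slab \<and>
     (\<exists>P :: real^3 \<Rightarrow> real. smooth_on P closed_slab \<and>
        (\<forall>x\<in>slab. - laplacian u x + advect u u x + grad P x = 0 \<and> divergence u x = 0))"

definition no_slip :: "(real^3 \<Rightarrow> real^3) \<Rightarrow> bool" where
  "no_slip u \<longleftrightarrow> (\<forall>x. x $ 3 = 0 \<or> x $ 3 = 1 \<longrightarrow> u x = 0)"

definition grad_norm_sq :: "(real^3 \<Rightarrow> real^3) \<Rightarrow> real^3 \<Rightarrow> real" where
  "grad_norm_sq u x = (\<Sum>i\<in>UNIV. \<Sum>j\<in>UNIV. (partial j u x $ i)\<^sup>2)"

definition energy :: "(real^3 \<Rightarrow> real^3) \<Rightarrow> real \<Rightarrow> real" where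
  "energy u R = (LINT x : {x \<in> slab. (x $ 1)\<^sup>2 + (x $ 2)\<^sup>2 < R\<^sup>2} | lborel. grad_norm_sq u x)"

definition cyl :: "real \<Rightarrow> real \<Rightarrow> real \<Rightarrow> real^3" where
  "cyl r \<theta> z = vector [r * cos \<theta>, r * sin \<theta>, z]"

definition e_r :: "real \<Rightarrow> real^3" where
  "e_r \<theta> = vector [cos \<theta>, sin \<theta>, 0]"

definition radial :: "(real^3 \<Rightarrow> real^3) \<Rightarrow> real \<Rightarrow> real \<Rightarrow> real \<Rightarrow> real" where
  "radial u r \<theta> z = u (cyl r \<theta> z) \<bullet> e_r \<theta>"

definition energy_condition :: "real \<Rightarrow> (real^3 \<Rightarrow> real^3) \<Rightarrow> bool" where
  "energy_condition \<alpha> u \<longleftrightarrow> Liminf at_top (\<lambda>R. ereal (R powr (-\<alpha>) * energy u R)) = 0"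

text \<open>In the second supremum the axis \<open>r = 0\<close>, where \<open>e_r\<close> is not defined, is left out; the
  exponent there is positive for \<open>\<alpha> < 1\<close> and \<open>\<beta> \<ge> 0\<close>. It is taken in the extended reals, since it
  may be infinite, while the first one is over a bounded set of reals.\<close>

definition decay_condition :: "real \<Rightarrow> (real^3 \<Rightarrow> real^3) \<Rightarrow> bool" where
  "decay_condition \<alpha> u \<longleftrightarrow>
     (\<exists>\<beta>\<in>{0..\<alpha>/2}.
        ((\<lambda>r. r powr (-\<beta>) * (SUP (\<theta>, z)\<in>{0..<2*pi} \<times> {0..1}. norm (u (cyl r \<theta> z)))) \<longlongrightarrow> 0) at_top \<and>
        (SUP (r, \<theta>, z)\<in>{0<..} \<times> {0..<2*pi} \<times> {0<..<1}.
           ereal (r powr (1 + \<beta> - \<alpha>/2) * \<bar>radial u r \<theta> z\<bar>)) < \<infinity>)"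

end

theory Submission
  imports Defs
begin

text \<open>
  Multiply the equation by a divergence-free field \<open>w\<close> of compact horizontal support that vanishes
  on both faces and equals \<open>u\<close> near the axis. The pressure drops out, and so does every term in which
  \<open>w\<close> is parallel to \<open>u\<close>, because \<open>(u \<cdot> \<nabla>)u - \<nabla>(|u|\<^sup>2/2)\<close> is orthogonal to \<open>u\<close>. Everything rests
  on a good correction \<open>w - \<phi> u\<close>, where \<open>\<phi>\<close> is a radial cutoff at scale \<open>R\<close>. Its divergence must be
  \<open>-\<nabla>\<phi> \<cdot> u\<close>. The vertical mean of \<open>u\<close> is a planar divergence-free field, so it has a stream function
  \<open>\<Psi>\<close>, and \<open>\<Psi> (-\<phi>\<^sub>y, \<phi>\<^sub>x)\<close>, spread over the height by a profile vanishing at the faces, has the right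
  mean divergence. What is left of \<open>\<nabla>\<phi> \<cdot> u\<close> has vertical mean zero and is removed by a vertical
  primitive (\<open>assembled_identity\<close>). This replaces a Bogovskii operator by explicit formulas.

  Write \<open>F(R)\<close> for the energy weighted with \<open>\<phi>\<close>. Only one term of the correction is not small like a
  negative power of \<open>R\<close>: the vertical derivative of the horizontal field, of size \<open>|\<Psi>| |\<nabla>\<phi>|\<close>. Since
  \<open>|\<nabla>\<phi>|\<close> lives where \<open>\<phi> < 1\<close>, Young's inequality trades it against the energy between the scales \<open>R\<close>
  and \<open>4R\<close>, and the Poincare inequality for \<open>\<Psi>\<close> pays for the rest. The nonlinear terms carry a factor
  \<open>sup |\<Psi>| / R\<close>, which is small as long as the energy grows slower than a small power of \<open>R\<close>. Hence
  \<open>F(R) \<le> \<theta> F(4R)\<close> with an absolute \<open>\<theta> < 1\<close> (\<open>hole_filling\<close>, \<open>F_step\<close>). Iterated over the scales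
  between \<open>\<surd>T\<close> and \<open>T\<close>, this says that growth of \<open>F\<close> along a sequence below a certain power, which
  depends on \<open>\<theta>\<close> alone, forces \<open>F = 0\<close> (\<open>F_zero\<close>), and with the no-slip condition \<open>u = 0\<close>. Condition
  (a) is of this kind.

  Condition (b) is reduced to the same criterion by showing that the energy grows at most like a small
  power of \<open>R\<close>. As the radial velocity is of size \<open>1/r\<close> up to a small power, \<open>\<Psi>\<close> varies
  little along circles; replacing \<open>\<Psi>\<close> by its deviation from a radial function does not change the
  divergence of \<open>\<Psi> (-\<phi>\<^sub>y, \<phi>\<^sub>x)\<close>, because \<open>\<phi>\<close> is radial, and makes the field bounded. The one obstacle
  is that the vertical primitive loses a horizontal derivative, so that \<open>|\<nabla>u|\<^sup>2\<close> reappears on a larger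
  set with a factor that is not small. Therefore \<open>u\<close> is first averaged over horizontal shifts of length
  \<open>e\<close>; the derivatives of the average are bounded by \<open>sup |u| / e\<close>, and the difference to \<open>u\<close> is
  a horizontal derivative of divergence-free fields of size \<open>e\<close>, which gives an explicit correction as
  well. Taking \<open>e\<close> proportional to the width of the cutoff yields a Caccioppoli inequality with a small
  factor (\<open>caccioppoli_step\<close>), and iterating over shrinking widths bounds the energy (\<open>F_growth\<close>).
\<close>

section \<open>Functions of three real variables\<close>

text \<open>
  Fields on the slab are handled in coordinates as curried functions, extended to all heights by
  clamping, so that continuity can be demanded everywhere. Functions of \<open>(x,y)\<close> or of \<open>z\<close> alone are
  written with three arguments too: one calculus then serves all of them.
\<close>
definition cont3 :: "(real \<Rightarrow> real \<Rightarrow> real \<Rightarrow> 'b::topological_space) \<Rightarrow> bool" where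
  "cont3 f \<longleftrightarrow> continuous_on UNIV (\<lambda>(x,y,z). f x y z)"

lemma cont3I:
  "continuous_on UNIV (\<lambda>p::real\<times>real\<times>real. f (fst p) (fst (snd p)) (snd (snd p))) \<Longrightarrow> cont3 f"
  by (simp add: cont3_def case_prod_beta)

lemma cont3_comp:
  assumes "cont3 f" "continuous_on S a" "continuous_on S b" "continuous_on S c"
  shows "continuous_on S (\<lambda>s. f (a s) (b s) (c s))"
proof -
  have "continuous_on S ((\<lambda>(x,y,z). f x y z) \<circ> (\<lambda>s. (a s, b s, c s)))"
    by (rule continuous_on_compose)
      (use assms in \<open>auto intro!: continuous_intros simp: cont3_def intro: continuous_on_subset\<close>)
  then show ?thesis by (simp add: o_def)
qed

lemma cont3_slices:
  assumes "cont3 f"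
  shows "continuous_on S (\<lambda>x. f x y z)" "continuous_on S (\<lambda>y. f x y z)" "continuous_on S (f x y)"
  by (rule cont3_comp[OF assms]; intro continuous_intros)+

lemma continuous_on_integral_param:
  fixes k :: "'a::topological_space \<Rightarrow> real \<Rightarrow> 'b::banach"
  assumes "continuous_on UNIV (\<lambda>p. k (fst p) (snd p))"
  shows "continuous_on UNIV (\<lambda>p. integral {a..b} (k p))"
proof -
  have "continuous_on UNIV (\<lambda>p. integral (cbox a b) (k p))"
    by (rule integral_continuous_on_param)
      (use assms in \<open>auto simp: case_prod_beta intro: continuous_on_subset\<close>)
  then show ?thesis by simp
qed

section \<open>Integrals over boxes\<close>

definition I3 :: "real \<Rightarrow> (real \<Rightarrow> real \<Rightarrow> real \<Rightarrow> real) \<Rightarrow> real" where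
  "I3 L f = integral (cbox (-L,-L,0) (L,L,1)) (\<lambda>(x,y,z). f x y z)"

lemma cont3_integrable: "cont3 f \<Longrightarrow> (\<lambda>(x,y,z). f x y z) integrable_on (cbox a b)"
  for f :: "real \<Rightarrow> real \<Rightarrow> real \<Rightarrow> 'b::banach"
  by (rule integrable_continuous) (auto simp: cont3_def intro: continuous_on_subset)

lemma I3_add: "cont3 f \<Longrightarrow> cont3 g \<Longrightarrow> I3 L (\<lambda>x y z. f x y z + g x y z) = I3 L f + I3 L g"
  unfolding I3_def
  using integral_add[OF cont3_integrable cont3_integrable, of f g "(-L,-L,0)" "(L,L,1)"]
  by (simp add: case_prod_beta')

lemma I3_cmul: "I3 L (\<lambda>x y z. c * f x y z) = c * I3 L f"
  unfolding I3_def by (subst integral_mult_right[symmetric]) (simp add: case_prod_beta')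

lemma I3_mono:
  assumes "cont3 f" "cont3 g"
    and "\<And>x y z. \<lbrakk>\<bar>x\<bar> \<le> L; \<bar>y\<bar> \<le> L; 0 \<le> z; z \<le> 1\<rbrakk> \<Longrightarrow> f x y z \<le> g x y z"
  shows "I3 L f \<le> I3 L g"
  unfolding I3_def
proof (intro integral_le cont3_integrable assms(1,2))
  fix p assume "p \<in> cbox (-L,-L,0) (L,L,1::real)"
  then show "(\<lambda>(x,y,z). f x y z) p \<le> (\<lambda>(x,y,z). g x y z) p"
    using assms(3)[of "fst p" "fst (snd p)" "snd (snd p)"] by (auto simp: cbox_Pair_eq abs_le_iff)
qed

lemma I3_cong:
  assumes "\<And>x y z. \<lbrakk>\<bar>x\<bar> \<le> L; \<bar>y\<bar> \<le> L; 0 \<le> z; z \<le> 1\<rbrakk> \<Longrightarrow> f x y z = g x y z"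
  shows "I3 L f = I3 L g"
  unfolding I3_def
proof (rule integral_cong)
  fix p assume "p \<in> cbox (-L,-L,0) (L,L,1::real)"
  then show "(\<lambda>(x,y,z). f x y z) p = (\<lambda>(x,y,z). g x y z) p"
    using assms[of "fst p" "fst (snd p)" "snd (snd p)"] by (auto simp: cbox_Pair_eq abs_le_iff)
qed

lemma I3_nonneg:
  assumes "cont3 f" and "\<And>x y z. \<lbrakk>\<bar>x\<bar> \<le> L; \<bar>y\<bar> \<le> L; 0 \<le> z; z \<le> 1\<rbrakk> \<Longrightarrow> 0 \<le> f x y z"
  shows "0 \<le> I3 L f"
  using I3_mono[of "\<lambda>x y z. 0" f L] assms I3_cmul[of L 0 f]
  by (auto simp: cont3_def case_prod_beta)

lemma I3_mono_box:
  assumes "cont3 f" "L \<le> M" and "\<And>x y z. \<lbrakk>0 \<le> z; z \<le> 1\<rbrakk> \<Longrightarrow> 0 \<le> f x y z"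
  shows "I3 L f \<le> I3 M f"
  unfolding I3_def
proof (intro integral_subset_le cont3_integrable assms(1))
  show "cbox (- L, - L, 0) (L, L, 1) \<subseteq> cbox (- M, - M, 0) (M, M, 1::real)"
    using assms(2) by (auto simp: cbox_Pair_eq)
qed (use assms in \<open>auto simp: cbox_Pair_eq\<close>)

lemma I3_const: "0 \<le> L \<Longrightarrow> I3 L (\<lambda>x y z. c) = 4 * L\<^sup>2 * c"
  unfolding I3_def case_prod_beta by (simp add: content_Pair power2_eq_square)

lemma integral_prod_real:
  fixes f :: "real \<Rightarrow> real \<Rightarrow> real"
  assumes "continuous_on UNIV (\<lambda>p. f (fst p) (snd p))"
  shows "integral {a..b} (\<lambda>x. integral {c..d} (\<lambda>y. f x y)) = integral {c..d} (\<lambda>y. integral {a..b} (\<lambda>x. f x y))"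
  using integral_swap_continuous[of a c b d f] assms
  by (auto simp: case_prod_beta intro: continuous_on_subset)

lemma I3_iterated:
  assumes "cont3 f"
  shows "I3 L f = integral {-L..L} (\<lambda>x. integral {-L..L} (\<lambda>y. integral {0..1} (f x y)))"
proof -
  have c: "continuous_on S (\<lambda>(x,y,z). f x y z)" for S
    using assms by (auto simp: cont3_def intro: continuous_on_subset)
  have c2: "continuous_on S (\<lambda>(y,z). f x y z)" for S x
    unfolding case_prod_beta by (intro cont3_comp[OF assms] continuous_intros)
  have "I3 L f = integral {-L..L} (\<lambda>x. integral (cbox (-L,0) (L,1)) (\<lambda>(y,z). f x y z))"
    unfolding I3_def by (subst integral_prod_continuous[OF c]) simp
  also have "\<dots> = integral {-L..L} (\<lambda>x. integral {-L..L} (\<lambda>y. integral {0..1} (f x y)))"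
    by (subst integral_prod_continuous[OF c2]) (simp add: case_prod_beta)
  finally show ?thesis .
qed

lemma I3_iterated_swap:
  assumes "cont3 f"
  shows "I3 L f = integral {-L..L} (\<lambda>y. integral {-L..L} (\<lambda>x. integral {0..1} (f x y)))"
proof -
  have "continuous_on UNIV (\<lambda>p::real\<times>real. integral {0..1} (f (fst p) (snd p)))"
    by (rule continuous_on_integral_param) (intro cont3_comp[OF assms] continuous_intros)
  from integral_prod_real[OF this, of "-L" L "-L" L] show ?thesis
    by (simp add: I3_iterated[OF assms])
qed

lemma I3_x_inner:
  assumes "cont3 f"
  shows "I3 L f = integral {-L..L} (\<lambda>y. integral {0..1} (\<lambda>z. integral {-L..L} (\<lambda>x. f x y z)))"
  unfolding I3_iterated_swap[OF assms]
  by (intro integral_cong integral_prod_real cont3_comp[OF assms] continuous_intros)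

lemma I3_y_inner:
  assumes "cont3 f"
  shows "I3 L f = integral {-L..L} (\<lambda>x. integral {0..1} (\<lambda>z. integral {-L..L} (\<lambda>y. f x y z)))"
  unfolding I3_iterated[OF assms]
  by (intro integral_cong integral_prod_real cont3_comp[OF assms] continuous_intros)

lemma I3_dx_zero:
  assumes "cont3 f'" "0 \<le> L"
    and "\<And>x y z. \<lbrakk>0 \<le> z; z \<le> 1\<rbrakk> \<Longrightarrow> ((\<lambda>s. f s y z) has_vector_derivative f' x y z) (at x)"
    and "\<And>y z. \<lbrakk>0 \<le> z; z \<le> 1\<rbrakk> \<Longrightarrow> f L y z = 0 \<and> f (-L) y z = 0"
  shows "I3 L f' = 0"
proof -
  have "integral {-L..L} (\<lambda>x. f' x y z) = 0" if "0 \<le> z" "z \<le> 1" for y z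
  proof -
    have "((\<lambda>x. f' x y z) has_integral (f L y z - f (-L) y z)) {-L..L}"
      by (rule fundamental_theorem_of_calculus)
        (use assms that in \<open>auto intro: has_vector_derivative_at_within\<close>)
    then show ?thesis using assms(4) that by (simp add: integral_unique)
  qed
  then have "integral {0..1} (\<lambda>z. integral {-L..L} (\<lambda>x. f' x y z)) = integral {0..1} (\<lambda>z::real. 0::real)" for y
    by (intro integral_cong) auto
  then show ?thesis by (simp add: I3_x_inner[OF assms(1)])
qed

lemma I3_dy_zero:
  assumes "cont3 f'" "0 \<le> L"
    and "\<And>x y z. \<lbrakk>0 \<le> z; z \<le> 1\<rbrakk> \<Longrightarrow> ((\<lambda>s. f x s z) has_vector_derivative f' x y z) (at y)"
    and "\<And>x z. \<lbrakk>0 \<le> z; z \<le> 1\<rbrakk> \<Longrightarrow> f x L z = 0 \<and> f x (-L) z = 0"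
  shows "I3 L f' = 0"
proof -
  have "integral {-L..L} (\<lambda>y. f' x y z) = 0" if "0 \<le> z" "z \<le> 1" for x z
  proof -
    have "((\<lambda>y. f' x y z) has_integral (f x L z - f x (-L) z)) {-L..L}"
      by (rule fundamental_theorem_of_calculus)
        (use assms that in \<open>auto intro: has_vector_derivative_at_within\<close>)
    then show ?thesis using assms(4) that by (simp add: integral_unique)
  qed
  then have "integral {0..1} (\<lambda>z. integral {-L..L} (\<lambda>y. f' x y z)) = integral {0..1} (\<lambda>z::real. 0::real)" for x
    by (intro integral_cong) auto
  then show ?thesis by (simp add: I3_y_inner[OF assms(1)])
qed

lemma I3_dz_zero:
  assumes "cont3 f'"
    and "\<And>x y z. \<lbrakk>0 \<le> z; z \<le> 1\<rbrakk> \<Longrightarrow> (f x y has_vector_derivative f' x y z) (at z within {0..1})"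
    and "\<And>x y. f x y 0 = 0 \<and> f x y 1 = 0"
  shows "I3 L f' = 0"
proof -
  have "integral {0..1} (f' x y) = 0" for x y
  proof -
    have "(f' x y has_integral (f x y 1 - f x y 0)) {0..1}"
      by (rule fundamental_theorem_of_calculus) (use assms in auto)
    then show ?thesis using assms(3) by (simp add: integral_unique)
  qed
  then show ?thesis by (simp add: I3_iterated[OF assms(1)])
qed

section \<open>Continuously differentiable functions\<close>

text \<open>
  The derivatives are arguments, because they are needed as formulas. They are demanded only inside
  the closed slab, one-sided in \<open>z\<close>: a clamped function is continuous for all \<open>z\<close>, but in general not
  differentiable across the faces.
\<close>
definition C1 :: "(real \<Rightarrow> real \<Rightarrow> real \<Rightarrow> 'b::real_normed_vector) \<Rightarrow> (real \<Rightarrow> real \<Rightarrow> real \<Rightarrow> 'b)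
   \<Rightarrow> (real \<Rightarrow> real \<Rightarrow> real \<Rightarrow> 'b) \<Rightarrow> (real \<Rightarrow> real \<Rightarrow> real \<Rightarrow> 'b) \<Rightarrow> bool" where
  "C1 f fx fy fz \<longleftrightarrow> cont3 f \<and> cont3 fx \<and> cont3 fy \<and> cont3 fz \<and>
    (\<forall>x y z. 0 \<le> z \<longrightarrow> z \<le> 1 \<longrightarrow>
       ((\<lambda>s. f s y z) has_vector_derivative fx x y z) (at x) \<and>
       ((\<lambda>s. f x s z) has_vector_derivative fy x y z) (at y) \<and>
       (f x y has_vector_derivative fz x y z) (at z within {0..1}))"

lemma C1I:
  assumes "cont3 f" "cont3 fx" "cont3 fy" "cont3 fz"
    "\<And>x y z. \<lbrakk>0 \<le> z; z \<le> 1\<rbrakk> \<Longrightarrow> ((\<lambda>s. f s y z) has_vector_derivative fx x y z) (at x)"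
    "\<And>x y z. \<lbrakk>0 \<le> z; z \<le> 1\<rbrakk> \<Longrightarrow> ((\<lambda>s. f x s z) has_vector_derivative fy x y z) (at y)"
    "\<And>x y z. \<lbrakk>0 \<le> z; z \<le> 1\<rbrakk> \<Longrightarrow> ((\<lambda>s. f x y s) has_vector_derivative fz x y z) (at z within {0..1})"
  shows "C1 f fx fy fz"
  using assms by (auto simp: C1_def)

lemma C1D:
  assumes "C1 f fx fy fz"
  shows "cont3 f" "cont3 fx" "cont3 fy" "cont3 fz"
    "\<lbrakk>0 \<le> z; z \<le> 1\<rbrakk> \<Longrightarrow> ((\<lambda>s. f s y z) has_vector_derivative fx x y z) (at x)"
    "\<lbrakk>0 \<le> z; z \<le> 1\<rbrakk> \<Longrightarrow> ((\<lambda>s. f x s z) has_vector_derivative fy x y z) (at y)"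
    "\<lbrakk>0 \<le> z; z \<le> 1\<rbrakk> \<Longrightarrow> ((\<lambda>s. f x y s) has_vector_derivative fz x y z) (at z within {0..1})"
  using assms by (auto simp: C1_def)

lemma C1_add:
  assumes f: "C1 f fx fy fz" and g: "C1 g gx gy gz"
  shows "C1 (\<lambda>x y z. f x y z + g x y z) (\<lambda>x y z. fx x y z + gx x y z) (\<lambda>x y z. fy x y z + gy x y z)
     (\<lambda>x y z. fz x y z + gz x y z)"
  by (intro C1I cont3I continuous_intros cont3_comp[OF C1D(1)[OF f]] cont3_comp[OF C1D(2)[OF f]]
     cont3_comp[OF C1D(3)[OF f]] cont3_comp[OF C1D(4)[OF f]] cont3_comp[OF C1D(1)[OF g]] cont3_comp[OF C1D(2)[OF g]]
     cont3_comp[OF C1D(3)[OF g]] cont3_comp[OF C1D(4)[OF g]] has_vector_derivative_add C1D(5-7)[OF f] C1D(5-7)[OF g])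

lemma C1_linear:
  assumes B: "bounded_linear B" and f: "C1 f fx fy fz"
  shows "C1 (\<lambda>x y z. B (f x y z)) (\<lambda>x y z. B (fx x y z)) (\<lambda>x y z. B (fy x y z)) (\<lambda>x y z. B (fz x y z))"
  by (intro C1I cont3I continuous_intros bounded_linear.continuous_on[OF B] bounded_linear.has_vector_derivative[OF B]
     cont3_comp[OF C1D(1)[OF f]] cont3_comp[OF C1D(2)[OF f]]
     cont3_comp[OF C1D(3)[OF f]] cont3_comp[OF C1D(4)[OF f]] C1D(5-7)[OF f])

lemma C1_bilinear:
  assumes B: "bounded_bilinear B" and f: "C1 f fx fy fz" and g: "C1 g gx gy gz"
  shows "C1 (\<lambda>x y z. B (f x y z) (g x y z))
     (\<lambda>x y z. B (f x y z) (gx x y z) + B (fx x y z) (g x y z))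
     (\<lambda>x y z. B (f x y z) (gy x y z) + B (fy x y z) (g x y z))
     (\<lambda>x y z. B (f x y z) (gz x y z) + B (fz x y z) (g x y z))"
  by (intro C1I cont3I continuous_intros bounded_bilinear.continuous_on[OF B] bounded_bilinear.has_vector_derivative[OF B]
     cont3_comp[OF C1D(1)[OF f]] cont3_comp[OF C1D(2)[OF f]]
     cont3_comp[OF C1D(3)[OF f]] cont3_comp[OF C1D(4)[OF f]] cont3_comp[OF C1D(1)[OF g]] cont3_comp[OF C1D(2)[OF g]]
     cont3_comp[OF C1D(3)[OF g]] cont3_comp[OF C1D(4)[OF g]] C1D(5-7)[OF f] C1D(5-7)[OF g])

lemmas C1_mult = C1_bilinear[OF bounded_bilinear_mult]
lemmas C1_scaleR = C1_bilinear[OF bounded_bilinear_scaleR]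
lemmas C1_inner = C1_bilinear[OF bounded_bilinear_inner]
lemmas C1_nth = C1_linear[OF bounded_linear_vec_nth]
lemmas C1_minus = C1_linear[OF bounded_linear_minus[OF bounded_linear_ident]]

lemma C1_const: "C1 (\<lambda>x y z. c) (\<lambda>x y z. 0) (\<lambda>x y z. 0) (\<lambda>x y z. 0)"
  by (intro C1I cont3I continuous_intros has_vector_derivative_const)

text \<open>
  Vertical means, vertical primitives and horizontal averages are all parameter integrals over the unit
  interval; this is where they get their derivatives from.
\<close>
lemma C1_param:
  fixes k :: "real \<Rightarrow> real \<Rightarrow> real \<Rightarrow> real \<Rightarrow> 'b::banach"
  assumes c: "continuous_on UNIV (\<lambda>p. k (fst (fst p)) (fst (snd (fst p))) (snd (snd (fst p))) (snd p))"
     "continuous_on UNIV (\<lambda>p. kx (fst (fst p)) (fst (snd (fst p))) (snd (snd (fst p))) (snd p))"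
     "continuous_on UNIV (\<lambda>p. ky (fst (fst p)) (fst (snd (fst p))) (snd (snd (fst p))) (snd p))"
     "continuous_on UNIV (\<lambda>p. kz (fst (fst p)) (fst (snd (fst p))) (snd (snd (fst p))) (snd p))"
    and d: "\<And>x y z t. \<lbrakk>0 \<le> z; z \<le> 1; 0 \<le> t; t \<le> 1\<rbrakk> \<Longrightarrow> ((\<lambda>s. k s y z t) has_vector_derivative kx x y z t) (at x)"
     "\<And>x y z t. \<lbrakk>0 \<le> z; z \<le> 1; 0 \<le> t; t \<le> 1\<rbrakk> \<Longrightarrow> ((\<lambda>s. k x s z t) has_vector_derivative ky x y z t) (at y)"
     "\<And>x y z t. \<lbrakk>0 \<le> z; z \<le> 1; 0 \<le> t; t \<le> 1\<rbrakk> \<Longrightarrow> ((\<lambda>s. k x y s t) has_vector_derivative kz x y z t) (at z within {0..1})"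
  shows "C1 (\<lambda>x y z. integral {0..1} (k x y z)) (\<lambda>x y z. integral {0..1} (kx x y z))
     (\<lambda>x y z. integral {0..1} (ky x y z)) (\<lambda>x y z. integral {0..1} (kz x y z))"
proof (rule C1I)
  have comp: "continuous_on S (\<lambda>s. g (a s) (b s) (c s) (d s))"
    if "continuous_on UNIV (\<lambda>p. g (fst (fst p)) (fst (snd (fst p))) (snd (snd (fst p))) (snd p))"
      "continuous_on S a" "continuous_on S b" "continuous_on S c" "continuous_on S d"
    for g :: "real \<Rightarrow> real \<Rightarrow> real \<Rightarrow> real \<Rightarrow> 'b" and a b c d and S :: "'z::topological_space set"
  proof -
    have "continuous_on S ((\<lambda>p. g (fst (fst p)) (fst (snd (fst p))) (snd (snd (fst p))) (snd p)) \<circ> (\<lambda>s. ((a s, b s, c s), d s)))"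
      by (rule continuous_on_compose) (use that in \<open>auto intro!: continuous_intros intro: continuous_on_subset\<close>)
    then show ?thesis by (simp add: o_def)
  qed
  have int: "(\<lambda>t. k x y z t) integrable_on cbox 0 1" for x y z
    by (intro integrable_continuous comp[OF c(1)] continuous_intros)
  show "cont3 (\<lambda>x y z. integral {0..1} (k x y z))" "cont3 (\<lambda>x y z. integral {0..1} (kx x y z))"
     "cont3 (\<lambda>x y z. integral {0..1} (ky x y z))" "cont3 (\<lambda>x y z. integral {0..1} (kz x y z))"
    by (intro cont3I continuous_on_integral_param comp[OF c(1)] comp[OF c(2)] comp[OF c(3)] comp[OF c(4)] continuous_intros)+
  fix x y z :: real assume z: "0 \<le> z" "z \<le> 1"
  show "((\<lambda>s. integral {0..1} (k s y z)) has_vector_derivative integral {0..1} (kx x y z)) (at x)"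
    using leibniz_rule_vector_derivative[of UNIV 0 1 "\<lambda>s. k s y z" "\<lambda>s. kx s y z" x] z
    by (simp add: d int[simplified] case_prod_beta comp[OF c(2)] continuous_intros)
  show "((\<lambda>s. integral {0..1} (k x s z)) has_vector_derivative integral {0..1} (ky x y z)) (at y)"
    using leibniz_rule_vector_derivative[of UNIV 0 1 "\<lambda>s. k x s z" "\<lambda>s. ky x s z" y] z
    by (simp add: d int[simplified] case_prod_beta comp[OF c(3)] continuous_intros)
  show "((\<lambda>s. integral {0..1} (k x y s)) has_vector_derivative integral {0..1} (kz x y z)) (at z within {0..1})"
    using leibniz_rule_vector_derivative[of "{0..1}" 0 1 "\<lambda>s. k x y s" "\<lambda>s. kz x y s" z] z
    by (simp add: d int[simplified] case_prod_beta comp[OF c(4)] continuous_intros)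
qed

section \<open>Signed integrals\<close>

text \<open>
  The integral from \<open>a\<close> to \<open>b\<close>, also for \<open>b < a\<close>. Written over the unit interval it is jointly
  continuous in \<open>a\<close>, \<open>b\<close> and further parameters by continuity of parameter integrals.
\<close>
definition lint :: "(real \<Rightarrow> 'b::banach) \<Rightarrow> real \<Rightarrow> real \<Rightarrow> 'b" where
  "lint f a b = integral {0..1} (\<lambda>t. (b - a) *\<^sub>R f (a + (b - a) * t))"

lemma lint_FTC:
  assumes "\<And>s. s \<in> S \<Longrightarrow> (f has_vector_derivative f' s) (at s within S)" "convex S" "a \<in> S" "b \<in> S"
  shows "lint f' a b = f b - f a"
proof -
  have inS: "a + (b - a) * t \<in> S" if "0 \<le> t" "t \<le> 1" for t
    using convexD_alt[OF assms(2-4) that] by (simp add: algebra_simps)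
  have "((\<lambda>t. (b - a) *\<^sub>R f' (a + (b - a) * t)) has_integral (f \<circ> (\<lambda>t. a + (b - a) * t)) 1 - (f \<circ> (\<lambda>t. a + (b - a) * t)) 0) {0..1}"
  proof (rule fundamental_theorem_of_calculus)
    fix t :: real assume t: "t \<in> {0..1}"
    have "(f has_vector_derivative f' (a + (b - a) * t)) (at (a + (b - a) * t) within (\<lambda>t. a + (b - a) * t) ` {0..1})"
      by (rule has_vector_derivative_within_subset[OF assms(1)]) (use inS t in auto)
    then show "(f \<circ> (\<lambda>t. a + (b - a) * t) has_vector_derivative (b - a) *\<^sub>R f' (a + (b - a) * t)) (at t within {0..1})"
      by (intro vector_diff_chain_within) (auto intro!: derivative_eq_intros simp: has_real_derivative_iff_has_vector_derivative[symmetric])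
  qed simp
  from integral_unique[OF this] show ?thesis unfolding lint_def by simp
qed

lemma lint_diff:
  assumes f: "continuous_on UNIV f" and "m \<le> a" "m \<le> b"
  shows "lint f a b = integral {m..b} f - integral {m..a} f"
proof -
  have "(\<lambda>u. integral {m..u} f) b - (\<lambda>u. integral {m..u} f) a = lint f a b"
  proof (rule lint_FTC[symmetric, where S="{m..max a b}"])
    fix s assume "s \<in> {m..max a b}"
    then show "((\<lambda>u. integral {m..u} f) has_vector_derivative f s) (at s within {m..max a b})"
      by (intro integral_has_vector_derivative continuous_on_subset[OF f]) auto
  qed (use assms in auto)
  then show ?thesis by simp
qed

lemma lint_deriv:
  assumes f: "continuous_on UNIV f"
  shows "(lint f a has_vector_derivative f b) (at b within S)"
proof -
  define m M where "m = min a b - 1" and "M = max a b + 1"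
  have "((\<lambda>u. integral {m..u} f) has_vector_derivative f b) (at b within {m..M})"
    by (intro integral_has_vector_derivative continuous_on_subset[OF f]) (auto simp: m_def M_def)
  then have "((\<lambda>u. integral {m..u} f) has_vector_derivative f b) (at b)"
    by (subst (asm) at_within_interior[of b "{m..M}"]) (auto simp: m_def M_def min_def max_def)
  then have "((\<lambda>u. integral {m..u} f - integral {m..a} f) has_vector_derivative f b - 0) (at b)"
    by (intro has_vector_derivative_diff has_vector_derivative_const)
  then have "(lint f a has_vector_derivative f b) (at b)"
    apply simp
    apply (rule has_vector_derivative_transform_within_open[where S="{m<..<M}"], assumption)
    using f by (auto simp: m_def M_def intro!: lint_diff[symmetric])
  then show ?thesis by (rule has_vector_derivative_at_within)
qed

lemma lint_eq_integral: "continuous_on UNIV f \<Longrightarrow> a \<le> b \<Longrightarrow> lint f a b = integral {a..b} f"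
  by (subst lint_diff[of f a]) auto

lemma norm_lint_le:
  assumes f: "continuous_on UNIV f" and ab: "a \<in> {l..m}" "b \<in> {l..m}"
  shows "norm (lint f a b) \<le> integral {l..m} (\<lambda>t. norm (f t))"
proof -
  have *: "norm (lint f a b) \<le> integral {l..m} (\<lambda>t. norm (f t))" if "a \<in> {l..m}" "b \<in> {l..m}" "a \<le> b" for a b
  proof -
    have "norm (integral {a..b} f) \<le> integral {a..b} (\<lambda>t. norm (f t))"
      by (intro integral_norm_bound_integral integrable_continuous_real continuous_intros continuous_on_subset[OF f]) auto
    also have "\<dots> \<le> integral {l..m} (\<lambda>t. norm (f t))"
      using that by (intro integral_subset_le integrable_continuous_real continuous_intros continuous_on_subset[OF f]) auto
    finally show ?thesis using that by (simp add: lint_eq_integral[OF f])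
  qed
  have "lint f a b = - lint f b a" using ab by (simp add: lint_diff[OF f, of l])
  then show ?thesis using *[of a b] *[of b a] ab by (cases "a \<le> b") (auto simp: norm_minus_cancel)
qed

section \<open>Vertical means, vertical primitives and horizontal averages\<close>

definition zavg :: "(real \<Rightarrow> real \<Rightarrow> real \<Rightarrow> 'b::banach) \<Rightarrow> real \<Rightarrow> real \<Rightarrow> real \<Rightarrow> 'b" where
  "zavg f x y z = integral {0..1} (f x y)"

definition zprim :: "(real \<Rightarrow> real \<Rightarrow> real \<Rightarrow> 'b::banach) \<Rightarrow> real \<Rightarrow> real \<Rightarrow> real \<Rightarrow> 'b" where
  "zprim f x y z = lint (f x y) 0 z"

text \<open>
  With \<open>w = 1\<close> this is a mollification in \<open>x\<close>; with \<open>w t = e (1 - t)\<close> it is a potential for the difference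
  between a function and its mollification.
\<close>
definition shx :: "(real \<Rightarrow> real) \<Rightarrow> real \<Rightarrow> (real \<Rightarrow> real \<Rightarrow> real \<Rightarrow> 'b::banach) \<Rightarrow> real \<Rightarrow> real \<Rightarrow> real \<Rightarrow> 'b" where
  "shx w e f x y z = integral {0..1} (\<lambda>t. w t *\<^sub>R f (x + e * t) y z)"

definition shy :: "(real \<Rightarrow> real) \<Rightarrow> real \<Rightarrow> (real \<Rightarrow> real \<Rightarrow> real \<Rightarrow> 'b::banach) \<Rightarrow> real \<Rightarrow> real \<Rightarrow> real \<Rightarrow> 'b" where
  "shy w e f x y z = integral {0..1} (\<lambda>t. w t *\<^sub>R f x (y + e * t) z)"

lemma cont3_zavg: assumes f: "cont3 f" shows "cont3 (zavg f)"
  unfolding zavg_def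
  by (intro cont3I continuous_on_integral_param cont3_comp[OF f] continuous_intros)

lemma cont3_zprim: assumes f: "cont3 f" shows "cont3 (zprim f)"
  unfolding zprim_def lint_def
  by (intro cont3I continuous_on_integral_param cont3_comp[OF f] continuous_intros)

lemma cont3_shx:
  assumes w: "continuous_on UNIV w" and f: "cont3 f" shows "cont3 (shx w e f)"
  unfolding shx_def
  by (intro cont3I continuous_on_integral_param cont3_comp[OF f] continuous_intros
    continuous_on_compose2[OF w]) auto

lemma cont3_shy:
  assumes w: "continuous_on UNIV w" and f: "cont3 f" shows "cont3 (shy w e f)"
  unfolding shy_def
  by (intro cont3I continuous_on_integral_param cont3_comp[OF f] continuous_intros
    continuous_on_compose2[OF w]) auto

lemma C1_zavg:
  assumes f: "C1 f fx fy fz"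
  shows "C1 (zavg f) (zavg fx) (zavg fy) (\<lambda>x y z. 0)"
proof -
  note c = C1D(1-4)[OF f]
  have "C1 (\<lambda>x y z. integral {0..1} (\<lambda>t. f x y t)) (\<lambda>x y z. integral {0..1} (\<lambda>t. fx x y t))
     (\<lambda>x y z. integral {0..1} (\<lambda>t. fy x y t)) (\<lambda>x y z. integral {0..1} (\<lambda>t::real. 0))"
    by (rule C1_param) (intro cont3_comp[OF c(1)] cont3_comp[OF c(2)] cont3_comp[OF c(3)]
      continuous_intros C1D(5-6)[OF f] has_vector_derivative_const; assumption)+
  then show ?thesis unfolding zavg_def[abs_def] by simp
qed

lemma C1_zprim:
  assumes f: "C1 f fx fy fz"
  shows "C1 (zprim f) (zprim fx) (zprim fy) f"
proof (rule C1I)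
  note c = C1D(1-4)[OF f]
  show "cont3 (zprim f)" "cont3 (zprim fx)" "cont3 (zprim fy)" "cont3 f"
    by (intro cont3_zprim c)+
  fix x y z :: real assume z: "0 \<le> z" "z \<le> 1"
  have zt: "0 \<le> z * t" "z * t \<le> 1" if "0 \<le> t" "t \<le> 1" for t
    using z that by (auto simp: mult_le_one)
  have "C1 (\<lambda>x y z'. integral {0..1} (\<lambda>t. z *\<^sub>R f x y (z * t))) (\<lambda>x y z'. integral {0..1} (\<lambda>t. z *\<^sub>R fx x y (z * t)))
     (\<lambda>x y z'. integral {0..1} (\<lambda>t. z *\<^sub>R fy x y (z * t))) (\<lambda>x y z'. integral {0..1} (\<lambda>t::real. 0))"
    by (rule C1_param; intro cont3_comp[OF c(1)] cont3_comp[OF c(2)] cont3_comp[OF c(3)]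
      continuous_intros bounded_linear.has_vector_derivative[OF bounded_linear_scaleR_right] C1D(5-6)[OF f] zt
      has_vector_derivative_const; assumption?)
  note * = C1D(5)[OF this z] C1D(6)[OF this z]
  show "((\<lambda>s. zprim f s y z) has_vector_derivative zprim fx x y z) (at x)"
    "((\<lambda>s. zprim f x s z) has_vector_derivative zprim fy x y z) (at y)"
    using *[of y x] *[of x y] unfolding zprim_def lint_def by simp_all
  show "((\<lambda>s. zprim f x y s) has_vector_derivative f x y z) (at z within {0..1})"
    unfolding zprim_def
    by (rule lint_deriv) (rule cont3_slices[OF c(1)])
qed

lemma has_vector_derivative_shift:
  assumes "(f has_vector_derivative f') (at (x + c))"
  shows "((\<lambda>s. f (s + c)) has_vector_derivative f') (at x)"
proof -
  have "((\<lambda>s. s + c) has_vector_derivative 1) (at x)"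
    by (auto intro!: derivative_eq_intros)
  from vector_diff_chain_at[OF this assms] show ?thesis by (simp add: o_def)
qed

lemma C1_shx:
  assumes w: "continuous_on UNIV w" and f: "C1 f fx fy fz"
  shows "C1 (shx w e f) (shx w e fx) (shx w e fy) (shx w e fz)"
proof -
  note c = C1D(1-4)[OF f]
  show ?thesis unfolding shx_def[abs_def]
    by (rule C1_param; intro cont3_comp[OF c(1)] cont3_comp[OF c(2)] cont3_comp[OF c(3)] cont3_comp[OF c(4)]
      continuous_intros continuous_on_compose2[OF w] bounded_linear.has_vector_derivative[OF bounded_linear_scaleR_right]
      has_vector_derivative_shift[where f="\<lambda>x. f x y z" for y z] C1D(5-7)[OF f]; (assumption | simp)?)
qed

lemma C1_shy:
  assumes w: "continuous_on UNIV w" and f: "C1 f fx fy fz"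
  shows "C1 (shy w e f) (shy w e fx) (shy w e fy) (shy w e fz)"
proof -
  note c = C1D(1-4)[OF f]
  show ?thesis unfolding shy_def[abs_def]
    by (rule C1_param; intro cont3_comp[OF c(1)] cont3_comp[OF c(2)] cont3_comp[OF c(3)] cont3_comp[OF c(4)]
      continuous_intros continuous_on_compose2[OF w] bounded_linear.has_vector_derivative[OF bounded_linear_scaleR_right]
      has_vector_derivative_shift[where f="\<lambda>y. f x y z" for x z] C1D(5-7)[OF f]; (assumption | simp)?)
qed

text \<open>
  A planar divergence-free field has a stream function. The path of integration runs along the line
  \<open>y = y0\<close> first; which line is used decides how well the stream function can be estimated, so it
  stays a parameter.
\<close>
lemma C1_stream:
  fixes p q :: "real \<Rightarrow> real \<Rightarrow> real \<Rightarrow> real"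
  assumes p: "C1 p px py pz" and q: "C1 q qx qy qz"
    and zp: "\<And>x y z. p x y z = p x y 0" and zq: "\<And>x y z. q x y z = q x y 0"
    and div: "\<And>x y. px x y 0 + qy x y 0 = 0"
  shows "C1 (\<lambda>x y z. lint (\<lambda>t. p x t 0) y0 y - lint (\<lambda>s. q s y0 0) x0 x) (\<lambda>x y z. - q x y z) p (\<lambda>x y z. 0)"
proof (rule C1I)
  note c = C1D(1-4)[OF p] C1D(1-4)[OF q]
  show "cont3 (\<lambda>x y z. lint (\<lambda>t. p x t 0) y0 y - lint (\<lambda>s. q s y0 0) x0 x)"
    unfolding lint_def
    by (intro cont3I continuous_on_integral_param cont3_comp[OF c(1)] cont3_comp[OF c(5)] continuous_intros)
  show "cont3 (\<lambda>x y z. - q x y z)" "cont3 p" "cont3 (\<lambda>x y z. 0::real)"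
    by (intro c cont3I cont3_comp[OF c(5)] continuous_intros)+
  fix x y z :: real assume z: "0 \<le> z" "z \<le> 1"
  have "C1 (\<lambda>x z z'. integral {0..1} (\<lambda>t. (y - y0) *\<^sub>R p x (y0 + (y - y0) * t) 0))
     (\<lambda>x z z'. integral {0..1} (\<lambda>t. (y - y0) *\<^sub>R px x (y0 + (y - y0) * t) 0))
     (\<lambda>x z z'. integral {0..1} (\<lambda>t::real. 0)) (\<lambda>x z z'. integral {0..1} (\<lambda>t::real. 0))"
    by (rule C1_param; intro cont3_comp[OF c(1)] cont3_comp[OF c(2)]
      continuous_intros bounded_linear.has_vector_derivative[OF bounded_linear_scaleR_right] C1D(5)[OF p]
      has_vector_derivative_const; simp?)
  from C1D(5)[OF this z]
  have d1: "((\<lambda>s. lint (\<lambda>t. p s t 0) y0 y) has_vector_derivative lint (\<lambda>t. px x t 0) y0 y) (at x)"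
    unfolding lint_def .
  have "lint (\<lambda>t. px x t 0) y0 y = (- q x y 0) - (- q x y0 0)"
  proof (rule lint_FTC[where S=UNIV])
    fix s
    have "((\<lambda>s. - q x s 0) has_vector_derivative - qy x s 0) (at s)"
      by (intro has_vector_derivative_minus C1D(6)[OF q]) auto
    moreover have "px x s 0 = - qy x s 0" using div[of x s] by simp
    ultimately show "((\<lambda>s. - q x s 0) has_vector_derivative px x s 0) (at s)" by simp
  qed auto
  moreover have "((\<lambda>x. lint (\<lambda>s. q s y0 0) x0 x) has_vector_derivative q x y0 0) (at x)"
    using lint_deriv[of "\<lambda>s. q s y0 0" x0 x UNIV] cont3_slices(1)[OF c(5)] by simp
  ultimately show "((\<lambda>x. lint (\<lambda>t. p x t 0) y0 y - lint (\<lambda>s. q s y0 0) x0 x) has_vector_derivative - q x y z) (at x)"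
    using has_vector_derivative_diff[OF d1] zq[of x y z] by fastforce
  have "((\<lambda>y. lint (\<lambda>t. p x t 0) y0 y) has_vector_derivative p x y 0) (at y)"
    using lint_deriv[of "\<lambda>t. p x t 0" y0 y UNIV] cont3_slices(2)[OF c(1)] by simp
  from has_vector_derivative_diff[OF this has_vector_derivative_const]
  show "((\<lambda>y. lint (\<lambda>t. p x t 0) y0 y - lint (\<lambda>s. q s y0 0) x0 x) has_vector_derivative p x y z) (at y)"
    using zp[of x y z] by simp
  show "((\<lambda>z. lint (\<lambda>t. p x t 0) y0 y - lint (\<lambda>s. q s y0 0) x0 x) has_vector_derivative 0) (at z within {0..1})"
    by (rule has_vector_derivative_const)
qed

section \<open>Flows in the slab\<close>

text \<open>
  A steady flow in coordinates. Of the second derivatives only the pure ones occur, as only the Laplacian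
  enters the argument.
\<close>
locale slab_flow =
  fixes U Ux Uy Uz Uxx Uyy Uzz :: "real \<Rightarrow> real \<Rightarrow> real \<Rightarrow> real^3"
    and P Px Py Pz :: "real \<Rightarrow> real \<Rightarrow> real \<Rightarrow> real"
  assumes U: "C1 U Ux Uy Uz" and P: "C1 P Px Py Pz"
    and U2: "cont3 Uxx" "cont3 Uyy" "cont3 Uzz"
      "\<And>x y z. \<lbrakk>0 \<le> z; z \<le> 1\<rbrakk> \<Longrightarrow> ((\<lambda>s. Ux s y z) has_vector_derivative Uxx x y z) (at x)"
      "\<And>x y z. \<lbrakk>0 \<le> z; z \<le> 1\<rbrakk> \<Longrightarrow> ((\<lambda>s. Uy x s z) has_vector_derivative Uyy x y z) (at y)"
      "\<And>x y z. \<lbrakk>0 \<le> z; z \<le> 1\<rbrakk> \<Longrightarrow> ((\<lambda>s. Uz x y s) has_vector_derivative Uzz x y z) (at z within {0..1})"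
    and momentum: "\<And>x y z. \<lbrakk>0 \<le> z; z \<le> 1\<rbrakk> \<Longrightarrow> Uxx x y z + Uyy x y z + Uzz x y z =
       (U x y z $ 1) *\<^sub>R Ux x y z + (U x y z $ 2) *\<^sub>R Uy x y z + (U x y z $ 3) *\<^sub>R Uz x y z
        + vector [Px x y z, Py x y z, Pz x y z]"
    and incompressible: "\<And>x y z. \<lbrakk>0 \<le> z; z \<le> 1\<rbrakk> \<Longrightarrow> Ux x y z $ 1 + Uy x y z $ 2 + Uz x y z $ 3 = 0"
    and noslip: "\<And>x y. U x y 0 = 0" "\<And>x y. U x y 1 = 0"
begin

definition gsq :: "real \<Rightarrow> real \<Rightarrow> real \<Rightarrow> real" where
  "gsq x y z = (norm (Ux x y z))\<^sup>2 + (norm (Uy x y z))\<^sup>2 + (norm (Uz x y z))\<^sup>2"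

text \<open>
  This is \<open>((u \<cdot> \<nabla>)u - \<nabla>(|u|\<^sup>2/2)) \<cdot> w\<close>, that is, the vorticity form \<open>(curl u \<times> u) \<cdot> w\<close> of the nonlinearity. It
  vanishes for \<open>w\<close> parallel to \<open>u\<close>.
\<close>
definition adv :: "real \<Rightarrow> real \<Rightarrow> real \<Rightarrow> real^3 \<Rightarrow> real" where
  "adv x y z w = ((U x y z $ 1) *\<^sub>R Ux x y z + (U x y z $ 2) *\<^sub>R Uy x y z + (U x y z $ 3) *\<^sub>R Uz x y z) \<bullet> w
     - ((Ux x y z \<bullet> U x y z) * w $ 1 + (Uy x y z \<bullet> U x y z) * w $ 2 + (Uz x y z \<bullet> U x y z) * w $ 3)"

lemmas cU = cont3_comp[OF C1D(1)[OF U]] cont3_comp[OF C1D(2)[OF U]] cont3_comp[OF C1D(3)[OF U]] cont3_comp[OF C1D(4)[OF U]]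

lemma cont3_gsq: "cont3 gsq"
  unfolding gsq_def by (intro cont3I continuous_intros cU)

lemma gsq_nonneg: "0 \<le> gsq x y z" by (simp add: gsq_def)

text \<open>
  The field \<open>\<phi> U + W\<close> is divergence-free and vanishes on the boundary of the box. So the divergence theorem,
  applied to \<open>\<nabla>u \<cdot> w - (P + |u|\<^sup>2/2) w\<close>, yields an identity without pressure; adding \<open>|u|\<^sup>2/2\<close> to the pressure
  removes the cubic term \<open>|u|\<^sup>2 u \<cdot> \<nabla>\<phi>\<close> as well, which would otherwise need a separate estimate.
\<close>
lemma test_identity:
  assumes phi: "C1 \<phi> \<phi>x \<phi>y (\<lambda>x y z. 0)" and W: "C1 W Wx Wy Wz" and L: "0 \<le> L"
    and supp: "\<And>x y z. \<bar>x\<bar> = L \<or> \<bar>y\<bar> = L \<Longrightarrow> \<phi> x y z = 0 \<and> W x y z = 0"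
    and bd: "\<And>x y. W x y 0 = 0" "\<And>x y. W x y 1 = 0"
    and div: "\<And>x y z. \<lbrakk>0 \<le> z; z \<le> 1\<rbrakk> \<Longrightarrow>
       Wx x y z $ 1 + Wy x y z $ 2 + Wz x y z $ 3 = - (\<phi>x x y z * U x y z $ 1 + \<phi>y x y z * U x y z $ 2)"
  shows "I3 L (\<lambda>x y z. \<phi> x y z * gsq x y z + (\<phi>x x y z * (Ux x y z \<bullet> U x y z) + \<phi>y x y z * (Uy x y z \<bullet> U x y z)
     + (Ux x y z \<bullet> Wx x y z + Uy x y z \<bullet> Wy x y z + Uz x y z \<bullet> Wz x y z) + adv x y z (W x y z))) = 0"
proof -
  define w wx wy wz where "w x y z = \<phi> x y z *\<^sub>R U x y z + W x y z"
    and "wx x y z = \<phi> x y z *\<^sub>R Ux x y z + \<phi>x x y z *\<^sub>R U x y z + Wx x y z"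
    and "wy x y z = \<phi> x y z *\<^sub>R Uy x y z + \<phi>y x y z *\<^sub>R U x y z + Wy x y z"
    and "wz x y z = \<phi> x y z *\<^sub>R Uz x y z + (0::real) *\<^sub>R U x y z + Wz x y z" for x y z
  have w: "C1 w wx wy wz"
    using C1_add[OF C1_scaleR[OF phi U] W] unfolding w_def[abs_def] wx_def[abs_def] wy_def[abs_def] wz_def[abs_def] .
  define H Hx Hy Hz where "H x y z = P x y z + (1/2) *\<^sub>R (U x y z \<bullet> U x y z)"
    and "Hx x y z = Px x y z + (1/2) *\<^sub>R (U x y z \<bullet> Ux x y z + Ux x y z \<bullet> U x y z)"
    and "Hy x y z = Py x y z + (1/2) *\<^sub>R (U x y z \<bullet> Uy x y z + Uy x y z \<bullet> U x y z)"
    and "Hz x y z = Pz x y z + (1/2) *\<^sub>R (U x y z \<bullet> Uz x y z + Uz x y z \<bullet> U x y z)" for x y z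
  have H: "C1 H Hx Hy Hz"
    using C1_add[OF P C1_linear[OF bounded_linear_scaleR_right C1_inner[OF U U]], of "1/2"]
    unfolding H_def[abs_def] Hx_def[abs_def] Hy_def[abs_def] Hz_def[abs_def] .
  define X where "X x y z = Uxx x y z \<bullet> w x y z + Ux x y z \<bullet> wx x y z - (Hx x y z * w x y z $ 1 + H x y z * wx x y z $ 1)" for x y z
  define Y where "Y x y z = Uyy x y z \<bullet> w x y z + Uy x y z \<bullet> wy x y z - (Hy x y z * w x y z $ 2 + H x y z * wy x y z $ 2)" for x y z
  define Z where "Z x y z = Uzz x y z \<bullet> w x y z + Uz x y z \<bullet> wz x y z - (Hz x y z * w x y z $ 3 + H x y z * wz x y z $ 3)" for x y z
  note cc = cU cont3_comp[OF C1D(1)[OF w]] cont3_comp[OF C1D(2)[OF w]] cont3_comp[OF C1D(3)[OF w]] cont3_comp[OF C1D(4)[OF w]]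
    cont3_comp[OF C1D(1)[OF H]] cont3_comp[OF C1D(2)[OF H]] cont3_comp[OF C1D(3)[OF H]] cont3_comp[OF C1D(4)[OF H]]
    cont3_comp[OF U2(1)] cont3_comp[OF U2(2)] cont3_comp[OF U2(3)]
  have cX: "cont3 X" "cont3 Y" "cont3 Z"
    unfolding X_def Y_def Z_def by (intro cont3I continuous_intros cc)+
  have w0: "w x y 0 = 0" "w x y 1 = 0" for x y
    by (simp_all add: w_def noslip bd)
  have wL: "w x y z = 0" if "\<bar>x\<bar> = L \<or> \<bar>y\<bar> = L" for x y z
    using supp[OF that] by (simp add: w_def)
  have "I3 L X = 0"
  proof (rule I3_dx_zero[OF cX(1) L, where f="\<lambda>x y z. Ux x y z \<bullet> w x y z - H x y z * w x y z $ 1"])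
    fix x y z :: real assume z: "0 \<le> z" "z \<le> 1"
    show "((\<lambda>s. Ux s y z \<bullet> w s y z - H s y z * w s y z $ 1) has_vector_derivative X x y z) (at x)"
      using has_vector_derivative_diff[OF
        bounded_bilinear.has_vector_derivative[OF bounded_bilinear_inner U2(4)[OF z] C1D(5)[OF w z]]
        bounded_bilinear.has_vector_derivative[OF bounded_bilinear_mult C1D(5)[OF H z]
          bounded_linear.has_vector_derivative[OF bounded_linear_vec_nth C1D(5)[OF w z]]]]
      by (simp add: X_def add.commute)
  qed (use L in \<open>simp add: wL\<close>)
  moreover have "I3 L Y = 0"
  proof (rule I3_dy_zero[OF cX(2) L, where f="\<lambda>x y z. Uy x y z \<bullet> w x y z - H x y z * w x y z $ 2"])
    fix x y z :: real assume z: "0 \<le> z" "z \<le> 1"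
    show "((\<lambda>s. Uy x s z \<bullet> w x s z - H x s z * w x s z $ 2) has_vector_derivative Y x y z) (at y)"
      using has_vector_derivative_diff[OF
        bounded_bilinear.has_vector_derivative[OF bounded_bilinear_inner U2(5)[OF z] C1D(6)[OF w z]]
        bounded_bilinear.has_vector_derivative[OF bounded_bilinear_mult C1D(6)[OF H z]
          bounded_linear.has_vector_derivative[OF bounded_linear_vec_nth C1D(6)[OF w z]]]]
      by (simp add: Y_def add.commute)
  qed (use L in \<open>simp add: wL\<close>)
  moreover have "I3 L Z = 0"
  proof (rule I3_dz_zero[OF cX(3), where f="\<lambda>x y z. Uz x y z \<bullet> w x y z - H x y z * w x y z $ 3"])
    fix x y z :: real assume z: "0 \<le> z" "z \<le> 1"
    show "((\<lambda>z. Uz x y z \<bullet> w x y z - H x y z * w x y z $ 3) has_vector_derivative Z x y z) (at z within {0..1})"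
      using has_vector_derivative_diff[OF
        bounded_bilinear.has_vector_derivative[OF bounded_bilinear_inner U2(6)[OF z] C1D(7)[OF w z]]
        bounded_bilinear.has_vector_derivative[OF bounded_bilinear_mult C1D(7)[OF H z]
          bounded_linear.has_vector_derivative[OF bounded_linear_vec_nth C1D(7)[OF w z]]]]
      by (simp add: Z_def add.commute)
  qed (simp add: w0)
  moreover have "I3 L (\<lambda>x y z. X x y z + Y x y z + Z x y z) = I3 L X + I3 L Y + I3 L Z"
    by (subst I3_add I3_add, (intro cont3I continuous_intros cont3_comp[OF cX(1)] cont3_comp[OF cX(2)] cont3_comp[OF cX(3)])+)+ simp
  moreover have "X x y z + Y x y z + Z x y z = \<phi> x y z * gsq x y z + (\<phi>x x y z * (Ux x y z \<bullet> U x y z) + \<phi>y x y z * (Uy x y z \<bullet> U x y z)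
     + (Ux x y z \<bullet> Wx x y z + Uy x y z \<bullet> Wy x y z + Uz x y z \<bullet> Wz x y z) + adv x y z (W x y z))" (is "_ = ?R x y z")
    if z: "0 \<le> z" "z \<le> 1" for x y z
  proof -
    have divw: "wx x y z $ 1 + wy x y z $ 2 + wz x y z $ 3 = 0"
      using div[OF z, of x y] arg_cong[OF incompressible[OF z, of x y], of "(*) (\<phi> x y z)"]
      by (simp add: wx_def wy_def wz_def algebra_simps)
    have "Uxx x y z \<bullet> w x y z + Uyy x y z \<bullet> w x y z + Uzz x y z \<bullet> w x y z
       = ((U x y z $ 1) *\<^sub>R Ux x y z + (U x y z $ 2) *\<^sub>R Uy x y z + (U x y z $ 3) *\<^sub>R Uz x y z) \<bullet> w x y z
         + (Px x y z * w x y z $ 1 + Py x y z * w x y z $ 2 + Pz x y z * w x y z $ 3)"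
      by (simp add: inner_add_left[symmetric] momentum[OF z])
         (simp add: inner_add_left inner_vec_def sum_3 algebra_simps)
    then have "X x y z + Y x y z + Z x y z = adv x y z (w x y z)
        + (Ux x y z \<bullet> wx x y z + Uy x y z \<bullet> wy x y z + Uz x y z \<bullet> wz x y z)
        - H x y z * (wx x y z $ 1 + wy x y z $ 2 + wz x y z $ 3)"
      unfolding X_def Y_def Z_def adv_def Hx_def Hy_def Hz_def
      by (simp add: inner_commute[of "U x y z"] algebra_simps)
    also have "\<dots> = ?R x y z"
      unfolding divw
      by (simp add: adv_def gsq_def w_def wx_def wy_def wz_def inner_add_left inner_add_right
         power2_norm_eq_inner algebra_simps)
    finally show ?thesis .
  qed
  then have "I3 L (\<lambda>x y z. X x y z + Y x y z + Z x y z) = I3 L ?R" by (intro I3_cong)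
  ultimately show ?thesis by simp
qed

end

section \<open>Cutoff functions\<close>

definition pos_part :: "real \<Rightarrow> real" where "pos_part t = max 0 t"

lemma pos_part_cont: "continuous_on S pos_part" unfolding pos_part_def[abs_def] by (intro continuous_intros)

lemma pos_part_power_deriv: "((\<lambda>s. pos_part s ^ Suc (Suc n)) has_real_derivative real (Suc (Suc n)) * pos_part s ^ Suc n) (at s)"
proof -
  consider "s > 0" | "s < 0" | "s = 0" by linarith
  then show ?thesis
  proof cases
    case 1
    have "((\<lambda>s. s ^ Suc (Suc n)) has_real_derivative real (Suc (Suc n)) * s ^ Suc n) (at s)"
      by (rule derivative_eq_intros refl | simp)+
    then have "((\<lambda>s. pos_part s ^ Suc (Suc n)) has_real_derivative real (Suc (Suc n)) * s ^ Suc n) (at s)"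
      by (rule has_field_derivative_transform_within_open[where S="{0<..}"]) (use 1 in \<open>auto simp: pos_part_def max_def\<close>)
    then show ?thesis using 1 by (simp add: pos_part_def max_def)
  next
    case 2
    have "((\<lambda>s. 0) has_real_derivative 0) (at s)" by simp
    then have "((\<lambda>s. pos_part s ^ Suc (Suc n)) has_real_derivative 0) (at s)"
      by (rule has_field_derivative_transform_within_open[where S="{..<0}"]) (use 2 in \<open>auto simp: pos_part_def max_def\<close>)
    then show ?thesis using 2 by (simp add: pos_part_def max_def)
  next
    case 3
    have "((\<lambda>h. pos_part h ^ Suc n) \<longlongrightarrow> pos_part 0 ^ Suc n) (at 0)"
      using pos_part_cont[of UNIV] by (intro tendsto_intros) (auto simp: continuous_on_def)
    moreover have "eventually (\<lambda>h. pos_part h ^ Suc n = (pos_part h ^ Suc (Suc n) - pos_part 0 ^ Suc (Suc n)) / (h - 0)) (at 0)"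
      by (auto simp: eventually_at_filter pos_part_def max_def)
    ultimately have "((\<lambda>h. (pos_part h ^ Suc (Suc n) - pos_part 0 ^ Suc (Suc n)) / (h - 0)) \<longlongrightarrow> pos_part 0 ^ Suc n) (at 0)"
      by (rule Lim_transform_eventually)
    then show ?thesis using 3 by (simp add: has_field_derivative_iff pos_part_def)
  qed
qed

lemma pos_part_fourth_deriv: "((\<lambda>s. pos_part s ^ 4) has_real_derivative 4 * pos_part s ^ 3) (at s)"
  using pos_part_power_deriv[of 2 s] by (simp add: numeral_eq_Suc)
lemma pos_part_cube_deriv: "((\<lambda>s. pos_part s ^ 3) has_real_derivative 3 * pos_part s ^ 2) (at s)"
  using pos_part_power_deriv[of 1 s] by (simp add: numeral_eq_Suc)

text \<open>
  A twice continuously differentiable step from 1 down to 0. The inner fourth power makes the derivative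
  small compared with \<open>\<surd>(1 - sstep)\<close>, so that first derivatives of a cutoff are controlled by the
  amount by which it falls short of 1.
\<close>
definition sstep :: "real \<Rightarrow> real" where "sstep t = pos_part (1 - pos_part t ^ 4) ^ 4"
definition sstep1 :: "real \<Rightarrow> real" where "sstep1 t = - 16 * (pos_part t ^ 3 * pos_part (1 - pos_part t ^ 4) ^ 3)"
definition sstep2 :: "real \<Rightarrow> real" where
  "sstep2 t = - 48 * (pos_part t ^ 2 * pos_part (1 - pos_part t ^ 4) ^ 3) + 192 * (pos_part t ^ 6 * pos_part (1 - pos_part t ^ 4) ^ 2)"

lemma sstep_deriv: "(sstep has_real_derivative sstep1 t) (at t)"
proof -
  have "((\<lambda>t. 1 - pos_part t ^ 4) has_real_derivative - (4 * pos_part t ^ 3)) (at t)"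
    using DERIV_diff[OF DERIV_const pos_part_fourth_deriv] by simp
  from DERIV_chain2[OF pos_part_fourth_deriv this] show ?thesis unfolding sstep_def[abs_def] sstep1_def by (simp add: mult_ac)
qed

lemma sstep1_deriv: "(sstep1 has_real_derivative sstep2 t) (at t)"
proof -
  have "((\<lambda>t. 1 - pos_part t ^ 4) has_real_derivative - (4 * pos_part t ^ 3)) (at t)"
    using DERIV_diff[OF DERIV_const pos_part_fourth_deriv] by simp
  from DERIV_cmult[OF DERIV_mult[OF pos_part_cube_deriv DERIV_chain2[OF pos_part_cube_deriv this]], of "-16"]
  show ?thesis unfolding sstep1_def[abs_def] sstep2_def
    by (simp add: algebra_simps power2_eq_square power3_eq_cube numeral_eq_Suc)
qed

lemma sstep2_cont: "continuous_on S sstep2"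
  unfolding sstep2_def[abs_def] by (intro continuous_intros continuous_on_compose2[OF pos_part_cont[of UNIV]]) auto

lemma pos_part_simps: "0 \<le> pos_part t" "t \<le> 0 \<Longrightarrow> pos_part t = 0" "0 \<le> t \<Longrightarrow> pos_part t = t" by (auto simp: pos_part_def)

lemma sstep_range: "0 \<le> sstep t" "sstep t \<le> 1"
proof -
  have "pos_part (1 - pos_part t ^ 4) \<le> 1" by (auto simp: pos_part_def)
  then show "0 \<le> sstep t" "sstep t \<le> 1" unfolding sstep_def by (auto simp: pos_part_simps power_le_one)
qed

lemma sstep_one: "t \<le> 0 \<Longrightarrow> sstep t = 1" by (simp add: sstep_def pos_part_def)

lemma sstep_zero: assumes "1 \<le> t" shows "sstep t = 0" "sstep1 t = 0" "sstep2 t = 0"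
proof -
  have "1 \<le> pos_part t ^ 4" using assms by (simp add: pos_part_def)
  then have "pos_part (1 - pos_part t ^ 4) = 0" by (simp add: pos_part_def)
  then show "sstep t = 0" "sstep1 t = 0" "sstep2 t = 0" by (simp_all add: sstep_def sstep1_def sstep2_def)
qed

lemma sstep_antimono: "s \<le> t \<Longrightarrow> sstep t \<le> sstep s"
proof -
  assume "s \<le> t"
  then have "pos_part s ^ 4 \<le> pos_part t ^ 4" by (intro power_mono) (auto simp: pos_part_def)
  then have "pos_part (1 - pos_part t ^ 4) \<le> pos_part (1 - pos_part s ^ 4)" unfolding pos_part_def[of "1 - _"] by linarith
  then show ?thesis unfolding sstep_def by (intro power_mono) (auto simp: pos_part_simps)
qed

lemma sstep_bounds: "\<bar>sstep1 t\<bar> \<le> 16" "\<bar>sstep2 t\<bar> \<le> 240" "(sstep1 t)\<^sup>2 \<le> 256 * (1 - sstep t)"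
proof -
  have "\<bar>sstep1 t\<bar> \<le> 16 \<and> \<bar>sstep2 t\<bar> \<le> 240 \<and> (sstep1 t)\<^sup>2 \<le> 256 * (1 - sstep t)"
  proof (cases "1 \<le> t")
    case True then show ?thesis using sstep_zero[OF True] by simp
  next
    case False
    define p m where "p = pos_part t" and "m = pos_part (1 - p ^ 4)"
    have p: "0 \<le> p" "p \<le> 1" using False by (auto simp: p_def pos_part_def)
    have p4: "0 \<le> p^4" "p ^ 4 \<le> 1" using p by (auto simp: power_le_one)
    then have m: "m = 1 - p ^ 4" by (simp add: m_def pos_part_def)
    have m01: "0 \<le> m" "m \<le> 1" using p4 m by auto
    have 1: "0 \<le> p ^ a * m ^ b" "p ^ a * m ^ b \<le> 1" for a b
      using p m01 by (auto intro!: mult_le_one power_le_one)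
    have "\<bar>sstep1 t\<bar> \<le> 16" "\<bar>sstep2 t\<bar> \<le> 240"
      unfolding sstep1_def sstep2_def p_def[symmetric] m_def[symmetric]
      using 1[of 3 3] 1[of 2 3] 1[of 6 2] by linarith+
    moreover have "(sstep1 t)\<^sup>2 = 256 * (p ^ 4 * (p ^ 2 * m ^ 6))"
      unfolding sstep1_def p_def[symmetric] m_def[symmetric]
      by (simp add: power_mult_distrib algebra_simps flip: power_mult power_add)
    moreover have "p ^ 4 * (p ^ 2 * m ^ 6) \<le> p ^ 4"
      using mult_left_mono[OF 1(2)[of 2 6] p4(1)] by simp
    moreover have "sstep t \<le> m"
      using power_decreasing[of 1 4 m] m01 by (simp add: sstep_def m_def p_def)
    ultimately show ?thesis using m by simp
  qed
  then show "\<bar>sstep1 t\<bar> \<le> 16" "\<bar>sstep2 t\<bar> \<le> 240" "(sstep1 t)\<^sup>2 \<le> 256 * (1 - sstep t)" by auto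
qed

text \<open>
  The squared radius is used because it is smooth on the axis.
\<close>
definition ctau :: "real \<Rightarrow> real \<Rightarrow> real \<Rightarrow> real \<Rightarrow> real" where
  "ctau s t x y = (x\<^sup>2 + y\<^sup>2 - s\<^sup>2) / (t\<^sup>2 - s\<^sup>2)"
definition cutoff :: "real \<Rightarrow> real \<Rightarrow> real \<Rightarrow> real \<Rightarrow> real \<Rightarrow> real" where
  "cutoff s t x y z = sstep (ctau s t x y)"
definition cutoff_x :: "real \<Rightarrow> real \<Rightarrow> real \<Rightarrow> real \<Rightarrow> real \<Rightarrow> real" where
  "cutoff_x s t x y z = (2 * x / (t\<^sup>2 - s\<^sup>2)) * sstep1 (ctau s t x y)"
definition cutoff_y :: "real \<Rightarrow> real \<Rightarrow> real \<Rightarrow> real \<Rightarrow> real \<Rightarrow> real" where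
  "cutoff_y s t x y z = (2 * y / (t\<^sup>2 - s\<^sup>2)) * sstep1 (ctau s t x y)"
definition cutoff_xx :: "real \<Rightarrow> real \<Rightarrow> real \<Rightarrow> real \<Rightarrow> real \<Rightarrow> real" where
  "cutoff_xx s t x y z = (2 * x / (t\<^sup>2 - s\<^sup>2)) * ((2 * x / (t\<^sup>2 - s\<^sup>2)) * sstep2 (ctau s t x y)) + (2 / (t\<^sup>2 - s\<^sup>2)) * sstep1 (ctau s t x y)"
definition cutoff_xy :: "real \<Rightarrow> real \<Rightarrow> real \<Rightarrow> real \<Rightarrow> real \<Rightarrow> real" where
  "cutoff_xy s t x y z = (2 * x / (t\<^sup>2 - s\<^sup>2)) * ((2 * y / (t\<^sup>2 - s\<^sup>2)) * sstep2 (ctau s t x y))"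
definition cutoff_yy :: "real \<Rightarrow> real \<Rightarrow> real \<Rightarrow> real \<Rightarrow> real \<Rightarrow> real" where
  "cutoff_yy s t x y z = (2 * y / (t\<^sup>2 - s\<^sup>2)) * ((2 * y / (t\<^sup>2 - s\<^sup>2)) * sstep2 (ctau s t x y)) + (2 / (t\<^sup>2 - s\<^sup>2)) * sstep1 (ctau s t x y)"

lemma sstep_cont: "continuous_on S sstep" "continuous_on S sstep1"
  by (auto intro!: continuous_at_imp_continuous_on DERIV_isCont sstep_deriv sstep1_deriv)

lemma ctau_deriv:
  "((\<lambda>x. ctau s t x y) has_real_derivative (2 * x / (t\<^sup>2 - s\<^sup>2))) (at x)"
  "((\<lambda>y. ctau s t x y) has_real_derivative (2 * y / (t\<^sup>2 - s\<^sup>2))) (at y)"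
  unfolding ctau_def by (auto intro!: derivative_eq_intros DERIV_cdivide)

lemma ctau_cont: "continuous_on S a \<Longrightarrow> continuous_on S b \<Longrightarrow> continuous_on S (\<lambda>p. ctau s t (a p) (b p))"
  unfolding ctau_def divide_inverse by (intro continuous_intros)

lemmas cutoff_cont_rules = continuous_on_compose2[OF sstep_cont(1)[of UNIV]] continuous_on_compose2[OF sstep_cont(2)[of UNIV]]
  continuous_on_compose2[OF sstep2_cont[of UNIV]] ctau_cont

lemma lin_deriv: "((\<lambda>x. 2 * x / c) has_real_derivative 2 / c) (at x)" for c :: real
  by (auto intro!: derivative_eq_intros DERIV_cdivide)

lemma cont3_cutoff: "cont3 (cutoff s t)" "cont3 (cutoff_x s t)" "cont3 (cutoff_y s t)" "cont3 (cutoff_xx s t)" "cont3 (cutoff_xy s t)" "cont3 (cutoff_yy s t)"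
  unfolding cutoff_def cutoff_x_def cutoff_y_def cutoff_xx_def cutoff_xy_def cutoff_yy_def divide_inverse
  by (intro cont3I continuous_intros cutoff_cont_rules subset_UNIV)+

lemma C1_cutoff: "C1 (cutoff s t) (cutoff_x s t) (cutoff_y s t) (\<lambda>x y z. 0)"
proof (rule C1I)
  fix x y z :: real
  show "((\<lambda>u. cutoff s t u y z) has_vector_derivative cutoff_x s t x y z) (at x)"
    "((\<lambda>u. cutoff s t x u z) has_vector_derivative cutoff_y s t x y z) (at y)"
    using DERIV_chain2[OF sstep_deriv ctau_deriv(1)[of s t y x]] DERIV_chain2[OF sstep_deriv ctau_deriv(2)[of s t x y]]
    unfolding has_real_derivative_iff_has_vector_derivative[symmetric] cutoff_def cutoff_x_def cutoff_y_def by (simp_all add: mult.commute)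
  show "((\<lambda>u. cutoff s t x y u) has_vector_derivative 0) (at z within {0..1})"
    unfolding cutoff_def by (rule has_vector_derivative_const)
qed (intro cont3_cutoff cont3I continuous_intros)+

lemma C1_cutoff_x: "C1 (cutoff_x s t) (cutoff_xx s t) (cutoff_xy s t) (\<lambda>x y z. 0)"
proof (rule C1I)
  fix x y z :: real
  have "((\<lambda>u. cutoff_x s t u y z) has_real_derivative cutoff_xx s t x y z) (at x)"
    using DERIV_mult[OF lin_deriv DERIV_chain2[OF sstep1_deriv ctau_deriv(1)[of s t y x]]]
    unfolding cutoff_x_def cutoff_xx_def by (simp add: ac_simps)
  then show "((\<lambda>u. cutoff_x s t u y z) has_vector_derivative cutoff_xx s t x y z) (at x)"
    by (simp add: has_real_derivative_iff_has_vector_derivative)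
  have "((\<lambda>u. cutoff_x s t x u z) has_real_derivative cutoff_xy s t x y z) (at y)"
    using DERIV_cmult[OF DERIV_chain2[OF sstep1_deriv ctau_deriv(2)[of s t x y]], of "2 * x / (t\<^sup>2 - s\<^sup>2)"]
    unfolding cutoff_x_def cutoff_xy_def by (simp add: ac_simps)
  then show "((\<lambda>u. cutoff_x s t x u z) has_vector_derivative cutoff_xy s t x y z) (at y)"
    by (simp add: has_real_derivative_iff_has_vector_derivative)
  show "((\<lambda>u. cutoff_x s t x y u) has_vector_derivative 0) (at z within {0..1})"
    unfolding cutoff_x_def by (rule has_vector_derivative_const)
qed (intro cont3_cutoff cont3I continuous_intros)+

lemma cutoff_sym: "cutoff s t x y z = cutoff s t y x z" "cutoff_y s t x y z = cutoff_x s t y x z" "cutoff_yy s t x y z = cutoff_xx s t y x z"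
   "cutoff_xy s t x y z = cutoff_xy s t y x z"
  by (simp_all add: cutoff_def cutoff_y_def cutoff_x_def cutoff_xx_def cutoff_yy_def cutoff_xy_def ctau_def add.commute)

lemma C1_cutoff_y: "C1 (cutoff_y s t) (cutoff_xy s t) (cutoff_yy s t) (\<lambda>x y z. 0)"
proof (rule C1I)
  fix x y z :: real assume z: "0 \<le> z" "z \<le> 1"
  show "((\<lambda>u. cutoff_y s t u y z) has_vector_derivative cutoff_xy s t x y z) (at x)"
     "((\<lambda>u. cutoff_y s t x u z) has_vector_derivative cutoff_yy s t x y z) (at y)"
    using C1D(6)[OF C1_cutoff_x z, of s t y x] C1D(5)[OF C1_cutoff_x z, of s t x y]
    by (simp_all add: cutoff_sym(2,3) cutoff_sym(4)[of s t x y])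
  show "((\<lambda>u. cutoff_y s t x y u) has_vector_derivative 0) (at z within {0..1})"
    unfolding cutoff_y_def by (rule has_vector_derivative_const)
qed (intro cont3_cutoff cont3I continuous_intros)+

lemma cutoff_range: "0 \<le> cutoff s t x y z" "cutoff s t x y z \<le> 1"
  by (simp_all add: cutoff_def sstep_range)

lemma cutoff_one:
  assumes "0 \<le> s" "s < t" "x\<^sup>2 + y\<^sup>2 \<le> s\<^sup>2" shows "cutoff s t x y z = 1"
proof -
  have "s\<^sup>2 < t\<^sup>2" using assms by (simp add: power_strict_mono)
  then show ?thesis using assms unfolding cutoff_def ctau_def by (intro sstep_one divide_nonpos_pos) auto
qed

lemma cutoff_zero:
  assumes "0 \<le> s" "s < t" "t\<^sup>2 \<le> x\<^sup>2 + y\<^sup>2"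
  shows "cutoff s t x y z = 0" "cutoff_x s t x y z = 0" "cutoff_y s t x y z = 0" "cutoff_xx s t x y z = 0" "cutoff_xy s t x y z = 0" "cutoff_yy s t x y z = 0"
proof -
  have "s\<^sup>2 < t\<^sup>2" using assms by (simp add: power_strict_mono)
  then have "1 \<le> ctau s t x y" using assms unfolding ctau_def by simp
  from sstep_zero[OF this] show "cutoff s t x y z = 0" "cutoff_x s t x y z = 0" "cutoff_y s t x y z = 0" "cutoff_xx s t x y z = 0" "cutoff_xy s t x y z = 0" "cutoff_yy s t x y z = 0"
    by (simp_all add: cutoff_def cutoff_x_def cutoff_y_def cutoff_xx_def cutoff_xy_def cutoff_yy_def)
qed

text \<open>
  On the support of the derivatives \<open>|x| \<le> t\<close>, hence \<open>2|x| / (t\<^sup>2 - s\<^sup>2) \<le> 2 / (t - s)\<close>, and all bounds follow from those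
  for the step. The constant 1000 covers all cases.
\<close>
lemma cutoff_x_bounds:
  assumes st: "0 \<le> s" "s < t"
  shows "\<bar>cutoff_x s t x y z\<bar> \<le> 1000 / (t - s)" "\<bar>cutoff_xx s t x y z\<bar> \<le> 1000 / (t - s)\<^sup>2" "\<bar>cutoff_xy s t x y z\<bar> \<le> 1000 / (t - s)\<^sup>2"
    "(cutoff_x s t x y z)\<^sup>2 \<le> (1000 / (t - s))\<^sup>2 * (1 - cutoff s t x y z)"
proof -
  have "\<bar>cutoff_x s t x y z\<bar> \<le> 1000 / (t - s) \<and> \<bar>cutoff_xx s t x y z\<bar> \<le> 1000 / (t - s)\<^sup>2 \<and> \<bar>cutoff_xy s t x y z\<bar> \<le> 1000 / (t - s)\<^sup>2
    \<and> (cutoff_x s t x y z)\<^sup>2 \<le> (1000 / (t - s))\<^sup>2 * (1 - cutoff s t x y z)"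
  proof (cases "t\<^sup>2 \<le> x\<^sup>2 + y\<^sup>2")
    case True
    from cutoff_zero[OF st this] show ?thesis using st by simp
  next
    case False
    define l where "l = t - s"
    have l: "0 < l" using st by (simp add: l_def)
    have D: "t\<^sup>2 - s\<^sup>2 = l * (t + s)" by (simp add: l_def power2_eq_square algebra_simps)
    have xy: "\<bar>x\<bar> \<le> t" "\<bar>y\<bar> \<le> t"
    proof -
      have "x\<^sup>2 \<le> t\<^sup>2" "y\<^sup>2 \<le> t\<^sup>2"
        using False zero_le_power2[of x] zero_le_power2[of y] by linarith+
      then show "\<bar>x\<bar> \<le> t" "\<bar>y\<bar> \<le> t" using st by (simp_all add: abs_le_square_iff[symmetric])
    qed
    have a: "\<bar>2 * x / (t\<^sup>2 - s\<^sup>2)\<bar> \<le> 2 / l" "\<bar>2 * y / (t\<^sup>2 - s\<^sup>2)\<bar> \<le> 2 / l"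
    proof -
      have *: "\<bar>2 * w / (t\<^sup>2 - s\<^sup>2)\<bar> \<le> 2 / l" if "\<bar>w\<bar> \<le> t" for w
      proof -
        have "\<bar>w\<bar> / (t + s) \<le> 1" using that st by simp
        from mult_left_mono[OF this, of "2 / l"]
        have "(2 / l) * (\<bar>w\<bar> / (t + s)) \<le> 2 / l" using l by simp
        then show ?thesis unfolding D using l st by (simp add: abs_mult)
      qed
      then show "\<bar>2 * x / (t\<^sup>2 - s\<^sup>2)\<bar> \<le> 2 / l" "\<bar>2 * y / (t\<^sup>2 - s\<^sup>2)\<bar> \<le> 2 / l" using xy by blast+
    qed
    have b: "\<bar>2 / (t\<^sup>2 - s\<^sup>2)\<bar> \<le> 2 / l\<^sup>2"
    proof -
      have "l\<^sup>2 \<le> l * (t + s)" using st l by (simp add: power2_eq_square l_def mult_left_mono)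
      then have "2 / (l * (t + s)) \<le> 2 / l\<^sup>2" using l st by (intro divide_left_mono) auto
      then show ?thesis unfolding D using l st by simp
    qed
    define T where "T = ctau s t x y"
    have "\<bar>cutoff_x s t x y z\<bar> \<le> (2 / l) * 16"
      unfolding cutoff_x_def abs_mult using a l sstep_bounds by (intro mult_mono) auto
    then have 1: "\<bar>cutoff_x s t x y z\<bar> \<le> 1000 / l" using l by (simp add: field_simps)
    have 2: "\<bar>(2 * x / (t\<^sup>2 - s\<^sup>2)) * ((2 * w / (t\<^sup>2 - s\<^sup>2)) * sstep2 T)\<bar> \<le> (2 / l) * ((2 / l) * 240)" if "w = x \<or> w = y" for w
      unfolding abs_mult using a l sstep_bounds that by (intro mult_mono mult_nonneg_nonneg) auto
    have 3: "\<bar>(2 / (t\<^sup>2 - s\<^sup>2)) * sstep1 T\<bar> \<le> (2 / l\<^sup>2) * 16"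
      unfolding abs_mult using b l sstep_bounds by (intro mult_mono) auto
    have "\<bar>cutoff_xx s t x y z\<bar> \<le> (2 / l) * ((2 / l) * 240) + (2 / l\<^sup>2) * 16"
      unfolding cutoff_xx_def T_def[symmetric] using 2[of x] 3 by (intro order_trans[OF abs_triangle_ineq] add_mono) auto
    also have "\<dots> = 992 / l\<^sup>2" using l by (simp add: field_simps power2_eq_square)
    also have "\<dots> \<le> 1000 / l\<^sup>2" using l by (simp add: field_simps)
    finally have 4: "\<bar>cutoff_xx s t x y z\<bar> \<le> 1000 / l\<^sup>2" .
    have "\<bar>cutoff_xy s t x y z\<bar> \<le> (2 / l) * ((2 / l) * 240)"
      unfolding cutoff_xy_def T_def[symmetric] using 2[of y] by simp
    also have "\<dots> \<le> 1000 / l\<^sup>2" using l by (simp add: field_simps power2_eq_square)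
    finally have 5: "\<bar>cutoff_xy s t x y z\<bar> \<le> 1000 / l\<^sup>2" .
    have "(cutoff_x s t x y z)\<^sup>2 = (2 * x / (t\<^sup>2 - s\<^sup>2))\<^sup>2 * (sstep1 T)\<^sup>2"
      unfolding cutoff_x_def T_def power_mult_distrib ..
    also have "\<dots> \<le> (2 / l)\<^sup>2 * (256 * (1 - sstep T))"
      using a(1) sstep_bounds(3)[of T] l by (intro mult_mono) (auto simp: abs_le_square_iff[symmetric])
    also have "\<dots> = (1024 / l\<^sup>2) * (1 - sstep T)" by (simp add: power2_eq_square)
    also have "\<dots> \<le> (1000 / l)\<^sup>2 * (1 - sstep T)"
      using sstep_range[of T] l by (intro mult_right_mono) (auto simp: field_simps power2_eq_square)
    finally show ?thesis using 1 4 5 by (simp add: l_def cutoff_def T_def)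
  qed
  then show "\<bar>cutoff_x s t x y z\<bar> \<le> 1000 / (t - s)" "\<bar>cutoff_xx s t x y z\<bar> \<le> 1000 / (t - s)\<^sup>2" "\<bar>cutoff_xy s t x y z\<bar> \<le> 1000 / (t - s)\<^sup>2"
    "(cutoff_x s t x y z)\<^sup>2 \<le> (1000 / (t - s))\<^sup>2 * (1 - cutoff s t x y z)" by auto
qed

lemma cutoff_y_bounds:
  assumes st: "0 \<le> s" "s < t"
  shows "\<bar>cutoff_y s t x y z\<bar> \<le> 1000 / (t - s)" "\<bar>cutoff_yy s t x y z\<bar> \<le> 1000 / (t - s)\<^sup>2"
    "(cutoff_y s t x y z)\<^sup>2 \<le> (1000 / (t - s))\<^sup>2 * (1 - cutoff s t x y z)"
  using cutoff_x_bounds[OF st, of y x z] by (simp_all add: cutoff_sym(2,3) cutoff_sym(1)[of s t x y])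

lemma cutoff_mono:
  assumes "0 < R" "R \<le> R'" shows "cutoff R (2*R) x y z \<le> cutoff R' (2*R') x y z"
proof -
  have e: "ctau R (2*R) x y = ((x\<^sup>2+y\<^sup>2) / R\<^sup>2 - 1) / 3" if "0 < R" for R
    using that by (simp add: ctau_def field_simps power2_eq_square)
  have "R\<^sup>2 \<le> R'\<^sup>2" using assms by (intro power_mono) auto
  then have "(x\<^sup>2+y\<^sup>2) / R'\<^sup>2 \<le> (x\<^sup>2+y\<^sup>2) / R\<^sup>2"
    using assms by (intro divide_left_mono) auto
  then have "ctau R' (2*R') x y \<le> ctau R (2*R) x y" using e[of R] e[of R'] assms by simp
  then show ?thesis unfolding cutoff_def by (rule sstep_antimono)
qed

section \<open>One-dimensional inequalities\<close>

text \<open>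
  The Cauchy-Schwarz inequality with 1, as nonnegativity of the variance.
\<close>
lemma integral_square_le:
  fixes f :: "real \<Rightarrow> real"
  assumes f: "continuous_on {a..b} f" and ab: "a \<le> b"
  shows "(integral {a..b} f)\<^sup>2 \<le> (b - a) * integral {a..b} (\<lambda>t. (f t)\<^sup>2)"
proof (cases "a = b")
  case False
  then have l: "0 < b - a" using ab by simp
  define m where "m = integral {a..b} f / (b - a)"
  note i = integrable_continuous_real[OF f] integrable_continuous_real[OF continuous_on_power[OF f, of 2]]
  have "0 \<le> integral {a..b} (\<lambda>t. (f t - m)\<^sup>2)"
    by (intro integral_nonneg integrable_continuous_real continuous_intros f) auto
  also have "(\<lambda>t. (f t - m)\<^sup>2) = (\<lambda>t. (f t)\<^sup>2 - 2 * m * f t + m\<^sup>2)"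
    by (auto simp: power2_eq_square algebra_simps)
  also have "integral {a..b} (\<lambda>t. (f t)\<^sup>2 - 2 * m * f t + m\<^sup>2)
     = integral {a..b} (\<lambda>t. (f t)\<^sup>2) - 2 * m * integral {a..b} f + m\<^sup>2 * (b - a)"
    using i ab by (simp add: integral_add integral_diff integrable_diff integrable_on_mult_right integrable_const_ivl)
  also have "\<dots> = integral {a..b} (\<lambda>t. (f t)\<^sup>2) - (integral {a..b} f)\<^sup>2 / (b - a)"
  proof -
    have "m * (b - a) = integral {a..b} f" using l by (simp add: m_def)
    then have "m\<^sup>2 * (b - a) = m * integral {a..b} f" "(integral {a..b} f)\<^sup>2 / (b - a) = m * integral {a..b} f"
      by (simp_all add: power2_eq_square mult.assoc m_def)
    then show ?thesis by simp
  qed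
  finally show ?thesis using l by (simp add: field_simps)
qed simp

lemma norm_integral_square_le:
  fixes f :: "real \<Rightarrow> 'b::euclidean_space"
  assumes f: "continuous_on {a..b} f" and ab: "a \<le> b"
  shows "(norm (integral {a..b} f))\<^sup>2 \<le> (b - a) * integral {a..b} (\<lambda>t. (norm (f t))\<^sup>2)"
proof -
  have "norm (integral {a..b} f) \<le> integral {a..b} (\<lambda>t. norm (f t))"
    by (intro integral_norm_bound_integral integrable_continuous_real continuous_intros f) auto
  then have "(norm (integral {a..b} f))\<^sup>2 \<le> (integral {a..b} (\<lambda>t. norm (f t)))\<^sup>2"
    by (intro power_mono) auto
  also have "\<dots> \<le> (b - a) * integral {a..b} (\<lambda>t. (norm (f t))\<^sup>2)"
    by (intro integral_square_le continuous_intros f ab)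
  finally show ?thesis .
qed

lemma exists_le_average:
  fixes f :: "real \<Rightarrow> real"
  assumes f: "continuous_on {a..b} f" and ab: "a \<le> b"
  shows "\<exists>c\<in>{a..b}. (b - a) * f c \<le> integral {a..b} f"
proof -
  obtain c where c: "c \<in> {a..b}" "\<And>t. t \<in> {a..b} \<Longrightarrow> f c \<le> f t"
    using continuous_attains_inf[of "{a..b}" f] f ab by auto
  have "integral {a..b} (\<lambda>t. f c) \<le> integral {a..b} f"
    by (intro integral_le integrable_continuous_real f continuous_intros) (use c in auto)
  then show ?thesis using c ab by (auto intro!: bexI[of _ c])
qed

text \<open>
  The value of \<open>f\<close> at its minimum is at most its mean, and the derivative controls the way from there to
  any other point.
\<close>
lemma sup_le_integral:
  fixes f f' :: "real \<Rightarrow> real"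
  assumes d: "\<And>t. (f has_vector_derivative f' t) (at t)" and c: "continuous_on UNIV f'"
    and ab: "1 \<le> b - a" and x: "x \<in> {a..b}" and pos: "\<And>t. 0 \<le> f t"
  shows "f x \<le> integral {a..b} (\<lambda>t. f t + \<bar>f' t\<bar>)"
proof -
  have f: "continuous_on S f" for S
    using d by (auto intro!: continuous_at_imp_continuous_on has_vector_derivative_continuous)
  obtain t0 where t0: "t0 \<in> {a..b}" "(b - a) * f t0 \<le> integral {a..b} f"
    using exists_le_average[OF f, of a b] ab by auto
  have "f t0 \<le> (b - a) * f t0" using ab pos[of t0] by (simp add: mult_right_mono[of 1 "b-a" "f t0", simplified])
  moreover have "f x - f t0 = lint f' t0 x"
    by (rule lint_FTC[symmetric, where S=UNIV]) (use d in auto)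
  moreover have "norm (lint f' t0 x) \<le> integral {a..b} (\<lambda>t. norm (f' t))"
    by (rule norm_lint_le[OF c t0(1) x])
  moreover have "integral {a..b} (\<lambda>t. f t + \<bar>f' t\<bar>) = integral {a..b} f + integral {a..b} (\<lambda>t. \<bar>f' t\<bar>)"
    by (intro integral_add integrable_continuous_real continuous_intros f continuous_on_subset[OF c]) auto
  ultimately show ?thesis using t0 by simp
qed

section \<open>Estimates by vertical means\<close>

lemma cont3_comps:
  fixes f g :: "real \<Rightarrow> real \<Rightarrow> real \<Rightarrow> real"
  assumes "cont3 f" "cont3 g" shows
    "cont3 (\<lambda>x y z. f x y z + g x y z)" "cont3 (\<lambda>x y z. f x y z - g x y z)" "cont3 (\<lambda>x y z. f x y z * g x y z)"
  by (intro cont3I continuous_intros cont3_comp[OF assms(1)] cont3_comp[OF assms(2)])+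

lemma zavg_const: "zavg f x y z = zavg f x y w" by (simp add: zavg_def)

lemma zavg_planar:
  assumes "\<And>z. f x y z = c" shows "zavg f x y w = c"
proof -
  have "f x y = (\<lambda>z. c)" using assms by blast
  then show ?thesis by (simp add: zavg_def)
qed

lemma zavg_zavg: "zavg (zavg f) x y w = zavg f x y w"
  by (rule zavg_planar) (rule zavg_const)

lemma zavg_mono:
  fixes f g :: "real \<Rightarrow> real \<Rightarrow> real \<Rightarrow> real"
  assumes "cont3 f" "cont3 g" "\<And>z. 0 \<le> z \<Longrightarrow> z \<le> 1 \<Longrightarrow> f x y z \<le> g x y z"
  shows "zavg f x y w \<le> zavg g x y w"
  unfolding zavg_def
  by (intro integral_le integrable_continuous_real cont3_slices(3)) (use assms in auto)

lemma zavg_nonneg: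
  fixes f :: "real \<Rightarrow> real \<Rightarrow> real \<Rightarrow> real"
  assumes "cont3 f" "\<And>z. 0 \<le> z \<Longrightarrow> z \<le> 1 \<Longrightarrow> 0 \<le> f x y z"
  shows "0 \<le> zavg f x y w"
  unfolding zavg_def
  by (intro integral_nonneg integrable_continuous_real cont3_slices(3)) (use assms in auto)

lemma zavg_norm_sq:
  fixes f :: "real \<Rightarrow> real \<Rightarrow> real \<Rightarrow> 'b::euclidean_space"
  assumes "cont3 f"
  shows "(norm (zavg f x y w))\<^sup>2 \<le> zavg (\<lambda>x y z. (norm (f x y z))\<^sup>2) x y w"
  using norm_integral_square_le[of 0 1 "f x y"] cont3_slices(3)[OF assms] by (simp add: zavg_def)

lemma zprim_norm_sq:
  fixes f :: "real \<Rightarrow> real \<Rightarrow> real \<Rightarrow> 'b::euclidean_space"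
  assumes f: "cont3 f" and z: "0 \<le> z" "z \<le> 1"
  shows "(norm (zprim f x y z))\<^sup>2 \<le> zavg (\<lambda>x y z. (norm (f x y z))\<^sup>2) x y w"
proof -
  have "norm (zprim f x y z) \<le> integral {0..1} (\<lambda>t. norm (f x y t))"
    unfolding zprim_def by (rule norm_lint_le[OF cont3_slices(3)[OF f]]) (use z in auto)
  then have "(norm (zprim f x y z))\<^sup>2 \<le> (integral {0..1} (\<lambda>t. norm (f x y t)))\<^sup>2"
    by (intro power_mono) auto
  also have "\<dots> \<le> (1 - 0) * integral {0..1} (\<lambda>t. (norm (f x y t))\<^sup>2)"
    by (intro integral_square_le continuous_intros cont3_slices(3)[OF f]) auto
  finally show ?thesis by (simp add: zavg_def)
qed

lemma zavg_weight:
  fixes f v :: "real \<Rightarrow> real \<Rightarrow> real \<Rightarrow> real"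
  assumes "\<And>z. v x y z = v x y 0"
  shows "zavg (\<lambda>x y z. v x y z * f x y z) x y w = v x y w * zavg f x y w"
proof -
  have "(\<lambda>z. v x y z * f x y z) = (\<lambda>z. v x y 0 * f x y z)" using assms by metis
  then show ?thesis unfolding zavg_def assms[of w] by simp
qed

lemma I3_zavg_iter:
  assumes f: "cont3 f"
  shows "I3 L f = integral {-L..L} (\<lambda>x. integral {-L..L} (\<lambda>y. zavg f x y 0))"
    "I3 L f = integral {-L..L} (\<lambda>y. integral {-L..L} (\<lambda>x. zavg f x y 0))"
  unfolding zavg_def by (rule I3_iterated[OF f], rule I3_iterated_swap[OF f])

lemma I3_zavg:
  assumes f: "cont3 f" shows "I3 L (zavg f) = I3 L f"
  by (simp add: I3_zavg_iter(1)[OF f] I3_zavg_iter(1)[OF cont3_zavg[OF f]] zavg_zavg)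

lemma I3_weight_zavg:
  assumes f: "cont3 f" and v: "cont3 v" and vz: "\<And>x y z. v x y z = v x y 0"
  shows "I3 L (\<lambda>x y z. v x y z * zavg f x y z) = I3 L (\<lambda>x y z. v x y z * f x y z)"
proof -
  have "I3 L (\<lambda>x y z. v x y z * f x y z) = I3 L (zavg (\<lambda>x y z. v x y z * f x y z))"
    by (rule I3_zavg[symmetric]) (intro cont3_comps f v)
  also have "zavg (\<lambda>x y z. v x y z * f x y z) = (\<lambda>x y z. v x y z * zavg f x y z)"
    by (intro ext zavg_weight vz)
  finally show ?thesis by simp
qed

lemma I3_planar:
  assumes f: "cont3 f" and fz: "\<And>x y z. f x y z = f x y 0"
  shows "I3 L f = integral {-L..L} (\<lambda>x. integral {-L..L} (\<lambda>y. f x y 0))"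
    "I3 L f = integral {-L..L} (\<lambda>y. integral {-L..L} (\<lambda>x. f x y 0))"
proof -
  have "zavg f x y 0 = f x y 0" for x y
    by (rule zavg_planar) (rule fz)
  then show "I3 L f = integral {-L..L} (\<lambda>x. integral {-L..L} (\<lambda>y. f x y 0))"
    "I3 L f = integral {-L..L} (\<lambda>y. integral {-L..L} (\<lambda>x. f x y 0))"
    using I3_zavg_iter[OF f, of L] by simp_all
qed

text \<open>
  The derivative of \<open>3z\<^sup>2 - 2z\<^sup>3\<close>: it vanishes on both faces and has integral 1, so \<open>profile z\<close> times a planar
  field is a no-slip field with that planar field as its vertical mean.
\<close>
definition profile :: "real \<Rightarrow> real" where "profile z = 6 * z - 6 * z\<^sup>2"
definition dprofile :: "real \<Rightarrow> real" where "dprofile z = 6 - 12 * z"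

lemma C1_profile: "C1 (\<lambda>x y. profile) (\<lambda>x y z. 0) (\<lambda>x y z. 0) (\<lambda>x y. dprofile)"
proof (rule C1I)
  fix x y z :: real
  show "(profile has_vector_derivative dprofile z) (at z within {0..1})"
    unfolding profile_def[abs_def] dprofile_def has_real_derivative_iff_has_vector_derivative[symmetric]
    by (rule derivative_eq_intros refl | simp)+
qed (unfold profile_def[abs_def] dprofile_def[abs_def], (intro cont3I continuous_intros has_vector_derivative_const)+)

lemma profile_range: assumes "0 \<le> z" "z \<le> 1" shows "0 \<le> profile z" "profile z \<le> 3/2" "\<bar>dprofile z\<bar> \<le> 6"
proof -
  have "profile z = 6 * (z * (1 - z))" by (simp add: profile_def power2_eq_square algebra_simps)
  then show "0 \<le> profile z" using assms by simp
  have "profile z = 3/2 - 6 * (z - 1/2)\<^sup>2" by (simp add: profile_def power2_eq_square algebra_simps)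
  then show "profile z \<le> 3/2" by simp
  show "\<bar>dprofile z\<bar> \<le> 6" using assms by (auto simp: dprofile_def)
qed

context slab_flow
begin

text \<open>
  \<open>dsq\<close> and \<open>qsq\<close> are the vertical means of \<open>|\<nabla>u|\<^sup>2\<close> and \<open>|u|\<^sup>2\<close>.
\<close>
abbreviation dsq :: "real \<Rightarrow> real \<Rightarrow> real \<Rightarrow> real" where "dsq \<equiv> zavg gsq"
definition qsq :: "real \<Rightarrow> real \<Rightarrow> real \<Rightarrow> real" where "qsq = zavg (\<lambda>x y z. (norm (U x y z))\<^sup>2)"

lemma cont3_nU: "cont3 (\<lambda>x y z. (norm (U x y z))\<^sup>2)" by (intro cont3I continuous_intros cU)
lemma cont3_dsq: "cont3 dsq" by (intro cont3_zavg cont3_gsq)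
lemma cont3_qsq: "cont3 qsq" unfolding qsq_def by (intro cont3_zavg cont3_nU)
lemma dsq_nonneg: "0 \<le> dsq x y z" by (intro zavg_nonneg cont3_gsq gsq_nonneg)
lemma qsq_nonneg: "0 \<le> qsq x y z" unfolding qsq_def by (intro zavg_nonneg cont3_nU) auto

lemma norm_le_gsq: "(norm (Ux x y z))\<^sup>2 \<le> gsq x y z" "(norm (Uy x y z))\<^sup>2 \<le> gsq x y z" "(norm (Uz x y z))\<^sup>2 \<le> gsq x y z"
  by (simp_all add: gsq_def)

text \<open>
  Integrate the vertical derivative up from the face, where the velocity vanishes.
\<close>
lemma norm_U_sq_le: assumes z: "0 \<le> z" "z \<le> 1" shows "(norm (U x y z))\<^sup>2 \<le> dsq x y w"
proof -
  have "zprim Uz x y z = U x y z - U x y 0" unfolding zprim_def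
    by (rule lint_FTC[where S="{0..1}"]) (use C1D(7)[OF U] z in auto)
  then have "(norm (U x y z))\<^sup>2 = (norm (zprim Uz x y z))\<^sup>2" by (simp add: noslip)
  also have "\<dots> \<le> zavg (\<lambda>x y z. (norm (Uz x y z))\<^sup>2) x y w"
    by (rule zprim_norm_sq[OF C1D(4)[OF U] z])
  also have "\<dots> \<le> dsq x y w"
    by (intro zavg_mono cont3_gsq norm_le_gsq) (intro cont3I continuous_intros cU)
  finally show ?thesis .
qed

lemma qsq_le_dsq: "qsq x y z \<le> dsq x y z"
proof -
  have "qsq x y z \<le> zavg dsq x y z" unfolding qsq_def
    by (intro zavg_mono cont3_nU cont3_dsq norm_U_sq_le)
  then show ?thesis by (simp add: zavg_zavg)
qed

lemma ubar_div: "zavg Ux x y z $ 1 + zavg Uy x y z $ 2 = 0"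
proof -
  have n: "zavg f x y z $ i = zavg (\<lambda>x y z. f x y z $ i) x y z" if "cont3 f" for f :: "real \<Rightarrow> real \<Rightarrow> real \<Rightarrow> real^3" and i
    unfolding zavg_def
    using integral_linear[OF integrable_continuous_real[OF cont3_slices(3)[OF that, of "{0..1}" x y]] bounded_linear_vec_nth[of i]]
    by (simp add: o_def)
  have "((\<lambda>z. Uz x y z $ 3) has_integral (U x y 1 $ 3 - U x y 0 $ 3)) {0..1}"
    by (rule fundamental_theorem_of_calculus)
      (auto intro!: bounded_linear.has_vector_derivative[OF bounded_linear_vec_nth] C1D(7)[OF U])
  then have 3: "integral {0..1} (\<lambda>z. Uz x y z $ 3) = 0" by (simp add: noslip integral_unique)
  have c: "continuous_on {0..1} (\<lambda>z. Ux x y z $ 1)" "continuous_on {0..1} (\<lambda>z. Uy x y z $ 2)"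
    by (intro continuous_intros cU)+
  have "zavg Ux x y z $ 1 + zavg Uy x y z $ 2 = integral {0..1} (\<lambda>z. Ux x y z $ 1 + Uy x y z $ 2)"
    unfolding n[OF C1D(2)[OF U]] n[OF C1D(3)[OF U]] unfolding zavg_def
    by (rule integral_add[symmetric]) (intro integrable_continuous_real c)+
  also have "\<dots> = integral {0..1} (\<lambda>z. - (Uz x y z $ 3))"
    by (rule integral_cong) (use incompressible[of _ x y] in \<open>auto simp: algebra_simps eq_neg_iff_add_eq_0\<close>)
  finally show ?thesis using 3 by simp
qed

lemma ubar_sq: "(zavg U x y z $ i)\<^sup>2 \<le> qsq x y w"
proof -
  have "(zavg U x y z $ i)\<^sup>2 \<le> (norm (zavg U x y z))\<^sup>2"
    using component_le_norm_cart[of "zavg U x y z" i] by (simp add: abs_le_square_iff[symmetric])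
  also have "\<dots> \<le> qsq x y w" using zavg_norm_sq[OF C1D(1)[OF U], of x y z] unfolding qsq_def zavg_def .
  finally show ?thesis .
qed

definition psi :: "real \<Rightarrow> real \<Rightarrow> real \<Rightarrow> real \<Rightarrow> real" where
  "psi y0 x y z = lint (\<lambda>t. zavg U x t 0 $ 1) y0 y - lint (\<lambda>s. zavg U s y0 0 $ 2) 0 x"

lemma C1_psi: "C1 (psi y0) (\<lambda>x y z. - (zavg U x y z $ 2)) (\<lambda>x y z. zavg U x y z $ 1) (\<lambda>x y z. 0)"
  unfolding psi_def[abs_def]
  by (rule C1_stream[OF C1_nth[OF C1_zavg[OF U]] C1_nth[OF C1_zavg[OF U]]])
    (use ubar_div in \<open>simp_all add: zavg_def\<close>)

text \<open>
  The derivative of \<open>qsq\<close> along a horizontal line is at most \<open>2 dsq\<close>, so \<open>sup_le_integral\<close>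
  bounds \<open>qsq\<close> by integrals of \<open>dsq\<close> along either coordinate line.
\<close>
lemma qsq_sup:
  assumes L: "1 \<le> 2 * L" and xy: "\<bar>x\<bar> \<le> L" "\<bar>y\<bar> \<le> L"
  shows "qsq x y w \<le> 3 * integral {-L..L} (\<lambda>s. dsq s y 0)" "qsq x y w \<le> 3 * integral {-L..L} (\<lambda>t. dsq x t 0)"
proof -
  have C: "C1 (\<lambda>x y z. (norm (U x y z))\<^sup>2) (\<lambda>x y z. U x y z \<bullet> Ux x y z + Ux x y z \<bullet> U x y z)
     (\<lambda>x y z. U x y z \<bullet> Uy x y z + Uy x y z \<bullet> U x y z) (\<lambda>x y z. U x y z \<bullet> Uz x y z + Uz x y z \<bullet> U x y z)"
    using C1_inner[OF U U] by (simp add: power2_norm_eq_inner)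
  note Q = C1_zavg[OF C, folded qsq_def]
  have b: "\<bar>zavg (\<lambda>x y z. U x y z \<bullet> V x y z + V x y z \<bullet> U x y z) x y w\<bar> \<le> 2 * dsq x y w"
    if V: "cont3 V" and Vg: "\<And>x y z. (norm (V x y z))\<^sup>2 \<le> gsq x y z" for V x y w
  proof -
    have c: "cont3 (\<lambda>x y z. U x y z \<bullet> V x y z + V x y z \<bullet> U x y z)"
      by (intro cont3I continuous_intros cU cont3_comp[OF V])
    have "\<bar>zavg (\<lambda>x y z. U x y z \<bullet> V x y z + V x y z \<bullet> U x y z) x y w\<bar> \<le> zavg (\<lambda>x y z. dsq x y z + gsq x y z) x y w"
      unfolding zavg_def[of "\<lambda>x y z. U x y z \<bullet> V x y z + V x y z \<bullet> U x y z"] zavg_def[of "\<lambda>x y z. dsq x y z + gsq x y z"] real_norm_def[symmetric]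
    proof (rule integral_norm_bound_integral)
      show "(\<lambda>z. U x y z \<bullet> V x y z + V x y z \<bullet> U x y z) integrable_on {0..1}" "(\<lambda>z. dsq x y z + gsq x y z) integrable_on {0..1}"
        by (intro integrable_continuous_real continuous_intros cU cont3_slices(3)[OF V] cont3_slices(3)[OF cont3_dsq] cont3_slices(3)[OF cont3_gsq])+
      fix z :: real assume z: "z \<in> {0..1}"
      have "\<bar>U x y z \<bullet> V x y z\<bar> \<le> norm (U x y z) * norm (V x y z)" by (rule Cauchy_Schwarz_ineq2)
      moreover have "2 * (norm (U x y z) * norm (V x y z)) \<le> (norm (U x y z))\<^sup>2 + (norm (V x y z))\<^sup>2"
        using sum_squares_bound[of "norm (U x y z)" "norm (V x y z)"] by simp
      moreover have "(norm (U x y z))\<^sup>2 \<le> dsq x y z" using z by (intro norm_U_sq_le) auto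
      ultimately show "norm (U x y z \<bullet> V x y z + V x y z \<bullet> U x y z) \<le> dsq x y z + gsq x y z"
        using Vg[of x y z] by (simp add: inner_commute)
    qed
    also have "\<dots> = 2 * dsq x y w"
      unfolding zavg_def[of "\<lambda>x y z. dsq x y z + gsq x y z"]
    proof (subst integral_add)
      show "integral {0..1} (dsq x y) + integral {0..1} (gsq x y) = 2 * dsq x y w"
        using zavg_zavg[of gsq x y w] unfolding zavg_def[of dsq x y w] unfolding zavg_def[of gsq x y w] by simp
    qed (intro integrable_continuous_real cont3_slices(3) cont3_dsq cont3_gsq)+
    finally show ?thesis .
  qed
  have bx: "qsq s y w + \<bar>zavg (\<lambda>x y z. U x y z \<bullet> Ux x y z + Ux x y z \<bullet> U x y z) s y w\<bar> \<le> 3 * dsq s y 0" for s w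
    using b[OF C1D(2)[OF U] norm_le_gsq(1), of s y w] qsq_le_dsq[of s y w] zavg_const[of gsq s y w 0] by linarith
  have by': "qsq x t w + \<bar>zavg (\<lambda>x y z. U x y z \<bullet> Uy x y z + Uy x y z \<bullet> U x y z) x t w\<bar> \<le> 3 * dsq x t 0" for t w
    using b[OF C1D(3)[OF U] norm_le_gsq(2), of x t w] qsq_le_dsq[of x t w] zavg_const[of gsq x t w 0] by linarith
  note cq = cont3_comp[OF C1D(1)[OF Q]] cont3_comp[OF C1D(2)[OF Q]] cont3_comp[OF C1D(3)[OF Q]] cont3_comp[OF cont3_dsq]
  have qw: "qsq x y w = qsq x y 0" for x y unfolding qsq_def by (rule zavg_const)
  have "qsq x y 0 \<le> integral {-L..L} (\<lambda>s. qsq s y 0 + \<bar>zavg (\<lambda>x y z. U x y z \<bullet> Ux x y z + Ux x y z \<bullet> U x y z) s y 0\<bar>)"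
    by (rule sup_le_integral[where f="\<lambda>s. qsq s y 0"])
      (use L xy in \<open>auto intro!: C1D(5)[OF Q] cq continuous_intros qsq_nonneg\<close>)
  also have "\<dots> \<le> integral {-L..L} (\<lambda>s. 3 * dsq s y 0)"
    by (intro integral_le integrable_continuous_real continuous_intros cq) (rule bx)
  finally show "qsq x y w \<le> 3 * integral {-L..L} (\<lambda>s. dsq s y 0)" using qw by simp
  have "qsq x y 0 \<le> integral {-L..L} (\<lambda>t. qsq x t 0 + \<bar>zavg (\<lambda>x y z. U x y z \<bullet> Uy x y z + Uy x y z \<bullet> U x y z) x t 0\<bar>)"
    by (rule sup_le_integral[where f="\<lambda>t. qsq x t 0"])
      (use L xy in \<open>auto intro!: C1D(6)[OF Q] cq continuous_intros qsq_nonneg\<close>)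
  also have "\<dots> \<le> integral {-L..L} (\<lambda>t. 3 * dsq x t 0)"
    by (intro integral_le integrable_continuous_real continuous_intros cq) (rule by')
  finally show "qsq x y w \<le> 3 * integral {-L..L} (\<lambda>t. dsq x t 0)" using qw by simp
qed

end

section \<open>Divergence-free test fields\<close>

lemma C1_eq:
  assumes "C1 f fx fy fz" "\<And>x y z. f' x y z = f x y z" "\<And>x y z. fx' x y z = fx x y z"
    "\<And>x y z. fy' x y z = fy x y z" "\<And>x y z. fz' x y z = fz x y z"
  shows "C1 f' fx' fy' fz'"
proof -
  have "f' = f" "fx' = fx" "fy' = fy" "fz' = fz" using assms(2-5) by blast+
  then show ?thesis using assms(1) by simp
qed

lemma vector3_eq: "(vector [a,b,c] :: real^3) = a *\<^sub>R axis 1 1 + b *\<^sub>R axis 2 1 + c *\<^sub>R axis 3 1"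
  by (simp add: vec_eq_iff forall_3 axis_def)

lemma norm_vector3: "norm (vector [a,b,c] :: real^3) \<le> \<bar>a\<bar> + \<bar>b\<bar> + \<bar>c\<bar>"
  unfolding vector3_eq by (intro norm_triangle_mono order_trans[OF norm_triangle_ineq] add_mono) auto

lemma C1_vector3:
  assumes a: "C1 a ax ay az" and b: "C1 b bx by bz" and c: "C1 c cx cy cz"
  shows "C1 (\<lambda>x y z. vector [a x y z, b x y z, c x y z] :: real^3)
    (\<lambda>x y z. vector [ax x y z, bx x y z, cx x y z]) (\<lambda>x y z. vector [ay x y z, by x y z, cy x y z])
    (\<lambda>x y z. vector [az x y z, bz x y z, cz x y z])"
  unfolding vector3_eq
  by (intro C1_add C1_linear[OF bounded_linear_scaleR_left] a b c)

context slab_flow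
begin

abbreviation "Ub \<equiv> zavg U"

text \<open>
  The correction \<open>W\<close> has three parts. The horizontal field with profile removes the vertical mean of
  \<open>\<nabla>\<phi> \<cdot> U\<close>. The remaining \<open>\<nabla>\<phi> \<cdot> (U - profile Ub)\<close> is split: the part with \<open>(p1, p2)\<close> has mean zero over the
  height and is removed by a vertical primitive, and the field \<open>Q\<close> takes care of the rest. The
  vertical primitive costs a horizontal derivative of \<open>(p1, p2)\<close>, which is why one may wish to choose
  these smoother than \<open>U\<close>.
\<close>
lemma assembled_identity:
  assumes phi: "C1 \<phi> \<phi>x \<phi>y (\<lambda>x y z. 0)" and phix: "C1 \<phi>x \<phi>xx \<phi>xy (\<lambda>x y z. 0)" and phiy: "C1 \<phi>y \<phi>xy \<phi>yy (\<lambda>x y z. 0)"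
    and V1: "C1 V1 V1x V1y (\<lambda>x y z. 0)" and V2: "C1 V2 V2x V2y (\<lambda>x y z. 0)"
    and divV: "\<And>x y z. \<lbrakk>0 \<le> z; z \<le> 1\<rbrakk> \<Longrightarrow> V1x x y z + V2y x y z = \<phi>x x y z * Ub x y z $ 1 + \<phi>y x y z * Ub x y z $ 2"
    and p1: "C1 p1 p1x p1y p1z" and p2: "C1 p2 p2x p2y p2z"
    and p0: "\<And>x y. zprim p1 x y 1 = 0" "\<And>x y. zprim p2 x y 1 = 0"
    and Q: "C1 Q Qx Qy Qz" "\<And>x y. Q x y 0 = 0" "\<And>x y. Q x y 1 = 0"
    and divQ: "\<And>x y z. \<lbrakk>0 \<le> z; z \<le> 1\<rbrakk> \<Longrightarrow> Qx x y z $ 1 + Qy x y z $ 2 + Qz x y z $ 3 =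
       - (\<phi>x x y z * (U x y z $ 1 - profile z * Ub x y z $ 1 - p1 x y z) + \<phi>y x y z * (U x y z $ 2 - profile z * Ub x y z $ 2 - p2 x y z))"
    and L: "0 \<le> L"
    and supp: "\<And>x y z. \<bar>x\<bar> = L \<or> \<bar>y\<bar> = L \<Longrightarrow> \<phi> x y z = 0 \<and> \<phi>x x y z = 0 \<and> \<phi>y x y z = 0 \<and> V1 x y z = 0 \<and> V2 x y z = 0 \<and> Q x y z = 0"
  defines "W \<equiv> (\<lambda>x y z. vector [- (profile z * V1 x y z), - (profile z * V2 x y z), - (\<phi>x x y z * zprim p1 x y z + \<phi>y x y z * zprim p2 x y z)] + Q x y z)"
    and "Wx \<equiv> (\<lambda>x y z. vector [- (profile z * V1x x y z), - (profile z * V2x x y z),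
        - ((\<phi>x x y z * zprim p1x x y z + \<phi>xx x y z * zprim p1 x y z) + (\<phi>y x y z * zprim p2x x y z + \<phi>xy x y z * zprim p2 x y z))] + Qx x y z)"
    and "Wy \<equiv> (\<lambda>x y z. vector [- (profile z * V1y x y z), - (profile z * V2y x y z),
        - ((\<phi>x x y z * zprim p1y x y z + \<phi>xy x y z * zprim p1 x y z) + (\<phi>y x y z * zprim p2y x y z + \<phi>yy x y z * zprim p2 x y z))] + Qy x y z)"
    and "Wz \<equiv> (\<lambda>x y z. vector [- (dprofile z * V1 x y z), - (dprofile z * V2 x y z), - (\<phi>x x y z * p1 x y z + \<phi>y x y z * p2 x y z)] + Qz x y z)"
  shows "C1 W Wx Wy Wz"
    and "I3 L (\<lambda>x y z. \<phi> x y z * gsq x y z + (\<phi>x x y z * (Ux x y z \<bullet> U x y z) + \<phi>y x y z * (Uy x y z \<bullet> U x y z)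
     + (Ux x y z \<bullet> Wx x y z + Uy x y z \<bullet> Wy x y z + Uz x y z \<bullet> Wz x y z) + adv x y z (W x y z))) = 0"
proof -
  have h: "C1 (\<lambda>x y z. - (profile z * V x y z)) (\<lambda>x y z. - (profile z * Vx x y z)) (\<lambda>x y z. - (profile z * Vy x y z)) (\<lambda>x y z. - (dprofile z * V x y z))"
    if "C1 V Vx Vy (\<lambda>x y z. 0)" for V Vx Vy
    by (rule C1_eq[OF C1_minus[OF C1_mult[OF C1_profile that]]]) auto
  have G: "C1 (\<lambda>x y z. - (\<phi>x x y z * zprim p1 x y z + \<phi>y x y z * zprim p2 x y z))
      (\<lambda>x y z. - ((\<phi>x x y z * zprim p1x x y z + \<phi>xx x y z * zprim p1 x y z) + (\<phi>y x y z * zprim p2x x y z + \<phi>xy x y z * zprim p2 x y z)))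
      (\<lambda>x y z. - ((\<phi>x x y z * zprim p1y x y z + \<phi>xy x y z * zprim p1 x y z) + (\<phi>y x y z * zprim p2y x y z + \<phi>yy x y z * zprim p2 x y z)))
      (\<lambda>x y z. - (\<phi>x x y z * p1 x y z + \<phi>y x y z * p2 x y z))"
    by (rule C1_eq[OF C1_minus[OF C1_add[OF C1_mult[OF phix C1_zprim[OF p1]] C1_mult[OF phiy C1_zprim[OF p2]]]]]) auto
  show W: "C1 W Wx Wy Wz"
    unfolding W_def Wx_def Wy_def Wz_def
    by (intro C1_add[OF C1_vector3[OF h[OF V1] h[OF V2] G] Q(1)])
  show "I3 L (\<lambda>x y z. \<phi> x y z * gsq x y z + (\<phi>x x y z * (Ux x y z \<bullet> U x y z) + \<phi>y x y z * (Uy x y z \<bullet> U x y z)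
     + (Ux x y z \<bullet> Wx x y z + Uy x y z \<bullet> Wy x y z + Uz x y z \<bullet> Wz x y z) + adv x y z (W x y z))) = 0"
  proof (rule test_identity[OF phi W L])
    have z0: "(vector [0, 0, 0] :: real^3) = 0" by (simp add: vector3_eq)
    show "\<phi> x y z = 0 \<and> W x y z = 0" if "\<bar>x\<bar> = L \<or> \<bar>y\<bar> = L" for x y z
      using supp[OF that, of z] by (simp add: W_def z0)
    show "W x y 0 = 0" "W x y 1 = 0" for x y
      using p0[of x y] Q(2,3)[of x y] by (simp_all add: W_def profile_def zprim_def lint_def z0)
    show "Wx x y z $ 1 + Wy x y z $ 2 + Wz x y z $ 3 = - (\<phi>x x y z * U x y z $ 1 + \<phi>y x y z * U x y z $ 2)"
      if z: "0 \<le> z" "z \<le> 1" for x y z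
    proof -
      have "Wx x y z $ 1 + Wy x y z $ 2 + Wz x y z $ 3 = - profile z * (V1x x y z + V2y x y z)
          - (\<phi>x x y z * p1 x y z + \<phi>y x y z * p2 x y z) + (Qx x y z $ 1 + Qy x y z $ 2 + Qz x y z $ 3)"
        by (simp add: Wx_def Wy_def Wz_def algebra_simps)
      then show ?thesis unfolding divV[OF z] divQ[OF z] by (simp add: algebra_simps)
    qed
  qed
qed

lemma adv_le: "\<bar>adv x y z w\<bar> \<le> 6 * sqrt (gsq x y z) * norm (U x y z) * norm w"
proof -
  define g where "g = sqrt (gsq x y z)"
  have n: "norm (Ux x y z) \<le> g" "norm (Uy x y z) \<le> g" "norm (Uz x y z) \<le> g"
    unfolding g_def using norm_le_gsq by (auto intro: real_le_rsqrt)
  have 1: "\<bar>((U x y z $ i) *\<^sub>R V) \<bullet> w\<bar> \<le> g * norm (U x y z) * norm w" if "norm V \<le> g" for V i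
  proof -
    have "\<bar>((U x y z $ i) *\<^sub>R V) \<bullet> w\<bar> \<le> \<bar>U x y z $ i\<bar> * norm V * norm w"
      using Cauchy_Schwarz_ineq2[of "(U x y z $ i) *\<^sub>R V" w] by simp
    also have "\<dots> \<le> norm (U x y z) * g * norm w"
      using that component_le_norm_cart[of "U x y z" i] norm_ge_zero[of V]
      by (intro mult_mono) (auto intro!: mult_nonneg_nonneg simp: g_def gsq_nonneg)
    finally show ?thesis by (simp add: ac_simps)
  qed
  have 2: "\<bar>(V \<bullet> U x y z) * w $ i\<bar> \<le> g * norm (U x y z) * norm w" if "norm V \<le> g" for V i
  proof -
    have "\<bar>V \<bullet> U x y z\<bar> \<le> norm V * norm (U x y z)" by (rule Cauchy_Schwarz_ineq2)
    also have "\<dots> \<le> g * norm (U x y z)" using that by (intro mult_right_mono) auto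
    finally show ?thesis unfolding abs_mult
      using component_le_norm_cart[of w i] by (intro mult_mono) (auto simp: g_def gsq_nonneg)
  qed
  show ?thesis unfolding adv_def inner_add_left g_def[symmetric]
    using 1[OF n(1), of 1] 1[OF n(2), of 2] 1[OF n(3), of 3] 2[OF n(1), of 1] 2[OF n(2), of 2] 2[OF n(3), of 3] by linarith
qed

lemma rest_le:
  "\<bar>a * (Ux x y z \<bullet> U x y z) + b * (Uy x y z \<bullet> U x y z)
     + (Ux x y z \<bullet> wx + Uy x y z \<bullet> wy + Uz x y z \<bullet> wz) + adv x y z w\<bar>
   \<le> sqrt (gsq x y z) * ((\<bar>a\<bar> + \<bar>b\<bar>) * norm (U x y z) + norm wx + norm wy + norm wz + 6 * norm (U x y z) * norm w)"
proof -
  define g where "g = sqrt (gsq x y z)"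
  have n: "norm (Ux x y z) \<le> g" "norm (Uy x y z) \<le> g" "norm (Uz x y z) \<le> g"
    unfolding g_def using norm_le_gsq by (auto intro: real_le_rsqrt)
  have 1: "\<bar>V \<bullet> w\<bar> \<le> g * norm w" if "norm V \<le> g" for V w :: "real^3"
    using Cauchy_Schwarz_ineq2[of V w] mult_right_mono[OF that, of "norm w"] by simp
  have 2: "\<bar>a * (V \<bullet> U x y z)\<bar> \<le> \<bar>a\<bar> * (g * norm (U x y z))" if "norm V \<le> g" for V a
    unfolding abs_mult using 1[OF that] by (intro mult_left_mono) auto
  have "\<bar>a * (Ux x y z \<bullet> U x y z) + b * (Uy x y z \<bullet> U x y z)
     + (Ux x y z \<bullet> wx + Uy x y z \<bullet> wy + Uz x y z \<bullet> wz) + adv x y z w\<bar>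
    \<le> \<bar>a\<bar> * (g * norm (U x y z)) + \<bar>b\<bar> * (g * norm (U x y z)) + g * norm wx + g * norm wy + g * norm wz + 6 * g * norm (U x y z) * norm w"
    using 2[OF n(1), of a] 2[OF n(2), of b] 1[OF n(1), of wx] 1[OF n(2), of wy] 1[OF n(3), of wz] adv_le[of x y z w]
    unfolding g_def[symmetric] by linarith
  then show ?thesis unfolding g_def by (simp add: algebra_simps)
qed

text \<open>
  Ladyzhenskaya's inequality: bound one factor of \<open>qsq\<^sup>2\<close> by its integral along the line in \<open>x\<close>, the other by the
  integral along the line in \<open>y\<close>; the double integral then splits into a product.
\<close>
lemma I3_qsq_sq:
  assumes L: "1 \<le> 2 * L"
  shows "I3 L (\<lambda>x y z. (qsq x y z)\<^sup>2) \<le> 9 * (I3 L gsq)\<^sup>2"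
proof -
  define A where "A y = integral {-L..L} (\<lambda>s. dsq s y 0)" for y
  define B where "B x = integral {-L..L} (\<lambda>t. dsq x t 0)" for x
  have c: "continuous_on UNIV A" "continuous_on UNIV B" unfolding A_def B_def
    by (intro continuous_on_integral_param cont3_comp[OF cont3_dsq] continuous_intros)+
  have pos: "0 \<le> A y" "0 \<le> B y" for y unfolding A_def B_def
    by (intro integral_nonneg integrable_continuous_real cont3_comp[OF cont3_dsq] continuous_intros dsq_nonneg)+
  have c3: "cont3 (\<lambda>x y z. 9 * (A y * B x))"
    by (intro cont3I continuous_intros continuous_on_compose2[OF c(1)] continuous_on_compose2[OF c(2)]) auto
  have AB: "integral {-L..L} A = I3 L gsq" "integral {-L..L} B = I3 L gsq"
    unfolding A_def B_def using I3_zavg_iter[OF cont3_gsq, of L] by simp_all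
  have "I3 L (\<lambda>x y z. (qsq x y z)\<^sup>2) \<le> I3 L (\<lambda>x y z. 9 * (A y * B x))"
  proof (rule I3_mono[OF _ c3])
    show "cont3 (\<lambda>x y z. (qsq x y z)\<^sup>2)" by (intro cont3I continuous_intros cont3_comp[OF cont3_qsq])
    fix x y z :: real assume xy: "\<bar>x\<bar> \<le> L" "\<bar>y\<bar> \<le> L"
    have "qsq x y z * qsq x y z \<le> (3 * A y) * (3 * B x)"
      using qsq_sup[OF L xy, of z] pos qsq_nonneg unfolding A_def B_def by (intro mult_mono) auto
    then show "(qsq x y z)\<^sup>2 \<le> 9 * (A y * B x)" by (simp add: power2_eq_square)
  qed
  also have "\<dots> = 9 * (I3 L gsq)\<^sup>2"
    unfolding I3_planar(1)[OF c3, OF refl] by (simp add: AB power2_eq_square)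
  finally show ?thesis .
qed

lemma psi_sq_le:
  assumes xy: "\<bar>x\<bar> \<le> L" "\<bar>y\<bar> \<le> L" and y0: "\<bar>y0\<bar> \<le> L"
  shows "(psi y0 x y z)\<^sup>2 \<le> 4 * L * (integral {-L..L} (\<lambda>t. qsq x t 0) + integral {-L..L} (\<lambda>s. qsq s y0 0))"
proof -
  have L: "0 \<le> L" using xy by linarith
  note cUb = cont3_comp[OF cont3_zavg[OF C1D(1)[OF U]]]
  have b: "(lint f a b)\<^sup>2 \<le> 2 * L * integral {-L..L} q"
    if f: "continuous_on UNIV f" and q: "continuous_on {-L..L} q" and ab: "a \<in> {-L..L}" "b \<in> {-L..L}" and fq: "\<And>t. (f t)\<^sup>2 \<le> q t"
    for f q :: "real \<Rightarrow> real" and a b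
  proof -
    have "\<bar>lint f a b\<bar> \<le> integral {-L..L} (\<lambda>t. \<bar>f t\<bar>)" using norm_lint_le[OF f ab] by simp
    then have "(lint f a b)\<^sup>2 \<le> (integral {-L..L} (\<lambda>t. \<bar>f t\<bar>))\<^sup>2"
      by (metis abs_ge_zero power2_abs power_mono)
    also have "\<dots> \<le> (L - (-L)) * integral {-L..L} (\<lambda>t. \<bar>f t\<bar>\<^sup>2)"
      by (intro integral_square_le continuous_intros continuous_on_subset[OF f]) (use L in auto)
    also have "\<dots> \<le> 2 * L * integral {-L..L} q"
      using L by (auto intro!: mult_left_mono integral_le integrable_continuous_real continuous_intros continuous_on_subset[OF f] q fq)
    finally show ?thesis .
  qed
  have 1: "(lint (\<lambda>t. Ub x t 0 $ 1) y0 y)\<^sup>2 \<le> 2 * L * integral {-L..L} (\<lambda>t. qsq x t 0)"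
    by (rule b) (use xy y0 in \<open>auto intro!: continuous_intros cUb ubar_sq cont3_comp[OF cont3_qsq]\<close>)
  have 2: "(lint (\<lambda>s. Ub s y0 0 $ 2) 0 x)\<^sup>2 \<le> 2 * L * integral {-L..L} (\<lambda>s. qsq s y0 0)"
    by (rule b) (use xy L in \<open>auto intro!: continuous_intros cUb ubar_sq cont3_comp[OF cont3_qsq]\<close>)
  have "(psi y0 x y z)\<^sup>2 \<le> 2 * (lint (\<lambda>t. Ub x t 0 $ 1) y0 y)\<^sup>2 + 2 * (lint (\<lambda>s. Ub s y0 0 $ 2) 0 x)\<^sup>2"
    unfolding psi_def
    using zero_le_power2[of "lint (\<lambda>t. Ub x t 0 $ 1) y0 y + lint (\<lambda>s. Ub s y0 0 $ 2) 0 x"]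
    by (simp add: power2_sum power2_diff)
  also have "\<dots> \<le> 4 * L * (integral {-L..L} (\<lambda>t. qsq x t 0) + integral {-L..L} (\<lambda>s. qsq s y0 0))"
    using 1 2 by (simp add: algebra_simps)
  finally show ?thesis .
qed

lemma I3_qsq_le: "0 \<le> L \<Longrightarrow> I3 L qsq \<le> I3 L gsq"
  using I3_mono[OF cont3_qsq cont3_dsq qsq_le_dsq] I3_zavg[OF cont3_gsq] by metis

text \<open>
  The base line is chosen such that its share of the energy is at most the average. This gives the
  Poincare inequality with the scaling \<open>L\<^sup>2\<close>; the bound for the supremum holds with any base line,
  as \<open>qsq\<close> has bounded integrals along all lines.
\<close>
lemma psi_bounds:
  assumes L: "1 \<le> 2 * L"
  shows "\<exists>y0. (\<forall>x y z. \<bar>x\<bar> \<le> L \<longrightarrow> \<bar>y\<bar> \<le> L \<longrightarrow> (psi y0 x y z)\<^sup>2 \<le> 24 * L * I3 L gsq) \<and>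
     I3 L (\<lambda>x y z. (psi y0 x y z)\<^sup>2) \<le> 16 * L\<^sup>2 * I3 L gsq"
proof -
  define E where "E = I3 L gsq"
  define K where "K y = integral {-L..L} (\<lambda>s. qsq s y 0)" for y
  define J where "J x = integral {-L..L} (\<lambda>t. qsq x t 0)" for x
  have c: "continuous_on UNIV K" "continuous_on UNIV J" unfolding K_def J_def
    by (intro continuous_on_integral_param cont3_comp[OF cont3_qsq] continuous_intros)+
  have qp: "qsq x y z = qsq x y 0" for x y z unfolding qsq_def by (rule zavg_const)
  have Iq: "integral {-L..L} K = I3 L qsq" "integral {-L..L} J = I3 L qsq"
    unfolding K_def J_def using I3_planar[OF cont3_qsq qp, of L] by simp_all
  obtain y0 where y0: "y0 \<in> {-L..L}" "2 * L * K y0 \<le> I3 L qsq"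
    using exists_le_average[of "-L" L K] continuous_on_subset[OF c(1)] L Iq(1) by auto
  have sup: "K y \<le> 3 * E" "J y \<le> 3 * E" if "\<bar>y\<bar> \<le> L" for y
  proof -
    have cA: "continuous_on {-L..L} (\<lambda>s. 3 * integral {-L..L} (\<lambda>t. dsq s t 0))" "continuous_on {-L..L} (\<lambda>t. 3 * integral {-L..L} (\<lambda>s. dsq s t 0))"
      by (rule continuous_on_subset[OF _ subset_UNIV], intro continuous_intros continuous_on_integral_param cont3_comp[OF cont3_dsq])+
    have "K y \<le> integral {-L..L} (\<lambda>s. 3 * integral {-L..L} (\<lambda>t. dsq s t 0))"
      unfolding K_def by (intro integral_le integrable_continuous_real cA cont3_slices cont3_qsq qsq_sup L) (use that in auto)
    also have "\<dots> = 3 * E" unfolding E_def I3_zavg_iter(1)[OF cont3_gsq] by simp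
    finally show "K y \<le> 3 * E" .
    have "J y \<le> integral {-L..L} (\<lambda>t. 3 * integral {-L..L} (\<lambda>s. dsq s t 0))"
      unfolding J_def by (intro integral_le integrable_continuous_real cA cont3_slices cont3_qsq qsq_sup L) (use that in auto)
    also have "\<dots> = 3 * E" unfolding E_def I3_zavg_iter(2)[OF cont3_gsq] by simp
    finally show "J y \<le> 3 * E" .
  qed
  have b: "(psi y0 x y z)\<^sup>2 \<le> 4 * L * (J x + K y0)" if "\<bar>x\<bar> \<le> L" "\<bar>y\<bar> \<le> L" for x y z
    using psi_sq_le[OF that, of y0 z] y0(1) unfolding J_def K_def by (simp add: abs_le_iff)
  have "(psi y0 x y z)\<^sup>2 \<le> 24 * L * E" if "\<bar>x\<bar> \<le> L" "\<bar>y\<bar> \<le> L" for x y z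
  proof -
    have "4 * L * (J x + K y0) \<le> 4 * L * (3 * E + 3 * E)"
      using sup(2)[OF that(1)] sup(1)[of y0] y0(1) L by (intro mult_left_mono add_mono) (auto simp: abs_le_iff)
    also have "\<dots> = 24 * L * E" by simp
    finally show ?thesis using b[OF that, of z] by (rule order_trans[rotated])
  qed
  moreover have "I3 L (\<lambda>x y z. (psi y0 x y z)\<^sup>2) \<le> 16 * L\<^sup>2 * E"
  proof -
    have c3: "cont3 (\<lambda>x y z. 4 * L * (J x + K y0))"
      by (intro cont3I continuous_intros continuous_on_compose2[OF c(2)]) auto
    have "I3 L (\<lambda>x y z. (psi y0 x y z)\<^sup>2) \<le> I3 L (\<lambda>x y z. 4 * L * (J x + K y0))"
      by (rule I3_mono[OF _ c3 b]) (intro cont3I continuous_intros cont3_comp[OF C1D(1)[OF C1_psi]])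
    also have "\<dots> = 4 * L * (2 * L * (I3 L qsq + 2 * L * K y0))"
    proof -
      have "integral {-L..L} (\<lambda>x. J x + K y0) = integral {-L..L} J + integral {-L..L} (\<lambda>x. K y0)"
        by (intro integral_add integrable_continuous_real continuous_on_subset[OF c(2)] continuous_intros) auto
      moreover have "I3 L (\<lambda>x y z. 4 * L * (J x + K y0)) = integral {-L..L} (\<lambda>x. (8 * L * L) * (J x + K y0))"
        unfolding I3_planar(1)[OF c3, OF refl] using L by (intro integral_cong) simp
      moreover have "integral {-L..L} (\<lambda>x. (8 * L * L) * (J x + K y0)) = (8 * L * L) * integral {-L..L} (\<lambda>x. J x + K y0)"
        by (rule integral_mult_right)
      ultimately show ?thesis using L by (simp add: Iq)
    qed
    also have "\<dots> \<le> 4 * L * (2 * L * (I3 L qsq + I3 L qsq))"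
      using y0 L by (intro mult_left_mono add_mono) auto
    also have "\<dots> = 16 * L\<^sup>2 * I3 L qsq" by (simp add: power2_eq_square)
    also have "\<dots> \<le> 16 * L\<^sup>2 * E" unfolding E_def using L by (intro mult_left_mono I3_qsq_le) auto
    finally show ?thesis .
  qed
  ultimately show ?thesis unfolding E_def by blast
qed

end

section \<open>Hole filling\<close>

lemma two_mult_le_squares: "2 * (a * b) \<le> a\<^sup>2 + b\<^sup>2" for a b :: real
  using sum_squares_bound[of a b] by simp

lemma abs_le_of_sq: "a\<^sup>2 \<le> b\<^sup>2 \<Longrightarrow> 0 \<le> b \<Longrightarrow> \<bar>a\<bar> \<le> b" for a b :: real
  by (metis abs_le_square_iff abs_of_nonneg)

lemma continuous_on_profile: "continuous_on S f \<Longrightarrow> continuous_on S (\<lambda>s. profile (f s))" "continuous_on S f \<Longrightarrow> continuous_on S (\<lambda>s. dprofile (f s))"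
  unfolding profile_def dprofile_def by (auto intro!: continuous_intros)

lemma zprim_at_one: "cont3 f \<Longrightarrow> zprim f x y 1 = zavg f x y z"
  unfolding zprim_def zavg_def by (intro lint_eq_integral cont3_slices(3)) auto

lemma zavg_nth:
  fixes f :: "real \<Rightarrow> real \<Rightarrow> real \<Rightarrow> real^3"
  assumes "cont3 f" shows "zavg f x y z $ i = zavg (\<lambda>x y z. f x y z $ i) x y z"
  unfolding zavg_def
  using integral_linear[OF integrable_continuous_real[OF cont3_slices(3)[OF assms, of "{0..1}" x y]] bounded_linear_vec_nth[of i]]
  by (simp add: o_def)

lemma integral_profile: "(profile has_integral 1) {0..1}"
proof -
  have "(profile has_integral (\<lambda>z. 3 * z\<^sup>2 - 2 * z ^ 3) 1 - (\<lambda>z. 3 * z\<^sup>2 - 2 * z ^ 3) 0) {0..1}"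
  proof (rule fundamental_theorem_of_calculus)
    fix z :: real
    show "((\<lambda>z. 3 * z\<^sup>2 - 2 * z ^ 3) has_vector_derivative profile z) (at z within {0..1})"
      unfolding has_real_derivative_iff_has_vector_derivative[symmetric] profile_def
      by (auto intro!: derivative_eq_intros simp: algebra_simps)
  qed simp
  then show ?thesis by simp
qed

text \<open>
  Subtracting the vertical mean with the profile leaves a function of mean zero that still vanishes
  on the faces.
\<close>
definition corr :: "(real \<Rightarrow> real \<Rightarrow> real \<Rightarrow> real^3) \<Rightarrow> 3 \<Rightarrow> real \<Rightarrow> real \<Rightarrow> real \<Rightarrow> real" where
  "corr V i x y z = V x y z $ i - profile z * (zavg V x y z $ i)"

lemma cont3_corr: assumes V: "cont3 V" shows "cont3 (corr V i)"
  unfolding corr_def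
  by (intro cont3I continuous_intros cont3_comp[OF V] cont3_comp[OF cont3_zavg[OF V]] continuous_on_profile)

lemma zprim_corr_one: assumes V: "cont3 V" shows "zprim (corr V i) x y 1 = 0"
proof -
  have "((\<lambda>z. V x y z $ i - profile z * (zavg V x y 0 $ i)) has_integral (zavg V x y 0 $ i - 1 * (zavg V x y 0 $ i))) {0..1}"
  proof (intro has_integral_diff has_integral_mult_left integral_profile)
    show "((\<lambda>z. V x y z $ i) has_integral zavg V x y 0 $ i) {0..1}"
      unfolding zavg_nth[OF V] unfolding zavg_def
      by (intro integrable_integral integrable_continuous_real continuous_intros cont3_slices(3)[OF V])
  qed
  moreover have "corr V i x y = (\<lambda>z. V x y z $ i - profile z * (zavg V x y 0 $ i))"
    by (simp add: corr_def[abs_def] zavg_def)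
  ultimately show ?thesis
    using zprim_at_one[OF cont3_corr[OF V], of i x y 0] by (simp add: zavg_def integral_unique)
qed

lemma corr_sq_le:
  assumes V: "cont3 V" and z: "0 \<le> z" "z \<le> 1"
  shows "(corr V i x y z)\<^sup>2 \<le> 2 * (norm (V x y z))\<^sup>2 + 9/2 * zavg (\<lambda>x y z. (norm (V x y z))\<^sup>2) x y w"
proof -
  have 1: "(V x y z $ i)\<^sup>2 \<le> (norm (V x y z))\<^sup>2"
    using component_le_norm_cart[of "V x y z" i] by (simp add: abs_le_square_iff[symmetric])
  have 2: "(zavg V x y z $ i)\<^sup>2 \<le> zavg (\<lambda>x y z. (norm (V x y z))\<^sup>2) x y w"
  proof -
    have "(zavg V x y z $ i)\<^sup>2 \<le> (norm (zavg V x y z))\<^sup>2"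
      using component_le_norm_cart[of "zavg V x y z" i] by (simp add: abs_le_square_iff[symmetric])
    also have "\<dots> \<le> zavg (\<lambda>x y z. (norm (V x y z))\<^sup>2) x y w"
      using zavg_norm_sq[OF V, of x y z] by (simp add: zavg_def)
    finally show ?thesis .
  qed
  have "(profile z)\<^sup>2 \<le> (3/2)\<^sup>2" using profile_range[OF z] by (intro power_mono) auto
  then have "(profile z)\<^sup>2 * (zavg V x y z $ i)\<^sup>2 \<le> (9/4) * zavg (\<lambda>x y z. (norm (V x y z))\<^sup>2) x y w"
    using 2 by (intro mult_mono) (auto simp: power2_eq_square)
  moreover have "(corr V i x y z)\<^sup>2 \<le> 2 * (V x y z $ i)\<^sup>2 + 2 * (profile z * (zavg V x y z $ i))\<^sup>2"
    using zero_le_power2[of "V x y z $ i + profile z * (zavg V x y z $ i)"]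
    unfolding corr_def power2_diff power2_sum by linarith
  ultimately show ?thesis using 1 by (simp add: power_mult_distrib)
qed

lemma zprim_corr_le:
  assumes V: "cont3 V" and z: "0 \<le> z" "z \<le> 1"
  shows "\<bar>zprim (corr V i) x y z\<bar> \<le> 3 * sqrt (zavg (\<lambda>x y z. (norm (V x y z))\<^sup>2) x y w)"
proof -
  define N where "N = (\<lambda>x y z. (norm (V x y z))\<^sup>2)"
  have cN: "cont3 N" unfolding N_def by (intro cont3I continuous_intros cont3_comp[OF V])
  have "(zprim (corr V i) x y z)\<^sup>2 \<le> zavg (\<lambda>x y z. (norm (corr V i x y z))\<^sup>2) x y w"
    using zprim_norm_sq[OF cont3_corr[OF V] z, of i x y w] by simp
  also have "\<dots> \<le> zavg (\<lambda>x y z. 2 * N x y z + 9/2 * zavg N x y z) x y w"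
  proof (rule zavg_mono)
    show "cont3 (\<lambda>x y z. (norm (corr V i x y z))\<^sup>2)" "cont3 (\<lambda>x y z. 2 * N x y z + 9/2 * zavg N x y z)"
      by (intro cont3I continuous_intros cont3_comp[OF cont3_corr[OF V]] cont3_comp[OF cN] cont3_comp[OF cont3_zavg[OF cN]])+
    fix z :: real assume "0 \<le> z" "z \<le> 1"
    then show "(norm (corr V i x y z))\<^sup>2 \<le> 2 * N x y z + 9/2 * zavg N x y z"
      using corr_sq_le[OF V, of z i x y z] by (simp add: N_def)
  qed
  also have "\<dots> = 2 * zavg N x y w + 9/2 * zavg N x y w"
  proof -
    have "((\<lambda>z. 2 * N x y z + 9/2 * zavg N x y 0) has_integral 2 * integral {0..1} (N x y) + 9/2 * zavg N x y 0) {0..1}"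
      using has_integral_const_real[of "zavg N x y 0" 0 1]
      by (intro has_integral_add has_integral_mult_right integrable_integral integrable_continuous_real cont3_slices(3)[OF cN]) simp
    then show ?thesis by (simp add: zavg_def integral_unique)
  qed
  also have "\<dots> \<le> 9 * zavg N x y w"
    using zavg_nonneg[OF cN, of x y w] by (simp add: N_def)
  also have "\<dots> = (3 * sqrt (zavg N x y w))\<^sup>2"
    using zavg_nonneg[OF cN, of x y w] by (simp add: N_def power_mult_distrib)
  finally show ?thesis
    unfolding N_def[symmetric] using zavg_nonneg[OF cN, of x y w]
    by (intro abs_le_of_sq) (auto simp: N_def)
qed

context slab_flow
begin

lemma C1_corr_U: "C1 (corr U i) (corr Ux i) (corr Uy i) (\<lambda>x y z. Uz x y z $ i - dprofile z * (Ub x y z $ i))"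
  by (rule C1_eq[OF C1_add[OF C1_nth[OF U] C1_minus[OF C1_mult[OF C1_profile C1_nth[OF C1_zavg[OF U]]]]]])
     (auto simp: corr_def)

lemma corr_bounds:
  assumes z: "0 \<le> z" "z \<le> 1"
  shows "\<bar>zprim (corr U i) x y z\<bar> \<le> 3 * sqrt (qsq x y z)"
    "\<bar>zprim (corr Ux i) x y z\<bar> \<le> 3 * sqrt (dsq x y z)" "\<bar>zprim (corr Uy i) x y z\<bar> \<le> 3 * sqrt (dsq x y z)"
    "\<bar>corr U i x y z\<bar> \<le> 3 * sqrt (dsq x y z)"
proof -
  show "\<bar>zprim (corr U i) x y z\<bar> \<le> 3 * sqrt (qsq x y z)"
    unfolding qsq_def by (rule zprim_corr_le[OF C1D(1)[OF U] z])
  have "zavg (\<lambda>x y z. (norm (Ux x y z))\<^sup>2) x y z \<le> dsq x y z" "zavg (\<lambda>x y z. (norm (Uy x y z))\<^sup>2) x y z \<le> dsq x y z"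
    by (intro zavg_mono cont3_gsq norm_le_gsq; intro cont3I continuous_intros cU)+
  then show "\<bar>zprim (corr Ux i) x y z\<bar> \<le> 3 * sqrt (dsq x y z)" "\<bar>zprim (corr Uy i) x y z\<bar> \<le> 3 * sqrt (dsq x y z)"
    using zprim_corr_le[OF C1D(2)[OF U] z, of i x y z] zprim_corr_le[OF C1D(3)[OF U] z, of i x y z]
    by (meson mult_left_mono order_trans real_sqrt_le_mono zero_le_numeral)+
  have "(corr U i x y z)\<^sup>2 \<le> 2 * dsq x y z + 9/2 * dsq x y z"
    using corr_sq_le[OF C1D(1)[OF U] z, of i x y z] norm_U_sq_le[OF z, of x y z] qsq_le_dsq[of x y z]
    unfolding qsq_def by linarith
  also have "\<dots> \<le> (3 * sqrt (dsq x y z))\<^sup>2" using dsq_nonneg[of x y z] by (simp add: power_mult_distrib)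
  finally show "\<bar>corr U i x y z\<bar> \<le> 3 * sqrt (dsq x y z)"
    using dsq_nonneg[of x y z] by (intro abs_le_of_sq) auto
qed

end

text \<open>
  The arithmetic of the estimate at one point, for \<open>R = \<rho>\<^sup>4\<close> and \<open>s = |\<Psi>| / R\<close>. Every term except the one with \<open>a + b\<close> is
  small by itself; the term with \<open>a + b\<close> is traded against the energy weighted with \<open>D\<close>, the increment of
  the cutoff. The weights in Young's inequality are chosen so that \<open>s\<^sup>2\<close> gets the factor 1/256, because the
  Poincare inequality for \<open>\<Psi>\<close> on the box of side \<open>4R\<close> has the constant \<open>64 R\<^sup>2\<close>.
\<close>
lemma pointwise_arith:
  fixes \<rho> :: real
  assumes rho: "1 \<le> \<rho>" and nonneg: "0 \<le> \<gamma>" "0 \<le> n" "0 \<le> \<delta>" "0 \<le> \<kappa>" "0 \<le> s" "0 \<le> a" "0 \<le> b" "n \<le> \<delta>"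
    and k: "k = 1000 / \<rho> ^ 4" and a: "a\<^sup>2 \<le> k\<^sup>2 * D" and b: "b\<^sup>2 \<le> k\<^sup>2 * D"
    and Y: "s * \<rho> ^ 4 \<le> 7 * \<rho> ^ 3"
  shows "\<gamma> * (38 * k * \<delta> + 6 * k * s + 6 * (s * \<rho> ^ 4) * (a + b) + 18 * k * n * (s * \<rho> ^ 4) + 36 * k * n * \<kappa>)
    \<le> (103000 / \<rho>) * \<gamma>\<^sup>2 + (82000 / \<rho>) * \<delta>\<^sup>2 + (1/256 + 3000 / \<rho>) * s\<^sup>2 + (18000 / \<rho> ^ 3) * (n\<^sup>2 * \<kappa>\<^sup>2)
      + 9216000000 * (D * \<gamma>\<^sup>2)"
proof -
  define i where "i = 1 / \<rho>"
  have i: "0 < i" "i \<le> 1" "i * \<rho> = 1" using rho by (auto simp: i_def)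
  have ki: "k = 1000 * i ^ 4" by (simp add: k i_def power_one_over)
  have ik: "i ^ 4 \<le> i" "i ^ 2 \<le> i" "i ^ 6 \<le> i ^ 3" using i power_decreasing[of 1 4 i] power_decreasing[of 1 2 i] power_decreasing[of 3 6 i] by auto
  have r4: "k * \<rho> ^ 4 = 1000" using rho by (simp add: k)
  have kpos: "0 \<le> k" using i by (simp add: ki)
  have k1: "k \<le> 1000 * i" using ik by (simp add: ki)
  have gd: "\<gamma> * \<delta> \<le> (\<gamma>\<^sup>2 + \<delta>\<^sup>2) / 2" "\<gamma> * s \<le> (\<gamma>\<^sup>2 + s\<^sup>2) / 2" using two_mult_le_squares[of \<gamma> \<delta>] two_mult_le_squares[of \<gamma> s] by auto
  have t1: "38 * k * (\<gamma> * \<delta>) \<le> 38 * (1000 * i) * ((\<gamma>\<^sup>2 + \<delta>\<^sup>2) / 2)"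
    using gd k1 kpos nonneg i by (intro mult_mono) auto
  have t2: "6 * k * (\<gamma> * s) \<le> 6 * (1000 * i) * ((\<gamma>\<^sup>2 + s\<^sup>2) / 2)"
    using gd k1 kpos nonneg i by (intro mult_mono) auto
  have t3: "\<gamma> * (6 * (s * \<rho> ^ 4) * (a + b)) \<le> (1/256) * s\<^sup>2 + 9216000000 * (D * \<gamma>\<^sup>2)"
  proof -
    define v where "v = 6 * \<gamma> * \<rho> ^ 4 * (a + b)"
    have "2 * ((s / 16) * (8 * v)) \<le> (s / 16)\<^sup>2 + (8 * v)\<^sup>2" by (rule two_mult_le_squares)
    then have 1: "s * v \<le> (1/256) * s\<^sup>2 + 64 * v\<^sup>2" by (simp add: power_mult_distrib power_divide)
    have "(a + b)\<^sup>2 \<le> 2 * a\<^sup>2 + 2 * b\<^sup>2" using two_mult_le_squares[of a b] by (simp add: power2_sum)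
    also have "\<dots> \<le> 4 * (k\<^sup>2 * D)" using a b by simp
    finally have "v\<^sup>2 \<le> (6 * \<gamma> * \<rho> ^ 4)\<^sup>2 * (4 * (k\<^sup>2 * D))"
      unfolding v_def power_mult_distrib[of "6 * \<gamma> * \<rho> ^ 4"] by (intro mult_left_mono) auto
    also have "\<dots> = 144 * (k * \<rho> ^ 4)\<^sup>2 * (D * \<gamma>\<^sup>2)" by (simp add: power_mult_distrib)
    also have "\<dots> = 144000000 * (D * \<gamma>\<^sup>2)" unfolding r4 by simp
    finally show ?thesis using 1 by (simp add: v_def algebra_simps)
  qed
  have t4: "\<gamma> * (18 * k * n * (s * \<rho> ^ 4)) \<le> 126000 * i * ((\<gamma>\<^sup>2 + \<delta>\<^sup>2) / 2)"
  proof -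
    have "\<gamma> * n * (18 * k * (s * \<rho> ^ 4)) \<le> ((\<gamma>\<^sup>2 + \<delta>\<^sup>2) / 2) * (18 * k * (7 * \<rho> ^ 3))"
    proof (rule mult_mono)
      show "18 * k * (s * \<rho> ^ 4) \<le> 18 * k * (7 * \<rho> ^ 3)" using Y kpos by (intro mult_left_mono) auto
      show "\<gamma> * n \<le> (\<gamma>\<^sup>2 + \<delta>\<^sup>2) / 2" using gd(1) mult_left_mono[OF nonneg(8) nonneg(1)] by linarith
    qed (use Y kpos nonneg rho in auto)
    also have "18 * k * (7 * \<rho> ^ 3) = 126000 * i"
      using rho by (simp add: k i_def eval_nat_numeral)
    finally show ?thesis by (simp add: algebra_simps)
  qed
  have t5: "\<gamma> * (36 * k * n * \<kappa>) \<le> 18000 * i * \<gamma>\<^sup>2 + 18000 * i ^ 3 * (n\<^sup>2 * \<kappa>\<^sup>2)"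
  proof -
    have "2 * ((\<gamma> * \<rho>) * (n * \<kappa> * i)) \<le> (\<gamma> * \<rho>)\<^sup>2 + (n * \<kappa> * i)\<^sup>2" by (rule two_mult_le_squares)
    then have "2 * (\<gamma> * (n * \<kappa>)) * (i * \<rho>) \<le> (\<gamma> * \<rho>)\<^sup>2 + (n * \<kappa> * i)\<^sup>2" by (simp add: ac_simps)
    then have "18 * k * (2 * (\<gamma> * (n * \<kappa>))) \<le> 18 * k * ((\<gamma> * \<rho>)\<^sup>2 + (n * \<kappa> * i)\<^sup>2)"
      using kpos i by (intro mult_left_mono) auto
    also have "\<dots> = 18000 * (i ^ 2 * (i * \<rho>)\<^sup>2) * \<gamma>\<^sup>2 + 18000 * i ^ 6 * (n\<^sup>2 * \<kappa>\<^sup>2)"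
      by (simp add: ki power_mult_distrib algebra_simps eval_nat_numeral)
    also have "\<dots> \<le> 18000 * i * \<gamma>\<^sup>2 + 18000 * i ^ 3 * (n\<^sup>2 * \<kappa>\<^sup>2)"
      unfolding i(3) using ik by (intro add_mono mult_right_mono) auto
    finally show ?thesis by (simp add: algebra_simps)
  qed
  have "\<gamma> * (38 * k * \<delta> + 6 * k * s + 6 * (s * \<rho> ^ 4) * (a + b) + 18 * k * n * (s * \<rho> ^ 4) + 36 * k * n * \<kappa>)
    = 38 * k * (\<gamma> * \<delta>) + 6 * k * (\<gamma> * s) + \<gamma> * (6 * (s * \<rho> ^ 4) * (a + b)) + \<gamma> * (18 * k * n * (s * \<rho> ^ 4)) + \<gamma> * (36 * k * n * \<kappa>)"
    by (simp add: algebra_simps)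
  also have "\<dots> \<le> 103000 * i * \<gamma>\<^sup>2 + 82000 * i * \<delta>\<^sup>2 + (1/256 + 3000 * i) * s\<^sup>2 + 18000 * i ^ 3 * (n\<^sup>2 * \<kappa>\<^sup>2)
      + 9216000000 * (D * \<gamma>\<^sup>2)"
  proof -
    have e: "38 * (1000 * i) * ((\<gamma>\<^sup>2 + \<delta>\<^sup>2) / 2) = 19000 * (i * \<gamma>\<^sup>2) + 19000 * (i * \<delta>\<^sup>2)"
      "6 * (1000 * i) * ((\<gamma>\<^sup>2 + s\<^sup>2) / 2) = 3000 * (i * \<gamma>\<^sup>2) + 3000 * (i * s\<^sup>2)"
      "126000 * i * ((\<gamma>\<^sup>2 + \<delta>\<^sup>2) / 2) = 63000 * (i * \<gamma>\<^sup>2) + 63000 * (i * \<delta>\<^sup>2)"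
      "(1/256 + 3000 * i) * s\<^sup>2 = (1/256) * s\<^sup>2 + 3000 * (i * s\<^sup>2)"
      by (simp_all add: distrib_left distrib_right add_divide_distrib)
    show ?thesis using t1 t2 t3 t4 t5 unfolding e unfolding mult.assoc[of _ i] by linarith
  qed
  moreover have "103000 / \<rho> = 103000 * i" "82000 / \<rho> = 82000 * i" "3000 / \<rho> = 3000 * i" "18000 / \<rho> ^ 3 = 18000 * i ^ 3"
    by (simp_all add: i_def power_one_over)
  ultimately show ?thesis by (simp only:)
qed

context slab_flow
begin

text \<open>
  The common form of the two energy estimates: plain with \<open>Q = 0\<close> in \<open>hole_filling\<close>, mollified in \<open>caccioppoli_step\<close>.
\<close>
lemma assembled_inequality:
  fixes Q Qx Qy Qz :: "real \<Rightarrow> real \<Rightarrow> real \<Rightarrow> real^3"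
  assumes phi: "C1 \<phi> \<phi>x \<phi>y (\<lambda>x y z. 0)" and phix: "C1 \<phi>x \<phi>xx \<phi>xy (\<lambda>x y z. 0)" and phiy: "C1 \<phi>y \<phi>xy \<phi>yy (\<lambda>x y z. 0)"
    and V1: "C1 V1 V1x V1y (\<lambda>x y z. 0)" and V2: "C1 V2 V2x V2y (\<lambda>x y z. 0)"
    and divV: "\<And>x y z. \<lbrakk>0 \<le> z; z \<le> 1\<rbrakk> \<Longrightarrow> V1x x y z + V2y x y z = \<phi>x x y z * Ub x y z $ 1 + \<phi>y x y z * Ub x y z $ 2"
    and p1: "C1 p1 p1x p1y p1z" and p2: "C1 p2 p2x p2y p2z"
    and p0: "\<And>x y. zprim p1 x y 1 = 0" "\<And>x y. zprim p2 x y 1 = 0"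
    and Q: "C1 Q Qx Qy Qz" "\<And>x y. Q x y 0 = 0" "\<And>x y. Q x y 1 = 0"
    and divQ: "\<And>x y z. \<lbrakk>0 \<le> z; z \<le> 1\<rbrakk> \<Longrightarrow> Qx x y z $ 1 + Qy x y z $ 2 + Qz x y z $ 3 =
       - (\<phi>x x y z * (U x y z $ 1 - profile z * Ub x y z $ 1 - p1 x y z) + \<phi>y x y z * (U x y z $ 2 - profile z * Ub x y z $ 2 - p2 x y z))"
    and L: "0 \<le> L"
    and supp: "\<And>x y z. \<bar>x\<bar> = L \<or> \<bar>y\<bar> = L \<Longrightarrow> \<phi> x y z = 0 \<and> \<phi>x x y z = 0 \<and> \<phi>y x y z = 0 \<and> V1 x y z = 0 \<and> V2 x y z = 0 \<and> Q x y z = 0"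
    and B: "cont3 B"
    and le: "\<And>x y z. \<lbrakk>\<bar>x\<bar> \<le> L; \<bar>y\<bar> \<le> L; 0 \<le> z; z \<le> 1\<rbrakk> \<Longrightarrow>
      sqrt (gsq x y z) * ((\<bar>\<phi>x x y z\<bar> + \<bar>\<phi>y x y z\<bar>) * norm (U x y z)
       + (3/2 * (\<bar>V1x x y z\<bar> + \<bar>V2x x y z\<bar>) + \<bar>(\<phi>x x y z * zprim p1x x y z + \<phi>xx x y z * zprim p1 x y z) + (\<phi>y x y z * zprim p2x x y z + \<phi>xy x y z * zprim p2 x y z)\<bar> + norm (Qx x y z))
       + (3/2 * (\<bar>V1y x y z\<bar> + \<bar>V2y x y z\<bar>) + \<bar>(\<phi>x x y z * zprim p1y x y z + \<phi>xy x y z * zprim p1 x y z) + (\<phi>y x y z * zprim p2y x y z + \<phi>yy x y z * zprim p2 x y z)\<bar> + norm (Qy x y z))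
       + (6 * (\<bar>V1 x y z\<bar> + \<bar>V2 x y z\<bar>) + \<bar>\<phi>x x y z * p1 x y z + \<phi>y x y z * p2 x y z\<bar> + norm (Qz x y z))
       + 6 * norm (U x y z) * (3/2 * (\<bar>V1 x y z\<bar> + \<bar>V2 x y z\<bar>) + \<bar>\<phi>x x y z * zprim p1 x y z + \<phi>y x y z * zprim p2 x y z\<bar> + norm (Q x y z)))
      \<le> B x y z"
  shows "I3 L (\<lambda>x y z. \<phi> x y z * gsq x y z) \<le> I3 L B"
proof -
  note id = assembled_identity[OF phi phix phiy V1 V2 divV p1 p2 p0 Q divQ L supp]
  define W where "W = (\<lambda>x y z. vector [- (profile z * V1 x y z), - (profile z * V2 x y z), - (\<phi>x x y z * zprim p1 x y z + \<phi>y x y z * zprim p2 x y z)] + Q x y z :: real^3)"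
  define Wx where "Wx = (\<lambda>x y z. vector [- (profile z * V1x x y z), - (profile z * V2x x y z),
        - ((\<phi>x x y z * zprim p1x x y z + \<phi>xx x y z * zprim p1 x y z) + (\<phi>y x y z * zprim p2x x y z + \<phi>xy x y z * zprim p2 x y z))] + Qx x y z :: real^3)"
  define Wy where "Wy = (\<lambda>x y z. vector [- (profile z * V1y x y z), - (profile z * V2y x y z),
        - ((\<phi>x x y z * zprim p1y x y z + \<phi>xy x y z * zprim p1 x y z) + (\<phi>y x y z * zprim p2y x y z + \<phi>yy x y z * zprim p2 x y z))] + Qy x y z :: real^3)"
  define Wz where "Wz = (\<lambda>x y z. vector [- (dprofile z * V1 x y z), - (dprofile z * V2 x y z), - (\<phi>x x y z * p1 x y z + \<phi>y x y z * p2 x y z)] + Qz x y z :: real^3)"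
  have CW: "C1 W Wx Wy Wz"
    unfolding W_def Wx_def Wy_def Wz_def by (rule id(1))
  define rest where "rest x y z = \<phi>x x y z * (Ux x y z \<bullet> U x y z) + \<phi>y x y z * (Uy x y z \<bullet> U x y z)
     + (Ux x y z \<bullet> Wx x y z + Uy x y z \<bullet> Wy x y z + Uz x y z \<bullet> Wz x y z) + adv x y z (W x y z)" for x y z
  have I0: "I3 L (\<lambda>x y z. \<phi> x y z * gsq x y z + rest x y z) = 0"
    unfolding rest_def W_def Wx_def Wy_def Wz_def by (rule id(2))
  note cc = cU cont3_comp[OF C1D(1)[OF CW]] cont3_comp[OF C1D(2)[OF CW]] cont3_comp[OF C1D(3)[OF CW]] cont3_comp[OF C1D(4)[OF CW]]
    cont3_comp[OF C1D(1)[OF phi]] cont3_comp[OF C1D(2)[OF phi]] cont3_comp[OF C1D(3)[OF phi]] cont3_comp[OF cont3_gsq] cont3_comp[OF B]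
  have c1: "cont3 (\<lambda>x y z. \<phi> x y z * gsq x y z)" by (intro cont3I continuous_intros cc)
  have c2: "cont3 (\<lambda>x y z. \<phi> x y z * gsq x y z + rest x y z)"
    unfolding rest_def adv_def by (intro cont3I continuous_intros cc)
  have n3: "norm (vector [- a, - b, - c] + q :: real^3) \<le> A + \<bar>c\<bar> + norm q" if "\<bar>a\<bar> + \<bar>b\<bar> \<le> A" for a b c A q
    using norm_vector3[of "-a" "-b" "-c"] norm_triangle_ineq[of "vector [- a, - b, - c]" q] that by simp
  have hb: "\<bar>profile z * a\<bar> + \<bar>profile z * b\<bar> \<le> 3/2 * (\<bar>a\<bar> + \<bar>b\<bar>)" "\<bar>dprofile z * a\<bar> + \<bar>dprofile z * b\<bar> \<le> 6 * (\<bar>a\<bar> + \<bar>b\<bar>)"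
    if "0 \<le> z" "z \<le> 1" for z a b
    unfolding abs_mult distrib_left using profile_range[OF that]
    by (intro add_mono mult_right_mono; simp)+
  have "I3 L (\<lambda>x y z. \<phi> x y z * gsq x y z) \<le> I3 L (\<lambda>x y z. (\<phi> x y z * gsq x y z + rest x y z) + B x y z)"
  proof (rule I3_mono[OF c1])
    show "cont3 (\<lambda>x y z. (\<phi> x y z * gsq x y z + rest x y z) + B x y z)"
      by (intro cont3I continuous_intros cont3_comp[OF c2] cc)
    fix x y z :: real assume xyz: "\<bar>x\<bar> \<le> L" "\<bar>y\<bar> \<le> L" "0 \<le> z" "z \<le> 1"
    note b = n3[OF hb(1)[OF xyz(3,4)]] n3[OF hb(2)[OF xyz(3,4)]]
    have nW: "norm (W x y z) \<le> 3/2 * (\<bar>V1 x y z\<bar> + \<bar>V2 x y z\<bar>) + \<bar>\<phi>x x y z * zprim p1 x y z + \<phi>y x y z * zprim p2 x y z\<bar> + norm (Q x y z)"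
      "norm (Wx x y z) \<le> 3/2 * (\<bar>V1x x y z\<bar> + \<bar>V2x x y z\<bar>) + \<bar>(\<phi>x x y z * zprim p1x x y z + \<phi>xx x y z * zprim p1 x y z) + (\<phi>y x y z * zprim p2x x y z + \<phi>xy x y z * zprim p2 x y z)\<bar> + norm (Qx x y z)"
      "norm (Wy x y z) \<le> 3/2 * (\<bar>V1y x y z\<bar> + \<bar>V2y x y z\<bar>) + \<bar>(\<phi>x x y z * zprim p1y x y z + \<phi>xy x y z * zprim p1 x y z) + (\<phi>y x y z * zprim p2y x y z + \<phi>yy x y z * zprim p2 x y z)\<bar> + norm (Qy x y z)"
      "norm (Wz x y z) \<le> 6 * (\<bar>V1 x y z\<bar> + \<bar>V2 x y z\<bar>) + \<bar>\<phi>x x y z * p1 x y z + \<phi>y x y z * p2 x y z\<bar> + norm (Qz x y z)"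
      unfolding W_def Wx_def Wy_def Wz_def by (rule b)+
    have "\<bar>rest x y z\<bar> \<le> sqrt (gsq x y z) * ((\<bar>\<phi>x x y z\<bar> + \<bar>\<phi>y x y z\<bar>) * norm (U x y z) + norm (Wx x y z) + norm (Wy x y z) + norm (Wz x y z) + 6 * norm (U x y z) * norm (W x y z))"
      unfolding rest_def by (rule rest_le)
    also have "\<dots> \<le> B x y z"
      by (rule order_trans[OF _ le[OF xyz]]) (intro mult_left_mono add_mono order_refl nW; simp add: gsq_nonneg)
    finally show "\<phi> x y z * gsq x y z \<le> (\<phi> x y z * gsq x y z + rest x y z) + B x y z" by linarith
  qed
  also have "\<dots> = I3 L B" using I0 I3_add[OF c2 B] by simp
  finally show ?thesis .
qed

text \<open>
  The correction is the plain one: the whole of \<open>U - profile Ub\<close> goes into the vertical primitive. Its horizontal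
  derivative costs a full gradient, but multiplied by \<open>|\<nabla>\<phi>| \<le> 1000/R\<close>, which is harmless here, where
  the energy of the big box may appear on the right.
\<close>
lemma hole_filling:
  fixes \<rho> :: real
  assumes rho: "10 ^ 7 \<le> \<rho>" and R: "R = \<rho> ^ 4" and E: "E = I3 (2*R) gsq" and Eb: "E \<le> \<rho>\<^sup>2"
  shows "I3 (2*R) (\<lambda>x y z. cutoff R (2*R) x y z * gsq x y z) \<le> E / 2 + 9216000000 *
     (I3 (2*R) (\<lambda>x y z. cutoff (2*R) (2*(2*R)) x y z * gsq x y z) - I3 (2*R) (\<lambda>x y z. cutoff R (2*R) x y z * gsq x y z))"
proof -
  have rho1: "1 \<le> \<rho>" using rho by simp
  have R1: "1 \<le> R" using rho1 by (simp add: R one_le_power)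
  have E0: "0 \<le> E" unfolding E by (intro I3_nonneg cont3_gsq gsq_nonneg)
  obtain y0 where sup: "\<And>x y z. \<bar>x\<bar> \<le> 2*R \<Longrightarrow> \<bar>y\<bar> \<le> 2*R \<Longrightarrow> (psi y0 x y z)\<^sup>2 \<le> 24 * (2*R) * E"
    and L2: "I3 (2*R) (\<lambda>x y z. (psi y0 x y z)\<^sup>2) \<le> 16 * (2*R)\<^sup>2 * E"
    using psi_bounds[of "2*R"] R1 unfolding E by auto
  define k where "k = 1000 / R"
  define \<phi> where "\<phi> = cutoff R (2*R)"
  define \<phi>x where "\<phi>x = cutoff_x R (2*R)"
  define \<phi>y where "\<phi>y = cutoff_y R (2*R)"
  define \<phi>xx where "\<phi>xx = cutoff_xx R (2*R)"
  define \<phi>xy where "\<phi>xy = cutoff_xy R (2*R)"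
  define \<phi>yy where "\<phi>yy = cutoff_yy R (2*R)"
  define \<phi>2 where "\<phi>2 = cutoff (2*R) (2*(2*R))"
  define \<psi> where "\<psi> = psi y0"
  note folds = \<phi>_def[symmetric] \<phi>x_def[symmetric] \<phi>y_def[symmetric] \<phi>xx_def[symmetric] \<phi>xy_def[symmetric] \<phi>yy_def[symmetric]
  have st: "0 \<le> R" "R < 2*R" using R1 by auto
  have phib: "\<bar>\<phi>x x y z\<bar> \<le> k" "\<bar>\<phi>y x y z\<bar> \<le> k" "\<bar>\<phi>xx x y z\<bar> \<le> k / R" "\<bar>\<phi>xy x y z\<bar> \<le> k / R" "\<bar>\<phi>yy x y z\<bar> \<le> k / R"
    "(\<phi>x x y z)\<^sup>2 \<le> k\<^sup>2 * (1 - \<phi> x y z)" "(\<phi>y x y z)\<^sup>2 \<le> k\<^sup>2 * (1 - \<phi> x y z)" for x y z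
    using cutoff_x_bounds[OF st, of x y z] cutoff_y_bounds[OF st, of x y z] unfolding folds k_def by (auto simp: power2_eq_square)
  have Db: "(\<phi>x x y z)\<^sup>2 \<le> k\<^sup>2 * (\<phi>2 x y z - \<phi> x y z) \<and> (\<phi>y x y z)\<^sup>2 \<le> k\<^sup>2 * (\<phi>2 x y z - \<phi> x y z)" for x y z
  proof (cases "x\<^sup>2 + y\<^sup>2 \<le> (2*R)\<^sup>2")
    case True
    then have "\<phi>2 x y z = 1" unfolding \<phi>2_def using R1 by (intro cutoff_one) auto
    then show ?thesis using phib(6,7)[of x y z] by simp
  next
    case False
    then have "\<phi>x x y z = 0" "\<phi>y x y z = 0" unfolding \<phi>x_def \<phi>y_def using cutoff_zero(2,3)[OF st, of x y z] by auto
    moreover have "\<phi> x y z \<le> \<phi>2 x y z" unfolding \<phi>_def \<phi>2_def by (rule cutoff_mono) (use R1 in auto)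
    ultimately show ?thesis by simp
  qed
  have CV1: "C1 (\<lambda>x y z. - (\<psi> x y z * \<phi>y x y z)) (\<lambda>x y z. - (\<psi> x y z * \<phi>xy x y z + - (Ub x y z $ 2) * \<phi>y x y z))
      (\<lambda>x y z. - (\<psi> x y z * \<phi>yy x y z + Ub x y z $ 1 * \<phi>y x y z)) (\<lambda>x y z. 0)"
    unfolding \<psi>_def \<phi>y_def \<phi>xy_def \<phi>yy_def
    by (rule C1_eq[OF C1_minus[OF C1_mult[OF C1_psi[of y0] C1_cutoff_y[of R "2*R"]]]]) simp_all
  have CV2: "C1 (\<lambda>x y z. \<psi> x y z * \<phi>x x y z) (\<lambda>x y z. \<psi> x y z * \<phi>xx x y z + - (Ub x y z $ 2) * \<phi>x x y z)
      (\<lambda>x y z. \<psi> x y z * \<phi>xy x y z + Ub x y z $ 1 * \<phi>x x y z) (\<lambda>x y z. 0)"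
    unfolding \<psi>_def \<phi>x_def \<phi>xx_def \<phi>xy_def
    by (rule C1_eq[OF C1_mult[OF C1_psi[of y0] C1_cutoff_x[of R "2*R"]]]) simp_all
  note Cphi = C1_cutoff[of R "2*R", unfolded folds] C1_cutoff_x[of R "2*R", unfolded folds] C1_cutoff_y[of R "2*R", unfolded folds]
  define B where "B x y z = (103000 / \<rho>) * gsq x y z + (82000 / \<rho>) * dsq x y z + ((1/256 + 3000 / \<rho>) / R\<^sup>2) * (\<psi> x y z)\<^sup>2
     + (18000 / \<rho> ^ 3) * ((norm (U x y z))\<^sup>2 * qsq x y z) + 9216000000 * ((\<phi>2 x y z - \<phi> x y z) * gsq x y z)" for x y z
  have cphi: "cont3 \<phi>" "cont3 \<phi>2" unfolding \<phi>_def \<phi>2_def by (rule cont3_cutoff)+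
  have cpsi: "cont3 \<psi>" unfolding \<psi>_def by (rule C1D(1)[OF C1_psi])
  note cc = cU cont3_comp[OF cont3_gsq] cont3_comp[OF cont3_dsq] cont3_comp[OF cont3_qsq] cont3_comp[OF cphi(1)] cont3_comp[OF cphi(2)] cont3_comp[OF cpsi]
  have cB: "cont3 B" unfolding B_def by (intro cont3I continuous_intros cc)
  have "I3 (2*R) (\<lambda>x y z. \<phi> x y z * gsq x y z) \<le> I3 (2*R) B"
  proof (rule assembled_inequality[OF Cphi CV1 CV2 _ C1_corr_U[of 1] C1_corr_U[of 2]
      zprim_corr_one[OF C1D(1)[OF U]] zprim_corr_one[OF C1D(1)[OF U]] C1_const[of 0] refl refl _ _ _ cB], goal_cases)
    case (4 x y z)
    then have "(2*R)\<^sup>2 \<le> x\<^sup>2 + y\<^sup>2" by (metis add_increasing add_increasing2 order_refl power2_abs zero_le_power2)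
    from cutoff_zero[OF st this] show ?case by (simp add: folds)
  next
    case (5 x y z)
    \<comment> \<open>all fields at the point are bounded by these five numbers; \<open>k\<close> bounds the gradient of the cutoff\<close>
    define g n d q s where "g = sqrt (gsq x y z)" and "n = norm (U x y z)" and "d = sqrt (dsq x y z)" and "q = sqrt (qsq x y z)"
      and "s = \<bar>\<psi> x y z\<bar> / R"
    have nn: "0 \<le> g" "0 \<le> n" "0 \<le> d" "0 \<le> q" "0 \<le> s" unfolding g_def n_def d_def q_def s_def
      using R1 by (auto simp: gsq_nonneg dsq_nonneg qsq_nonneg)
    have sq: "g\<^sup>2 = gsq x y z" "d\<^sup>2 = dsq x y z" "q\<^sup>2 = qsq x y z" unfolding g_def d_def q_def
      by (simp_all add: gsq_nonneg dsq_nonneg qsq_nonneg)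
    have nd: "n \<le> d" unfolding n_def d_def by (rule real_le_rsqrt) (rule norm_U_sq_le[OF 5(3,4)])
    have qd: "q \<le> d" unfolding q_def d_def by (simp add: qsq_le_dsq)
    have ps: "\<bar>\<psi> x y z\<bar> = s * R" using R1 by (simp add: s_def)
    have k0: "0 \<le> k" using R1 by (simp add: k_def)
    have kR: "k / R \<le> k" using k0 R1 by (simp add: divide_le_eq mult_right_mono[of 1 R k, simplified] mult.commute)
    have ub: "\<bar>Ub x y z $ i\<bar> \<le> q" for i
      unfolding q_def using ubar_sq[of x y z i z] by (intro abs_le_of_sq) (auto simp: qsq_nonneg)
    have m: "\<bar>a * b\<bar> \<le> A * C" if "\<bar>a\<bar> \<le> A" "\<bar>b\<bar> \<le> C" for a b A C :: real
      unfolding abs_mult using that by (intro mult_mono) auto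
    note cb = corr_bounds[OF 5(3,4), of _ x y, folded q_def d_def]
    have kRs: "\<bar>\<psi> x y z * F\<bar> \<le> k * s" if "\<bar>F\<bar> \<le> k / R" for F
      using m[of "\<psi> x y z" "s * R" F "k / R"] that ps R1 by (simp add: mult.commute)
    have Vd: "\<bar>- (\<psi> x y z * F + - G * H)\<bar> \<le> k * s + k * d" "\<bar>- (\<psi> x y z * F + G * H)\<bar> \<le> k * s + k * d"
        "\<bar>\<psi> x y z * F + - G * H\<bar> \<le> k * s + k * d" "\<bar>\<psi> x y z * F + G * H\<bar> \<le> k * s + k * d"
      if "\<bar>F\<bar> \<le> k / R" "\<bar>G\<bar> \<le> q" "\<bar>H\<bar> \<le> k" for F G H
      using kRs[OF that(1)] m[OF that(2,3)] mult_left_mono[OF qd k0] by (auto simp: mult.commute abs_le_iff)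
    have V0: "\<bar>- (\<psi> x y z * \<phi>y x y z)\<bar> + \<bar>\<psi> x y z * \<phi>x x y z\<bar> = (s * R) * (\<bar>\<phi>x x y z\<bar> + \<bar>\<phi>y x y z\<bar>)"
      using ps by (simp add: abs_mult algebra_simps)
    have ab: "\<bar>\<phi>x x y z\<bar> + \<bar>\<phi>y x y z\<bar> \<le> 2 * k" using phib(1,2)[of x y z] by linarith
    have Gd: "\<bar>(F1 * M1 + F2 * M2) + (F3 * M3 + F4 * M4)\<bar> \<le> 12 * k * d"
      if "\<bar>F1\<bar> \<le> k" "\<bar>F2\<bar> \<le> k / R" "\<bar>F3\<bar> \<le> k" "\<bar>F4\<bar> \<le> k / R" "\<bar>M1\<bar> \<le> 3 * d" "\<bar>M2\<bar> \<le> 3 * q" "\<bar>M3\<bar> \<le> 3 * d" "\<bar>M4\<bar> \<le> 3 * q"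
      for F1 F2 F3 F4 M1 M2 M3 M4 :: real
    proof -
      have "\<bar>F2\<bar> \<le> k" "\<bar>F4\<bar> \<le> k" "\<bar>M2\<bar> \<le> 3 * d" "\<bar>M4\<bar> \<le> 3 * d" using that kR qd by linarith+
      then have "\<bar>F1 * M1\<bar> \<le> k * (3 * d)" "\<bar>F2 * M2\<bar> \<le> k * (3 * d)" "\<bar>F3 * M3\<bar> \<le> k * (3 * d)" "\<bar>F4 * M4\<bar> \<le> k * (3 * d)"
        using that by (auto intro!: m)
      then show ?thesis by linarith
    qed
    have G2: "\<bar>F1 * M1 + F2 * M2\<bar> \<le> 6 * k * D" if "\<bar>F1\<bar> \<le> k" "\<bar>F2\<bar> \<le> k" "\<bar>M1\<bar> \<le> 3 * D" "\<bar>M2\<bar> \<le> 3 * D" for F1 F2 M1 M2 D :: real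
      using m[OF that(1,3)] m[OF that(2,4)] by linarith
    \<comment> \<open>the supremum bound for the stream function and the smallness of the energy, \<open>48 \<le> 7\<^sup>2\<close>\<close>
    have Y: "s * \<rho> ^ 4 \<le> 7 * \<rho> ^ 3"
    proof -
      have "(\<psi> x y z)\<^sup>2 \<le> 48 * R * E" using sup[OF 5(1,2), of z] by (simp add: \<psi>_def)
      also have "\<dots> \<le> 48 * R * \<rho>\<^sup>2" using Eb R1 by (intro mult_left_mono) auto
      also have "\<dots> = 48 * \<rho> ^ 6" by (simp add: R mult.assoc flip: power_add)
      also have "\<dots> \<le> (7 * \<rho> ^ 3)\<^sup>2" using rho1 by (simp add: power_mult_distrib flip: power_mult)
      finally have "\<bar>\<psi> x y z\<bar> \<le> 7 * \<rho> ^ 3" using rho1 by (intro abs_le_of_sq) auto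
      then show ?thesis using ps R by simp
    qed
    have c1: "(\<bar>\<phi>x x y z\<bar> + \<bar>\<phi>y x y z\<bar>) * n \<le> 2 * k * d" using ab nd nn k0 by (intro mult_mono) auto
    have c5: "6 * n * (3/2 * ((s * R) * (\<bar>\<phi>x x y z\<bar> + \<bar>\<phi>y x y z\<bar>)) + A + norm (0::real^3)) \<le> 6 * n * (3 * (s * R * k) + 6 * k * q)"
      if "A \<le> 6 * k * q" for A
    proof -
      have "(s * R) * (\<bar>\<phi>x x y z\<bar> + \<bar>\<phi>y x y z\<bar>) \<le> (s * R) * (2 * k)" using ab nn R1 by (intro mult_left_mono) auto
      then show ?thesis using that nn by (intro mult_left_mono) auto
    qed
    have c2: "3/2 * (a + b) + c + norm (0::real^3) \<le> 3/2 * (2 * (k * s + k * d)) + 12 * k * d"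
      if "a \<le> k * s + k * d" "b \<le> k * s + k * d" "c \<le> 12 * k * d" for a b c :: real
    proof -
      have "a + b \<le> 2 * (k * s + k * d)" unfolding mult_2 by (rule add_mono[OF that(1,2)])
      then have "3/2 * (a + b) \<le> 3/2 * (2 * (k * s + k * d))" by (rule mult_left_mono) simp
      then show ?thesis using that(3) by (simp only: norm_zero add_0_right)
    qed
    have c4: "6 * a + c + norm (0::real^3) \<le> 6 * a + 6 * k * d" if "c \<le> 6 * k * d" for a c
      using that by simp
    have "sqrt (gsq x y z) * ((\<bar>\<phi>x x y z\<bar> + \<bar>\<phi>y x y z\<bar>) * norm (U x y z)
       + (3/2 * (\<bar>- (\<psi> x y z * \<phi>xy x y z + - (Ub x y z $ 2) * \<phi>y x y z)\<bar> + \<bar>\<psi> x y z * \<phi>xx x y z + - (Ub x y z $ 2) * \<phi>x x y z\<bar>)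
          + \<bar>(\<phi>x x y z * zprim (corr Ux 1) x y z + \<phi>xx x y z * zprim (corr U 1) x y z) + (\<phi>y x y z * zprim (corr Ux 2) x y z + \<phi>xy x y z * zprim (corr U 2) x y z)\<bar> + norm (0::real^3))
       + (3/2 * (\<bar>- (\<psi> x y z * \<phi>yy x y z + Ub x y z $ 1 * \<phi>y x y z)\<bar> + \<bar>\<psi> x y z * \<phi>xy x y z + Ub x y z $ 1 * \<phi>x x y z\<bar>)
          + \<bar>(\<phi>x x y z * zprim (corr Uy 1) x y z + \<phi>xy x y z * zprim (corr U 1) x y z) + (\<phi>y x y z * zprim (corr Uy 2) x y z + \<phi>yy x y z * zprim (corr U 2) x y z)\<bar> + norm (0::real^3))
       + (6 * (\<bar>- (\<psi> x y z * \<phi>y x y z)\<bar> + \<bar>\<psi> x y z * \<phi>x x y z\<bar>) + \<bar>\<phi>x x y z * corr U 1 x y z + \<phi>y x y z * corr U 2 x y z\<bar> + norm (0::real^3))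
       + 6 * norm (U x y z) * (3/2 * (\<bar>- (\<psi> x y z * \<phi>y x y z)\<bar> + \<bar>\<psi> x y z * \<phi>x x y z\<bar>) + \<bar>\<phi>x x y z * zprim (corr U 1) x y z + \<phi>y x y z * zprim (corr U 2) x y z\<bar> + norm (0::real^3)))
      \<le> g * (2 * k * d + (3/2 * (2 * (k * s + k * d)) + 12 * k * d) + (3/2 * (2 * (k * s + k * d)) + 12 * k * d)
        + (6 * (s * R * (\<bar>\<phi>x x y z\<bar> + \<bar>\<phi>y x y z\<bar>)) + 6 * k * d) + 6 * n * (3 * (s * R * k) + 6 * k * q))"
      unfolding g_def[symmetric] n_def[symmetric] V0
      by (intro mult_left_mono[OF _ nn(1)] add_mono c1 c2 c4 c5 Vd(1)[OF phib(4) ub phib(2)] Vd(3)[OF phib(3) ub phib(1)]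
        Vd(2)[OF phib(5) ub phib(2)] Vd(4)[OF phib(4) ub phib(1)]
        Gd[OF phib(1) phib(3) phib(2) phib(4) cb(2) cb(1) cb(2) cb(1)] Gd[OF phib(1) phib(4) phib(2) phib(5) cb(3) cb(1) cb(3) cb(1)]
        G2[OF phib(1,2) cb(4) cb(4)] G2[OF phib(1,2) cb(1) cb(1)])
    also have "\<dots> = g * (38 * k * d + 6 * k * s + 6 * (s * \<rho> ^ 4) * (\<bar>\<phi>x x y z\<bar> + \<bar>\<phi>y x y z\<bar>) + 18 * k * n * (s * \<rho> ^ 4) + 36 * k * n * q)"
      by (simp add: R algebra_simps)
    also have "\<dots> \<le> (103000 / \<rho>) * g\<^sup>2 + (82000 / \<rho>) * d\<^sup>2 + (1/256 + 3000 / \<rho>) * s\<^sup>2 + (18000 / \<rho> ^ 3) * (n\<^sup>2 * q\<^sup>2)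
      + 9216000000 * ((\<phi>2 x y z - \<phi> x y z) * g\<^sup>2)"
      using Db[of x y z] by (intro pointwise_arith rho1 nn nd Y) (auto simp: k_def R)
    also have "\<dots> = B x y z" unfolding B_def sq n_def s_def by (simp add: power_divide)
    finally show ?case .
  qed (use R1 in \<open>auto simp: corr_def algebra_simps\<close>)
  also have "I3 (2*R) B = (103000 / \<rho>) * E + (82000 / \<rho>) * E + ((1/256 + 3000 / \<rho>) / R\<^sup>2) * I3 (2*R) (\<lambda>x y z. (\<psi> x y z)\<^sup>2)
     + (18000 / \<rho> ^ 3) * I3 (2*R) (\<lambda>x y z. (qsq x y z)\<^sup>2)
     + 9216000000 * (I3 (2*R) (\<lambda>x y z. \<phi>2 x y z * gsq x y z) - I3 (2*R) (\<lambda>x y z. \<phi> x y z * gsq x y z))"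
  proof -
    have q: "I3 (2*R) (\<lambda>x y z. (norm (U x y z))\<^sup>2 * qsq x y z) = I3 (2*R) (\<lambda>x y z. (qsq x y z)\<^sup>2)"
      using I3_weight_zavg[OF cont3_nU cont3_qsq, of "2*R", folded qsq_def]
      by (simp add: power2_eq_square mult.commute) (simp add: qsq_def zavg_def)
    have "I3 (2*R) (\<lambda>x y z. (\<phi>2 x y z - \<phi> x y z) * gsq x y z) = I3 (2*R) (\<lambda>x y z. \<phi>2 x y z * gsq x y z + (-1) * (\<phi> x y z * gsq x y z))"
      by (intro I3_cong) (simp add: algebra_simps)
    also have "\<dots> = I3 (2*R) (\<lambda>x y z. \<phi>2 x y z * gsq x y z) + I3 (2*R) (\<lambda>x y z. (-1) * (\<phi> x y z * gsq x y z))"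
      by (rule I3_add) (intro cont3I continuous_intros cc)+
    finally have p: "I3 (2*R) (\<lambda>x y z. (\<phi>2 x y z - \<phi> x y z) * gsq x y z) = I3 (2*R) (\<lambda>x y z. \<phi>2 x y z * gsq x y z) - I3 (2*R) (\<lambda>x y z. \<phi> x y z * gsq x y z)"
      unfolding I3_cmul by simp
    have "I3 (2*R) B = (103000 / \<rho>) * I3 (2*R) gsq + (82000 / \<rho>) * I3 (2*R) dsq + ((1/256 + 3000 / \<rho>) / R\<^sup>2) * I3 (2*R) (\<lambda>x y z. (\<psi> x y z)\<^sup>2)
     + (18000 / \<rho> ^ 3) * I3 (2*R) (\<lambda>x y z. (norm (U x y z))\<^sup>2 * qsq x y z) + 9216000000 * I3 (2*R) (\<lambda>x y z. (\<phi>2 x y z - \<phi> x y z) * gsq x y z)"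
      unfolding B_def I3_cmul[symmetric]
      by (subst I3_add, (intro cont3I continuous_intros cc)[1], (intro cont3I continuous_intros cc)[1])+ (rule refl)
    then show ?thesis unfolding q p I3_zavg[OF cont3_gsq] E by simp
  qed
  also have "\<dots> \<le> E / 2 + 9216000000 * (I3 (2*R) (\<lambda>x y z. \<phi>2 x y z * gsq x y z) - I3 (2*R) (\<lambda>x y z. \<phi> x y z * gsq x y z))"
  proof -
    have "((1/256 + 3000 / \<rho>) / R\<^sup>2) * I3 (2*R) (\<lambda>x y z. (\<psi> x y z)\<^sup>2) \<le> ((1/256 + 3000 / \<rho>) / R\<^sup>2) * (16 * (2*R)\<^sup>2 * E)"
      unfolding \<psi>_def using L2 rho1 by (intro mult_left_mono) auto
    also have "\<dots> = (1/256 + 3000 / \<rho>) * (64 * E)" using R1 by (simp add: power2_eq_square)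
    also have "\<dots> = E / 4 + 192000 / \<rho> * E" by (simp add: algebra_simps)
    finally have 1: "((1/256 + 3000 / \<rho>) / R\<^sup>2) * I3 (2*R) (\<lambda>x y z. (\<psi> x y z)\<^sup>2) \<le> E / 4 + 192000 / \<rho> * E" .
    have "(18000 / \<rho> ^ 3) * I3 (2*R) (\<lambda>x y z. (qsq x y z)\<^sup>2) \<le> (18000 / \<rho> ^ 3) * (9 * E\<^sup>2)"
      using I3_qsq_sq[of "2*R"] R1 rho1 unfolding E by (intro mult_left_mono) auto
    also have "\<dots> \<le> (18000 / \<rho> ^ 3) * (9 * (\<rho>\<^sup>2 * E))"
      using rho1 Eb E0 by (intro mult_left_mono) (auto simp: power2_eq_square intro: mult_right_mono)
    also have "\<dots> = 162000 / \<rho> * E" using rho1 by (simp add: eval_nat_numeral)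
    finally have 2: "(18000 / \<rho> ^ 3) * I3 (2*R) (\<lambda>x y z. (qsq x y z)\<^sup>2) \<le> 162000 / \<rho> * E" .
    \<comment> \<open>the Poincare term contributes \<open>64/256\<close>; all other multiples of \<open>E\<close> together stay below the second quarter\<close>
    have "539000 / \<rho> \<le> 1/4" using rho by (simp add: divide_le_eq)
    then have "539000 / \<rho> * E \<le> (1/4) * E" using E0 by (rule mult_right_mono)
    moreover have "539000 / \<rho> * E = (103000 / \<rho>) * E + (82000 / \<rho>) * E + 192000 / \<rho> * E + 162000 / \<rho> * E"
      by (simp add: add_divide_distrib[symmetric] distrib_right[symmetric])
    ultimately show ?thesis using 1 2 by linarith
  qed
  finally show ?thesis unfolding \<phi>_def \<phi>2_def .
qed

end

section \<open>Iteration over the scales\<close>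

definition hole_const :: real where "hole_const = 9216000000"
definition theta :: real where "theta = (1/2 + hole_const) / (1 + hole_const)"
text \<open>
  The decisive power: \<open>\<theta>\<close> gained at every step from \<open>4R\<close> down to \<open>R\<close> beats the growth of \<open>T\<close> to this power, even if only half of
  the steps between \<open>1\<close> and \<open>T\<close> are used and half of the gain is spent.
\<close>
definition growth_exp :: real where "growth_exp = min (1/8) (log 16 (1 / sqrt theta))"

lemma theta_bounds: "0 < theta" "theta < 1" by (simp_all add: theta_def hole_const_def)

lemma growth_exp_bounds: "0 < growth_exp" "growth_exp \<le> 1/8" "16 powr growth_exp * sqrt theta \<le> 1"
proof -
  have s: "0 < sqrt theta" "sqrt theta < 1" using theta_bounds by auto
  then show "0 < growth_exp" by (simp add: growth_exp_def)
  show "growth_exp \<le> 1/8" by (simp add: growth_exp_def)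
  have "16 powr growth_exp \<le> 16 powr (log 16 (1 / sqrt theta))"
    by (intro powr_mono) (auto simp: growth_exp_def)
  also have "\<dots> = 1 / sqrt theta" using s by (intro powr_log_cancel) auto
  finally show "16 powr growth_exp * sqrt theta \<le> 1" using s by (simp add: field_simps)
qed

context slab_flow
begin

definition F :: "real \<Rightarrow> real" where "F R = I3 (2*R) (\<lambda>x y z. cutoff R (2*R) x y z * gsq x y z)"

lemma cont3_cutoff_gsq: "cont3 (\<lambda>x y z. cutoff s t x y z * gsq x y z)"
  by (intro cont3_comps cont3_cutoff cont3_gsq)

lemma cutoff_gsq_nonneg: "0 \<le> cutoff s t x y z * gsq x y z"
  by (intro mult_nonneg_nonneg cutoff_range gsq_nonneg)

lemma F_nonneg: "0 \<le> F R" unfolding F_def by (intro I3_nonneg cont3_cutoff_gsq cutoff_gsq_nonneg)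

lemma F_mono:
  assumes "0 < R" "R \<le> R'" shows "F R \<le> F R'"
proof -
  have "F R \<le> I3 (2*R') (\<lambda>x y z. cutoff R (2*R) x y z * gsq x y z)"
    unfolding F_def using assms by (intro I3_mono_box cont3_cutoff_gsq cutoff_gsq_nonneg) auto
  also have "\<dots> \<le> F R'" unfolding F_def
    using assms by (intro I3_mono cont3_cutoff_gsq mult_right_mono cutoff_mono gsq_nonneg)
  finally show ?thesis .
qed

lemma box_le_F: assumes "0 < R" "cont3 w" "\<And>x y z. w x y z \<le> gsq x y z" shows "I3 (2*R) w \<le> F (4*R)"
proof -
  have "I3 (2*R) w \<le> I3 (2*R) (\<lambda>x y z. cutoff (4*R) (2*(4*R)) x y z * gsq x y z)"
  proof (rule I3_mono[OF assms(2) cont3_cutoff_gsq])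
    fix x y z :: real assume xy: "\<bar>x\<bar> \<le> 2*R" "\<bar>y\<bar> \<le> 2*R"
    have "x\<^sup>2 \<le> 4*R\<^sup>2" "y\<^sup>2 \<le> 4*R\<^sup>2" "(4*R)\<^sup>2 = 16 * R\<^sup>2" "0 \<le> R\<^sup>2"
      using power_mono[OF xy(1), of 2] power_mono[OF xy(2), of 2] by (simp_all add: power_mult_distrib)
    then have "x\<^sup>2 + y\<^sup>2 \<le> (4*R)\<^sup>2" by linarith
    then have "cutoff (4*R) (2*(4*R)) x y z = 1" using assms(1) by (intro cutoff_one) auto
    then show "w x y z \<le> cutoff (4*R) (2*(4*R)) x y z * gsq x y z" using assms(3) by simp
  qed
  also have "\<dots> \<le> F (4*R)"
    unfolding F_def using assms(1) by (intro I3_mono_box cont3_cutoff_gsq cutoff_gsq_nonneg) auto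
  finally show ?thesis .
qed

text \<open>
  The energy of the box of half-side \<open>2R\<close> and the energy weighted with the cutoff at scale \<open>2R\<close> are both at
  most \<open>F (4*R)\<close>; solving \<open>hole_filling\<close> for \<open>F R\<close> gives the factor \<open>theta\<close>.
\<close>
lemma F_step:
  assumes R: "10 ^ 28 \<le> R" and small: "F (4*R) \<le> sqrt R"
  shows "F R \<le> theta * F (4*R)"
proof -
  define \<rho> where "\<rho> = sqrt (sqrt R)"
  have R0: "0 < R" using R by simp
  have r2: "\<rho>\<^sup>2 = sqrt R" unfolding \<rho>_def using R0 by simp
  have "\<rho> ^ 4 = (\<rho>\<^sup>2)\<^sup>2" by (simp flip: power_mult)
  then have r4: "R = \<rho> ^ 4" using R0 r2 by simp
  have rho: "10 ^ 7 \<le> \<rho>" unfolding \<rho>_def using R by (intro real_le_rsqrt) simp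
  have b: "I3 (2*R) gsq \<le> F (4*R)" by (rule box_le_F[OF R0 cont3_gsq order_refl])
  have c: "I3 (2*R) (\<lambda>x y z. cutoff (2*R) (2*(2*R)) x y z * gsq x y z) \<le> F (4*R)"
    by (rule box_le_F[OF R0 cont3_cutoff_gsq]) (use cutoff_range gsq_nonneg in \<open>simp add: mult_left_le_one_le\<close>)
  have "F R \<le> I3 (2*R) gsq / 2 + hole_const * (I3 (2*R) (\<lambda>x y z. cutoff (2*R) (2*(2*R)) x y z * gsq x y z) - F R)"
    unfolding F_def hole_const_def by (rule hole_filling[OF rho r4 refl]) (use b small r2 in simp)
  also have "\<dots> \<le> F (4*R) / 2 + hole_const * (F (4*R) - F R)"
    using b c by (intro add_mono mult_left_mono) (auto simp: hole_const_def)
  finally have "(1 + hole_const) * F R \<le> (1/2 + hole_const) * F (4*R)" by (simp add: algebra_simps)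
  then show ?thesis by (simp add: theta_def hole_const_def field_simps)
qed

text \<open>
  Descend from \<open>T\<close> in \<open>n\<close> steps of factor 4, where \<open>16\<^sup>n \<le> T < 16\<^sup>n\<^sup>+\<^sup>1\<close>. All radii on the way are at least \<open>\<surd>T\<close>, so the smallness
  condition of \<open>F_step\<close> follows from \<open>growth_exp \<le> 1/8\<close> once \<open>T\<close> is large; at the end the energy is at most a multiple of
  \<open>(\<surd>theta)\<^sup>n\<close>.
\<close>
lemma F_zero:
  assumes K: "0 < K" and often: "\<And>T0. \<exists>T\<ge>T0. F T \<le> K * T powr growth_exp" and R1: "0 < R1"
  shows "F R1 = 0"
proof -
  define \<mu> where "\<mu> = sqrt theta"
  have mu: "0 < \<mu>" "\<mu> < 1" "\<mu> * \<mu> = theta" using theta_bounds by (auto simp: \<mu>_def)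
  have le: "F R1 \<le> e" if e: "0 < e" for e
  proof -
    have "(\<lambda>n. (2 * K) * \<mu> ^ n) \<longlonglongrightarrow> (2 * K) * 0"
      by (intro tendsto_intros LIMSEQ_power_zero) (use mu in auto)
    then have "eventually (\<lambda>n. (2 * K) * \<mu> ^ n < e) sequentially" using e by (auto elim!: order_tendstoD)
    then obtain N where N: "\<And>n. N \<le> n \<Longrightarrow> 2 * K * \<mu> ^ n < e" by (auto simp: eventually_sequentially)
    define T0 where "T0 = max (16 ^ N) (max ((10 ^ 28)\<^sup>2) (max (K ^ 8) (R1\<^sup>2)))"
    obtain T where T: "T0 \<le> T" "F T \<le> K * T powr growth_exp" using often by blast
    have T1: "1 \<le> T" "16 ^ N \<le> T" "(10 ^ 28)\<^sup>2 \<le> T" "K ^ 8 \<le> T" "R1\<^sup>2 \<le> T"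
      using T(1) unfolding T0_def by auto
    obtain n where n: "16 ^ n \<le> T" "T < 16 ^ Suc n"
    proof -
      define n where "n = (LEAST n. T < 16 ^ Suc n)"
      obtain m where "T < 16 ^ m" using real_arch_pow[of 16 T] by auto
      then have "T < 16 ^ Suc m" by (simp add: less_le_trans)
      then have a: "T < 16 ^ Suc n" unfolding n_def by (rule LeastI)
      have "16 ^ n \<le> T"
      proof (cases n)
        case (Suc m)
        then have "\<not> T < 16 ^ Suc m" unfolding n_def by (intro not_less_Least) simp
        then show ?thesis using Suc by simp
      qed (use T1 in simp)
      then show thesis using a that by blast
    qed
    have Nn: "N \<le> n"
    proof -
      have "(16::real) ^ N < 16 ^ Suc n" using T1(2) n(2) by linarith
      then have "N < Suc n" by (rule power_less_imp_less_exp[rotated]) simp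
      then show ?thesis by simp
    qed
    have n4: "4 ^ n \<le> sqrt T"
      by (rule real_le_rsqrt) (use n(1) in \<open>simp add: power_mult[symmetric] mult.commute[of n] power_mult\<close>)
    have Tn: "sqrt T \<le> T / 4 ^ j" if "j \<le> n" for j
    proof -
      have "(4::real) ^ j \<le> sqrt T" using n4 that power_increasing[of j n "4::real"] by linarith
      then have "sqrt T * 4 ^ j \<le> sqrt T * sqrt T" using T1 by (intro mult_left_mono) auto
      then show ?thesis using T1 by (simp add: le_divide_eq)
    qed
    have big: "10 ^ 28 \<le> sqrt T" by (rule real_le_rsqrt[OF T1(3)])
    have small: "F T \<le> sqrt (sqrt T)"
    proof -
      have "K \<le> T powr (1/8)"
      proof -
        have "K = (K powr 8) powr (1/8)" unfolding powr_powr using K by simp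
        also have "\<dots> \<le> T powr (1/8)" using T1(4) K by (intro powr_mono2) (auto simp: powr_numeral)
        finally show ?thesis .
      qed
      moreover have "T powr growth_exp \<le> T powr (1/8)" using growth_exp_bounds T1 by (intro powr_mono) auto
      ultimately have "K * T powr growth_exp \<le> T powr (1/8) * T powr (1/8)"
        using K by (intro mult_mono) auto
      also have "\<dots> = (T powr (1/2)) powr (1/2)" unfolding powr_powr powr_add[symmetric] by simp
      also have "\<dots> = sqrt (sqrt T)" using T1(1) by (simp add: powr_half_sqrt)
      finally show ?thesis using T(2) by simp
    qed
    have step: "F (T / 4 ^ j) \<le> theta ^ j * F T" if "j \<le> n" for j
      using that
    proof (induction j)
      case (Suc j)
      have e: "4 * (T / 4 ^ Suc j) = T / 4 ^ j" by simp
      have "F (T / 4 ^ j) \<le> F T"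
        using T1 Tn[of j] Suc.prems by (intro F_mono) (auto simp: divide_le_eq)
      then have "F (4 * (T / 4 ^ Suc j)) \<le> sqrt (T / 4 ^ Suc j)"
        unfolding e using small real_sqrt_le_mono[OF Tn[OF Suc.prems]] by linarith
      then have "F (T / 4 ^ Suc j) \<le> theta * F (T / 4 ^ j)"
        using F_step[of "T / 4 ^ Suc j"] big Tn[OF Suc.prems] unfolding e by linarith
      also have "\<dots> \<le> theta * (theta ^ j * F T)" using Suc theta_bounds by (intro mult_left_mono) auto
      finally show ?case by simp
    qed simp
    have "R1 \<le> sqrt T" using T1(5) by (intro real_le_rsqrt) auto
    then have "F R1 \<le> F (T / 4 ^ n)" using Tn[of n] R1 by (intro F_mono) auto
    also have "\<dots> \<le> theta ^ n * (K * T powr growth_exp)"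
      using step[of n] T(2) theta_bounds by (meson mult_left_mono order_refl order_trans zero_le_power less_imp_le)
    also have "\<dots> \<le> theta ^ n * (K * (2 * (1 / \<mu>) ^ n))"
    proof -
      have "T powr growth_exp \<le> (16 ^ Suc n) powr growth_exp"
        using n T1 growth_exp_bounds by (intro powr_mono2) auto
      also have "\<dots> = (16 powr growth_exp) ^ Suc n"
      proof -
        have e: "(16::real) ^ Suc n = 16 powr (Suc n)" by (rule powr_realpow[symmetric]) simp
        have "(16 powr growth_exp) ^ Suc n = (16 powr growth_exp) powr (Suc n)" by (rule powr_realpow[symmetric]) simp
        then show ?thesis unfolding e powr_powr by (simp only: mult.commute)
      qed
      also have "\<dots> = 16 powr growth_exp * (16 powr growth_exp) ^ n" by simp
      also have "\<dots> \<le> 2 * (1 / \<mu>) ^ n"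
      proof (intro mult_mono power_mono)
        have "16 powr growth_exp \<le> 16 powr (1/8)" using growth_exp_bounds by (intro powr_mono) auto
        also have "\<dots> \<le> 16 powr (1/4)" by (intro powr_mono) auto
        also have "16 powr (1/4) = (2 powr 4) powr (1/4::real)" by simp
        also have "\<dots> = 2" by (simp only: powr_powr) simp
        finally show "16 powr growth_exp \<le> 2" .
        show "16 powr growth_exp \<le> 1 / \<mu>" using growth_exp_bounds(3) mu by (simp add: \<mu>_def[symmetric] field_simps)
      qed auto
      finally show ?thesis using K theta_bounds by (intro mult_left_mono) auto
    qed
    also have "\<dots> = 2 * K * \<mu> ^ n"
    proof -
      have "theta ^ n * (1 / \<mu>) ^ n = \<mu> ^ n"
        unfolding power_mult_distrib[symmetric] using mu by (simp add: mu(3)[symmetric])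
      then show ?thesis by (simp add: algebra_simps)
    qed
    also have "\<dots> < e" by (rule N[OF Nn])
    finally show ?thesis by simp
  qed
  have "F R1 \<le> 0"
  proof (rule field_le_epsilon)
    fix e :: real assume "0 < e"
    from le[OF this] show "F R1 \<le> 0 + e" by (simp only: add_0)
  qed
  then show ?thesis using F_nonneg[of R1] by simp
qed

lemma vanish:
  assumes F0: "\<And>R. 0 < R \<Longrightarrow> F R = 0" and z: "0 \<le> z" "z \<le> 1"
  shows "U x y z = 0"
proof -
  define R where "R = \<bar>x\<bar> + \<bar>y\<bar> + 1"
  have R: "0 < R" "\<bar>x\<bar> \<le> 2*R" "\<bar>y\<bar> \<le> 2*R" by (auto simp: R_def)
  have xyR: "x\<^sup>2 + y\<^sup>2 \<le> R\<^sup>2"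
  proof -
    have "x\<^sup>2 + y\<^sup>2 \<le> (\<bar>x\<bar> + \<bar>y\<bar>)\<^sup>2" by (simp add: power2_sum)
    also have "\<dots> \<le> R\<^sup>2" by (intro power_mono) (auto simp: R_def)
    finally show ?thesis .
  qed
  have "gsq x y t = 0" if t: "0 \<le> t" "t \<le> 1" for t
  proof -
    define f where "f = (\<lambda>(x,y,z). cutoff R (2*R) x y z * gsq x y z)"
    have "f (x,y,t) = 0"
    proof (rule has_integral_0_cbox_imp_0[where a="(-(2*R),-(2*R),0)" and b="(2*R,2*R,1)"])
      show "continuous_on (cbox (-(2*R),-(2*R),0) (2*R,2*R,1)) f"
        unfolding f_def using cont3_cutoff_gsq[of R "2*R"] by (auto simp: cont3_def intro: continuous_on_subset)
      have "f integrable_on cbox (-(2*R),-(2*R),0) (2*R,2*R,1)" unfolding f_def by (rule cont3_integrable[OF cont3_cutoff_gsq])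
      moreover have "integral (cbox (-(2*R),-(2*R),0) (2*R,2*R,1)) f = 0"
        using F0[OF R(1)] unfolding F_def I3_def f_def .
      ultimately show "(f has_integral 0) (cbox (-(2*R),-(2*R),0) (2*R,2*R,1))"
        by (metis integrable_integral)
      show "0 \<le> f p" if "p \<in> box (-(2*R),-(2*R),0) (2*R,2*R,1)" for p unfolding f_def by (cases p) (simp add: cutoff_gsq_nonneg)
      show "box (-(2*R),-(2*R),0) (2*R,2*R,1::real) \<noteq> {}"
        using R(1) by (auto simp: box_ne_empty Basis_prod_def)
      show "(x,y,t) \<in> cbox (-(2*R),-(2*R),0) (2*R,2*R,1)" using R t by (auto simp: cbox_Pair_eq abs_le_iff)
    qed
    moreover have "cutoff R (2*R) x y t = 1" using R xyR by (intro cutoff_one) auto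
    ultimately show ?thesis by (simp add: f_def)
  qed
  then have "dsq x y 0 = integral {0..1::real} (\<lambda>t. 0)" unfolding zavg_def by (intro integral_cong) auto
  then show ?thesis using norm_U_sq_le[OF z, of x y 0] by simp
qed

lemma liouville_of_growth:
  assumes "0 < K" "\<And>T0. \<exists>T\<ge>T0. F T \<le> K * T powr growth_exp" "0 \<le> z" "z \<le> 1"
  shows "U x y z = 0"
  using vanish F_zero[OF assms(1,2)] assms(3,4) by blast

end

section \<open>Horizontal mollification\<close>

abbreviation "Tx \<equiv> shx (\<lambda>t. 1)"
abbreviation "Ty \<equiv> shy (\<lambda>t. 1)"
abbreviation "Kx e \<equiv> shx (\<lambda>t. e * (1 - t)) e"
abbreviation "Ky e \<equiv> shy (\<lambda>t. e * (1 - t)) e"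

lemma shy_shx: "shy w e f x y z = shx w e (\<lambda>x y z. f y x z) y x z"
  by (simp add: shx_def shy_def)

lemma cont3_swap: assumes "cont3 f" shows "cont3 (\<lambda>x y z. f y x z)"
  by (intro cont3I cont3_comp[OF assms] continuous_intros)

lemma weights_cont: "continuous_on UNIV (\<lambda>t::real. 1::real)" "continuous_on UNIV (\<lambda>t::real. e * (1 - t) :: real)"
  by (intro continuous_intros)+

lemma cont_shx_integrand:
  fixes f :: "real \<Rightarrow> real \<Rightarrow> real \<Rightarrow> 'b::real_normed_vector"
  assumes "cont3 f" "continuous_on UNIV w" shows "continuous_on {0..1} (\<lambda>t. w t *\<^sub>R f (x + e * t) y z)"
  by (intro continuous_intros cont3_comp[OF assms(1)] continuous_on_subset[OF assms(2)]) auto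

lemma shx_nth:
  fixes f :: "real \<Rightarrow> real \<Rightarrow> real \<Rightarrow> real^3"
  assumes "cont3 f" "continuous_on UNIV w"
  shows "shx w e f x y z $ i = shx w e (\<lambda>x y z. f x y z $ i) x y z"
  unfolding shx_def
  using integral_linear[OF integrable_continuous_real[OF cont_shx_integrand[OF assms, of x e y z]] bounded_linear_vec_nth[of i]]
  by (simp add: o_def)

lemma shx_add:
  fixes f g :: "real \<Rightarrow> real \<Rightarrow> real \<Rightarrow> real"
  assumes "cont3 f" "cont3 g" "continuous_on UNIV w"
  shows "shx w e f x y z + shx w e g x y z = shx w e (\<lambda>x y z. f x y z + g x y z) x y z"
  unfolding shx_def scaleR_add_right
  by (rule integral_add[symmetric]) (intro integrable_continuous_real cont_shx_integrand assms)+

lemma shx_div_free: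
  fixes f g h :: "real \<Rightarrow> real \<Rightarrow> real \<Rightarrow> real^3"
  assumes c: "cont3 f" "cont3 g" "cont3 h" and w: "continuous_on UNIV w"
    and z: "\<And>x y. f x y z $ 1 + g x y z $ 2 + h x y z $ 3 = 0"
  shows "shx w e f x y z $ 1 + shx w e g x y z $ 2 + shx w e h x y z $ 3 = 0"
proof -
  have n: "cont3 (\<lambda>x y z. f x y z $ 1)" "cont3 (\<lambda>x y z. g x y z $ 2)" "cont3 (\<lambda>x y z. h x y z $ 3)"
     "cont3 (\<lambda>x y z. f x y z $ 1 + g x y z $ 2)"
    by (intro cont3I continuous_intros cont3_comp[OF c(1)] cont3_comp[OF c(2)] cont3_comp[OF c(3)])+
  show ?thesis
    unfolding shx_nth[OF c(1) w] shx_nth[OF c(2) w] shx_nth[OF c(3) w] shx_add[OF n(1,2) w] shx_add[OF n(4,3) w]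
    unfolding shx_def z by simp
qed

lemma norm_shx_le:
  fixes f :: "real \<Rightarrow> real \<Rightarrow> real \<Rightarrow> 'b::euclidean_space"
  assumes c: "cont3 f" and w: "continuous_on UNIV w" and wb: "\<And>t. 0 \<le> t \<Longrightarrow> t \<le> 1 \<Longrightarrow> \<bar>w t\<bar> \<le> W"
    and M: "\<And>t. 0 \<le> t \<Longrightarrow> t \<le> 1 \<Longrightarrow> norm (f (x + e * t) y z) \<le> M"
  shows "norm (shx w e f x y z) \<le> W * M"
proof -
  have "norm (shx w e f x y z) \<le> integral {0..1} (\<lambda>t::real. W * M)"
    unfolding shx_def
  proof (rule integral_norm_bound_integral)
    fix t :: real assume "t \<in> {0..1}"
    then show "norm (w t *\<^sub>R f (x + e * t) y z) \<le> W * M"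
      unfolding norm_scaleR using wb[of t] M[of t] by (intro mult_mono) (auto intro: order_trans[OF abs_ge_zero])
  qed (intro integrable_continuous_real cont_shx_integrand c w continuous_intros)+
  then show ?thesis by simp
qed

lemma norm_Tx_le:
  fixes f :: "real \<Rightarrow> real \<Rightarrow> real \<Rightarrow> 'b::euclidean_space"
  assumes c: "cont3 f" and M: "\<And>t. 0 \<le> t \<Longrightarrow> t \<le> 1 \<Longrightarrow> norm (f (x + e * t) y z) \<le> M"
  shows "norm (Tx e f x y z) \<le> M"
  using norm_shx_le[OF c weights_cont(1), of 1 x e y z M] M by simp

lemma norm_Kx_le:
  fixes f :: "real \<Rightarrow> real \<Rightarrow> real \<Rightarrow> 'b::euclidean_space"
  assumes c: "cont3 f" and e: "0 \<le> e" and M: "\<And>t. 0 \<le> t \<Longrightarrow> t \<le> 1 \<Longrightarrow> norm (f (x + e * t) y z) \<le> M"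
  shows "norm (Kx e f x y z) \<le> e * M"
  by (rule norm_shx_le[OF c weights_cont(2) _ M]) (use e in \<open>auto simp: abs_mult mult_left_le\<close>)

lemma norm_shx_sq_le:
  fixes f :: "real \<Rightarrow> real \<Rightarrow> real \<Rightarrow> 'b::euclidean_space"
  assumes c: "cont3 f" and w: "continuous_on UNIV w" and wb: "\<And>t. 0 \<le> t \<Longrightarrow> t \<le> 1 \<Longrightarrow> \<bar>w t\<bar> \<le> W"
  shows "(norm (shx w e f x y z))\<^sup>2 \<le> W\<^sup>2 * Tx e (\<lambda>x y z. (norm (f x y z))\<^sup>2) x y z"
proof -
  have "(norm (shx w e f x y z))\<^sup>2 \<le> (1 - 0) * integral {0..1} (\<lambda>t. (norm (w t *\<^sub>R f (x + e * t) y z))\<^sup>2)"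
    unfolding shx_def by (rule norm_integral_square_le[OF cont_shx_integrand[OF c w]]) simp
  also have "\<dots> \<le> 1 * integral {0..1} (\<lambda>t. W\<^sup>2 * (norm (f (x + e * t) y z))\<^sup>2)"
  proof -
    have le: "(norm (w t *\<^sub>R f (x + e * t) y z))\<^sup>2 \<le> W\<^sup>2 * (norm (f (x + e * t) y z))\<^sup>2" if "t \<in> {0..1}" for t
      using that wb[of t] by (auto simp: power_mult_distrib intro!: mult_right_mono abs_le_square_iff[THEN iffD1])
    show ?thesis unfolding diff_zero mult_1
      by (intro integral_le integrable_continuous_real continuous_intros cont3_comp[OF c] continuous_on_subset[OF w] subset_UNIV le)
  qed
  also have "\<dots> = W\<^sup>2 * Tx e (\<lambda>x y z. (norm (f x y z))\<^sup>2) x y z" by (simp add: shx_def)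
  finally show ?thesis .
qed

lemma norm_Kx_sq_le:
  fixes f :: "real \<Rightarrow> real \<Rightarrow> real \<Rightarrow> 'b::euclidean_space"
  assumes c: "cont3 f" and e: "0 \<le> e"
  shows "(norm (Kx e f x y z))\<^sup>2 \<le> e\<^sup>2 * Tx e (\<lambda>x y z. (norm (f x y z))\<^sup>2) x y z"
  by (rule norm_shx_sq_le[OF c weights_cont(2)]) (use e in \<open>auto simp: abs_mult mult_left_le\<close>)

lemma norm_Ky_sq_le:
  fixes f :: "real \<Rightarrow> real \<Rightarrow> real \<Rightarrow> 'b::euclidean_space"
  assumes c: "cont3 f" and e: "0 \<le> e"
  shows "(norm (Ky e f x y z))\<^sup>2 \<le> e\<^sup>2 * Ty e (\<lambda>x y z. (norm (f x y z))\<^sup>2) x y z"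
  unfolding shy_shx by (rule norm_Kx_sq_le[OF cont3_swap[OF c] e])

lemma norm_Tx_sq_le:
  fixes f :: "real \<Rightarrow> real \<Rightarrow> real \<Rightarrow> 'b::euclidean_space"
  assumes c: "cont3 f"
  shows "(norm (Tx e f x y z))\<^sup>2 \<le> Tx e (\<lambda>x y z. (norm (f x y z))\<^sup>2) x y z"
  using norm_shx_sq_le[OF c weights_cont(1), of 1 e x y z] by simp

lemma Tx_mono:
  fixes f g :: "real \<Rightarrow> real \<Rightarrow> real \<Rightarrow> real"
  assumes c: "cont3 f" "cont3 g" and le: "\<And>t. 0 \<le> t \<Longrightarrow> t \<le> 1 \<Longrightarrow> f (x + e * t) y z \<le> g (x + e * t) y z"
  shows "Tx e f x y z \<le> Tx e g x y z"
  unfolding shx_def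
  by (intro integral_le integrable_continuous_real cont_shx_integrand c weights_cont) (use le in auto)

lemma Ty_mono:
  fixes f g :: "real \<Rightarrow> real \<Rightarrow> real \<Rightarrow> real"
  assumes c: "cont3 f" "cont3 g" and le: "\<And>t. 0 \<le> t \<Longrightarrow> t \<le> 1 \<Longrightarrow> f x (y + e * t) z \<le> g x (y + e * t) z"
  shows "Ty e f x y z \<le> Ty e g x y z"
  unfolding shy_shx by (rule Tx_mono[OF cont3_swap[OF c(1)] cont3_swap[OF c(2)]]) (rule le)

text \<open>
  Integration by parts in the shift parameter: the difference between mollification and function is an
  \<open>x\<close>-derivative of something of size \<open>e\<close>.
\<close>
lemma Kx_FTC:
  fixes f :: "real \<Rightarrow> real \<Rightarrow> real \<Rightarrow> 'b::euclidean_space"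
  assumes f: "C1 f fx fy fz" and z: "0 \<le> z" "z \<le> 1"
  shows "Kx e fx x y z = Tx e f x y z - f x y z"
proof -
  have d: "((\<lambda>t. f (x + e * t) y z) has_vector_derivative e *\<^sub>R fx (x + e * t) y z) (at t)" for t
  proof -
    have "((\<lambda>t. x + e * t) has_vector_derivative e) (at t)"
      by (auto intro!: derivative_eq_intros)
    from vector_diff_chain_at[OF this C1D(5)[OF f z]] show ?thesis by (simp add: o_def)
  qed
  have "((\<lambda>t. (1 - t) *\<^sub>R (e *\<^sub>R fx (x + e * t) y z) + (-1) *\<^sub>R f (x + e * t) y z) has_integral
     (1 - 1) *\<^sub>R f (x + e * 1) y z - (1 - 0) *\<^sub>R f (x + e * 0) y z) {0..1}"
  proof (rule fundamental_theorem_of_calculus)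
    fix t :: real
    have "((\<lambda>t. 1 - t) has_vector_derivative -1) (at t)" by (auto intro!: derivative_eq_intros)
    from bounded_bilinear.has_vector_derivative[OF bounded_bilinear_scaleR this d[of t]]
    show "((\<lambda>t. (1 - t) *\<^sub>R f (x + e * t) y z) has_vector_derivative (1 - t) *\<^sub>R (e *\<^sub>R fx (x + e * t) y z) + (-1) *\<^sub>R f (x + e * t) y z) (at t within {0..1})"
      by (rule has_vector_derivative_at_within)
  qed simp
  from integral_unique[OF this]
  have "integral {0..1} (\<lambda>t. (1 - t) *\<^sub>R (e *\<^sub>R fx (x + e * t) y z) + (-1) *\<^sub>R f (x + e * t) y z) = - f x y z" by simp
  moreover have "integral {0..1} (\<lambda>t. (1 - t) *\<^sub>R (e *\<^sub>R fx (x + e * t) y z) + (-1) *\<^sub>R f (x + e * t) y z)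
     = integral {0..1} (\<lambda>t. (1 - t) *\<^sub>R (e *\<^sub>R fx (x + e * t) y z)) + integral {0..1} (\<lambda>t. (-1) *\<^sub>R f (x + e * t) y z)"
    by (intro integral_add integrable_continuous_real continuous_intros cont3_comp[OF C1D(1)[OF f]] cont3_comp[OF C1D(2)[OF f]])
  moreover have "integral {0..1} (\<lambda>t. (1 - t) *\<^sub>R (e *\<^sub>R fx (x + e * t) y z)) = Kx e fx x y z"
    by (simp add: shx_def mult.commute)
  moreover have "integral {0..1} (\<lambda>t. (-1) *\<^sub>R f (x + e * t) y z) = - Tx e f x y z"
    by (simp add: shx_def)
  ultimately show ?thesis by (simp add: algebra_simps)
qed

lemma C1_swap: assumes f: "C1 f fx fy fz"
  shows "C1 (\<lambda>x y z. f y x z) (\<lambda>x y z. fy y x z) (\<lambda>x y z. fx y x z) (\<lambda>x y z. fz y x z)"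
  by (intro C1I cont3_swap[OF C1D(1)[OF f]] cont3_swap[OF C1D(2)[OF f]] cont3_swap[OF C1D(3)[OF f]]
    cont3_swap[OF C1D(4)[OF f]] C1D(5-7)[OF f])

lemma Ky_FTC:
  fixes f :: "real \<Rightarrow> real \<Rightarrow> real \<Rightarrow> 'b::euclidean_space"
  assumes f: "C1 f fx fy fz" and z: "0 \<le> z" "z \<le> 1"
  shows "Ky e fy x y z = Ty e f x y z - f x y z"
  unfolding shy_shx by (rule Kx_FTC[OF C1_swap[OF f] z])

text \<open>
  The derivative of a mollification is a difference quotient, hence bounded without any bound for the derivative.
\<close>
lemma Tx_FTC:
  fixes f :: "real \<Rightarrow> real \<Rightarrow> real \<Rightarrow> 'b::euclidean_space"
  assumes f: "C1 f fx fy fz" and z: "0 \<le> z" "z \<le> 1"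
  shows "e *\<^sub>R Tx e fx x y z = f (x + e) y z - f x y z"
proof -
  have "lint (\<lambda>x. fx x y z) x (x + e) = f (x + e) y z - f x y z"
    by (rule lint_FTC[where S=UNIV]) (use C1D(5)[OF f z] in auto)
  then show ?thesis by (simp add: lint_def shx_def)
qed

lemma zavg_shx:
  fixes f :: "real \<Rightarrow> real \<Rightarrow> real \<Rightarrow> real"
  assumes c: "cont3 f" and w: "continuous_on UNIV w"
  shows "zavg (shx w e f) x y v = shx w e (zavg f) x y v"
proof -
  have "integral {0..1} (\<lambda>z. integral {0..1} (\<lambda>t. w t * f (x + e * t) y z)) = integral {0..1} (\<lambda>t. integral {0..1} (\<lambda>z. w t * f (x + e * t) y z))"
    by (rule integral_prod_real) (intro continuous_intros cont3_comp[OF c] continuous_on_compose2[OF w]; simp)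
  then show ?thesis by (simp add: zavg_def shx_def[abs_def])
qed

lemma zavg_shy:
  fixes f :: "real \<Rightarrow> real \<Rightarrow> real \<Rightarrow> real"
  assumes c: "cont3 f" and w: "continuous_on UNIV w"
  shows "zavg (shy w e f) x y v = shy w e (zavg f) x y v"
  using zavg_shx[OF cont3_swap[OF c] w, of e y x v] by (simp add: zavg_def shy_def[abs_def] shx_def[abs_def])

lemma I3_swap: "cont3 f \<Longrightarrow> I3 L (\<lambda>x y z. f y x z) = I3 L f"
  by (simp only: I3_iterated[OF cont3_swap] I3_iterated_swap)

text \<open>
  For each shift the integral moves to a translated box; the part sticking out on one side carries
  no mass, and the missing part on the other side only helps.
\<close>
lemma I3_Tx_le:
  assumes c: "cont3 f" and e: "0 \<le> e" and L: "0 \<le> L" and pos: "\<And>x y z. 0 \<le> f x y z"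
    and zero: "\<And>x y z. L \<le> x \<Longrightarrow> f x y z = 0"
  shows "I3 L (Tx e f) \<le> I3 L f"
proof -
  have sh: "integral {-L..L} (\<lambda>x. f (x + d) y z) \<le> integral {-L..L} (\<lambda>x. f x y z)" if d: "0 \<le> d" for d y z
  proof -
    have cf: "continuous_on S (\<lambda>x. f x y z)" for S by (rule cont3_slices(1)[OF c])
    have "integral {-L..L} (\<lambda>x. f (x + d) y z) = integral {-L + d..L + d} (\<lambda>x. f x y z)"
      using integral_shift_Icc_real[of "-L" L "\<lambda>x. f x y z" d] by (simp add: o_def add.commute)
    also have "\<dots> \<le> integral {-L..L + d} (\<lambda>x. f x y z)"
      by (intro integral_subset_le integrable_continuous_real cf) (use d pos in auto)
    also have "\<dots> = integral {-L..L} (\<lambda>x. f x y z) + integral {L..L + d} (\<lambda>x. f x y z)"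
      by (intro Henstock_Kurzweil_Integration.integral_combine[symmetric] integrable_continuous_real cf) (use d L in auto)
    also have "integral {L..L + d} (\<lambda>x. f x y z) = integral {L..L + d} (\<lambda>x. 0)"
      by (intro integral_cong) (use zero in auto)
    finally show ?thesis by simp
  qed
  have inner: "integral {-L..L} (\<lambda>x. Tx e f x y z) \<le> integral {-L..L} (\<lambda>x. f x y z)" for y z
  proof -
    have "integral {-L..L} (\<lambda>x. Tx e f x y z) = integral {0..1} (\<lambda>t. integral {-L..L} (\<lambda>x. f (x + e * t) y z))"
      unfolding shx_def scaleR_one
      by (rule integral_prod_real) (intro continuous_intros cont3_comp[OF c])
    also have "\<dots> \<le> integral {0..1} (\<lambda>t::real. integral {-L..L} (\<lambda>x. f x y z))"
    proof (rule integral_le)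
      have "continuous_on {0..1} (\<lambda>t. integral {-L..L} (\<lambda>x. f (x + e * t) y z))"
        by (rule continuous_on_subset[OF _ subset_UNIV]) (intro continuous_on_integral_param continuous_intros cont3_comp[OF c])
      then show "(\<lambda>t. integral {-L..L} (\<lambda>x. f (x + e * t) y z)) integrable_on {0..1}" by (rule integrable_continuous_real)
      show "integral {-L..L} (\<lambda>x. f (x + e * t) y z) \<le> integral {-L..L} (\<lambda>x. f x y z)" if "t \<in> {0..1}" for t
        by (rule sh) (use e that in auto)
    qed (intro integrable_continuous_real continuous_intros)
    finally show ?thesis by simp
  qed
  have ct: "cont3 (Tx e f)" by (rule cont3_shx[OF weights_cont(1) c])
  have k: "continuous_on UNIV (\<lambda>p::real\<times>real. integral {-L..L} (\<lambda>x. g x (fst p) (snd p)))" if "cont3 g" for g :: "real \<Rightarrow> real \<Rightarrow> real \<Rightarrow> real"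
    by (intro continuous_on_integral_param continuous_intros cont3_comp[OF that])
  have k1: "continuous_on S (\<lambda>z. integral {-L..L} (\<lambda>x. g x y z))" if "cont3 g" for g :: "real \<Rightarrow> real \<Rightarrow> real \<Rightarrow> real" and y S
    by (rule continuous_on_subset[OF _ subset_UNIV]) (intro continuous_on_integral_param continuous_intros cont3_comp[OF that])
  have k2: "continuous_on S (\<lambda>y. integral {0..1} (\<lambda>z. integral {-L..L} (\<lambda>x. g x y z)))" if "cont3 g" for g :: "real \<Rightarrow> real \<Rightarrow> real \<Rightarrow> real" and S
    by (rule continuous_on_subset[OF _ subset_UNIV]) (intro continuous_on_integral_param k[OF that])
  show ?thesis unfolding I3_x_inner[OF ct] I3_x_inner[OF c]
    by (rule integral_le integrable_continuous_real k1 k2 c ct inner)+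
qed

lemma I3_Ty_le:
  assumes c: "cont3 f" and e: "0 \<le> e" and L: "0 \<le> L" and pos: "\<And>x y z. 0 \<le> f x y z"
    and zero: "\<And>x y z. L \<le> y \<Longrightarrow> f x y z = 0"
  shows "I3 L (Ty e f) \<le> I3 L f"
proof -
  have "I3 L (Ty e f) = I3 L (\<lambda>x y z. Ty e f y x z)"
    by (rule I3_swap[symmetric]) (rule cont3_shy[OF weights_cont(1) c])
  also have "\<dots> = I3 L (Tx e (\<lambda>x y z. f y x z))" by (simp add: shy_shx[abs_def])
  also have "\<dots> \<le> I3 L (\<lambda>x y z. f y x z)"
    by (rule I3_Tx_le[OF cont3_swap[OF c] e L pos]) (rule zero)
  also have "\<dots> = I3 L f" by (rule I3_swap[OF c])
  finally show ?thesis .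
qed

section \<open>Flows with small radial velocity\<close>

definition hz :: "real^3 \<Rightarrow> real^3" where "hz v = vector [v $ 1, v $ 2, 0]"

lemma bounded_linear_hz: "bounded_linear hz"
proof -
  have "bounded_linear (\<lambda>v. (v $ 1) *\<^sub>R axis 1 1 + (v $ 2) *\<^sub>R axis 2 1 + 0 *\<^sub>R axis 3 1 :: real^3)"
    by (intro bounded_linear_add bounded_linear_compose[OF bounded_linear_scaleR_left bounded_linear_vec_nth]) simp
  then show ?thesis unfolding hz_def[abs_def] vector3_eq .
qed

lemma norm_hz_le: "norm (hz v) \<le> norm v"
proof (rule norm_le_componentwise_cart)
  show "norm (hz v $ i) \<le> norm (v $ i)" for i
    using exhaust_3[of i] by (auto simp: hz_def)
qed

text \<open>
  For divergence-free \<open>a\<close>, constant \<open>E = e\<^sub>1\<close> and \<open>f = \<nabla>\<phi>\<close>, \<open>f3 = \<phi>\<^sub>x\<close>, this is a field with divergence \<open>\<nabla>\<phi> \<cdot> \<partial>\<^sub>x a\<close>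
  that involves no derivative of \<open>a\<close>; likewise with \<open>e\<^sub>2\<close> and \<open>y\<close>.
\<close>
definition transp :: "real \<Rightarrow> real \<Rightarrow> real \<Rightarrow> real^3 \<Rightarrow> real^3 \<Rightarrow> real^3" where
  "transp f1 f2 f3 E v = (f1 * v $ 1 + f2 * v $ 2) *\<^sub>R E - f3 *\<^sub>R v"

lemma norm_transp_le:
  assumes "\<bar>f1\<bar> \<le> k" "\<bar>f2\<bar> \<le> k" "\<bar>f3\<bar> \<le> k" "norm E = 1"
  shows "norm (transp f1 f2 f3 E v) \<le> 3 * k * norm v"
proof -
  have "\<bar>f1 * v $ 1\<bar> \<le> k * norm v" "\<bar>f2 * v $ 2\<bar> \<le> k * norm v" "\<bar>f3\<bar> * norm v \<le> k * norm v"
    unfolding abs_mult using assms component_le_norm_cart[of v] by (intro mult_mono; force)+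
  moreover have "norm (transp f1 f2 f3 E v) \<le> \<bar>f1 * v $ 1 + f2 * v $ 2\<bar> + \<bar>f3\<bar> * norm v"
    unfolding transp_def using norm_triangle_ineq4[of "(f1 * v $ 1 + f2 * v $ 2) *\<^sub>R E" "f3 *\<^sub>R v"] assms(4) by simp
  ultimately show ?thesis by linarith
qed

lemma C1_transp:
  assumes f1: "C1 f1 f1x f1y (\<lambda>x y z. 0)" and f2: "C1 f2 f2x f2y (\<lambda>x y z. 0)" and f3: "C1 f3 f3x f3y (\<lambda>x y z. 0)"
    and a: "C1 a ax ay az"
  shows "C1 (\<lambda>x y z. transp (f1 x y z) (f2 x y z) (f3 x y z) E (a x y z))
    (\<lambda>x y z. transp (f1 x y z) (f2 x y z) (f3 x y z) E (ax x y z) + transp (f1x x y z) (f2x x y z) (f3x x y z) E (a x y z))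
    (\<lambda>x y z. transp (f1 x y z) (f2 x y z) (f3 x y z) E (ay x y z) + transp (f1y x y z) (f2y x y z) (f3y x y z) E (a x y z))
    (\<lambda>x y z. transp (f1 x y z) (f2 x y z) (f3 x y z) E (az x y z))"
  by (rule C1_eq[OF C1_add[OF C1_linear[OF bounded_linear_scaleR_left C1_add[OF C1_mult[OF f1 C1_nth[OF a]] C1_mult[OF f2 C1_nth[OF a]]]]
     C1_minus[OF C1_scaleR[OF f3 a]]]])
    (auto simp: transp_def algebra_simps)

context slab_flow
begin

lemma psi_curve_deriv:
  "((\<lambda>t. psi y0 (r * cos t) (r * sin t) 0) has_real_derivative
     (r * sin t) * (Ub (r * cos t) (r * sin t) 0 $ 2) + (r * cos t) * (Ub (r * cos t) (r * sin t) 0 $ 1)) (at t)"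
proof -
  define X Y where "X = r * cos t" and "Y = r * sin t"
  have cb: "continuous_on UNIV (\<lambda>p. Ub (fst p) (snd p) 0 $ 1)"
    by (intro continuous_intros cont3_comp[OF cont3_zavg[OF C1D(1)[OF U]]])
  have "((\<lambda>(x, y). psi y0 x y 0) has_derivative (\<lambda>(a, b). a *\<^sub>R (- (Ub X Y 0 $ 2)) + blinfun_apply (blinfun_mult_right (Ub X Y 0 $ 1)) b)) (at (X, Y) within UNIV \<times> UNIV)"
  proof (rule has_derivative_partialsI)
    show "((\<lambda>x. psi y0 x Y 0) has_derivative (\<lambda>a. a *\<^sub>R (- (Ub X Y 0 $ 2)))) (at X within UNIV)"
      using C1D(5)[OF C1_psi, of 0 y0 Y X] by (simp add: has_vector_derivative_def)
    have e: "blinfun_apply (blinfun_mult_right c) = (\<lambda>h. h *\<^sub>R c)" for c :: real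
      by (auto simp: fun_eq_iff mult.commute)
    show "((\<lambda>y. psi y0 x y 0) has_derivative blinfun_apply (blinfun_mult_right (Ub x y 0 $ 1))) (at y within UNIV)" for x y
      unfolding e using C1D(6)[OF C1_psi, of 0 y0 x y] by (simp add: has_vector_derivative_def)
    show "continuous (at (X, Y) within UNIV \<times> UNIV) (\<lambda>(x, y). blinfun_mult_right (Ub x y 0 $ 1))"
      using bounded_linear.continuous_on[OF bounded_linear_blinfun_mult_right cb]
      by (simp add: case_prod_beta' continuous_on_eq_continuous_within)
  qed auto
  then have d: "((\<lambda>(x, y). psi y0 x y 0) has_derivative (\<lambda>(a, b). a *\<^sub>R (- (Ub X Y 0 $ 2)) + (Ub X Y 0 $ 1) * b)) (at (X, Y))"
    by simp
  have c: "((\<lambda>t. (r * cos t, r * sin t)) has_derivative (\<lambda>h. (- (Y * h), X * h))) (at t)"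
    unfolding X_def Y_def by (auto intro!: derivative_eq_intros simp: algebra_simps)
  have "((\<lambda>t. (\<lambda>(x, y). psi y0 x y 0) (r * cos t, r * sin t)) has_derivative (\<lambda>h. (\<lambda>(a, b). a *\<^sub>R (- (Ub X Y 0 $ 2)) + (Ub X Y 0 $ 1) * b) (- (Y * h), X * h))) (at t)"
    by (rule has_derivative_compose[OF c]) (use d in \<open>simp add: X_def Y_def\<close>)
  moreover have "(\<lambda>h. (\<lambda>(a, b). a *\<^sub>R (- (Ub X Y 0 $ 2)) + (Ub X Y 0 $ 1) * b) (- (Y * h), X * h)) = (*) (Y * (Ub X Y 0 $ 2) + X * (Ub X Y 0 $ 1))"
    by (auto simp: algebra_simps)
  ultimately show ?thesis by (simp add: has_field_derivative_def X_def Y_def)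
qed

text \<open>
  Along a circle about the origin the derivative of the stream function with respect to the angle is the radius
  times the mean radial velocity; the length of the parameter interval is below 7.
\<close>
lemma psi_circle:
  assumes b: "\<And>X Y. X\<^sup>2 + Y\<^sup>2 = x\<^sup>2 + y\<^sup>2 \<Longrightarrow> \<bar>X * (Ub X Y 0 $ 1) + Y * (Ub X Y 0 $ 2)\<bar> \<le> N"
  shows "\<bar>psi y0 x y 0 - psi y0 (sqrt (x\<^sup>2 + y\<^sup>2)) 0 0\<bar> \<le> 7 * N"
proof (cases "x\<^sup>2 + y\<^sup>2 = 0")
  case True
  then have "x = 0" "y = 0" by (auto simp: sum_power2_eq_zero_iff)
  then show ?thesis using b[of 0 0] by simp
next
  case False
  define r where "r = sqrt (x\<^sup>2 + y\<^sup>2)"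
  have r: "0 < r" "r\<^sup>2 = x\<^sup>2 + y\<^sup>2" using False by (auto simp: r_def sum_power2_gt_zero_iff)
  have "(x / r)\<^sup>2 + (y / r)\<^sup>2 = r\<^sup>2 / r\<^sup>2" unfolding r(2) by (simp only: power_divide add_divide_distrib[symmetric] r(2))
  then have "(x / r)\<^sup>2 + (y / r)\<^sup>2 = 1" using r(1) by simp
  then obtain t where t: "0 \<le> t" "t < 2 * pi" "x / r = cos t" "y / r = sin t"
    using sincos_total_2pi by metis
  have xy: "x = r * cos t" "y = r * sin t" using t(3,4) r(1) by (simp_all add: field_simps)
  have N0: "0 \<le> N" using b[of x y] by linarith
  have db: "\<bar>(r * sin s) * (Ub (r * cos s) (r * sin s) 0 $ 2) + (r * cos s) * (Ub (r * cos s) (r * sin s) 0 $ 1)\<bar> \<le> N" for s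
  proof -
    have "(r * cos s)\<^sup>2 + (r * sin s)\<^sup>2 = x\<^sup>2 + y\<^sup>2"
      using r(2) by (simp add: power_mult_distrib distrib_left[symmetric])
    from b[OF this] show ?thesis by (simp add: add.commute)
  qed
  have "\<bar>psi y0 (r * cos t) (r * sin t) 0 - psi y0 (r * cos 0) (r * sin 0) 0\<bar> \<le> 7 * N"
  proof (cases "t = 0")
    case False
    then have t0: "0 < t" using t(1) by simp
    have "\<exists>s. 0 < s \<and> s < t \<and> psi y0 (r * cos t) (r * sin t) 0 - psi y0 (r * cos 0) (r * sin 0) 0
       = (t - 0) * ((r * sin s) * (Ub (r * cos s) (r * sin s) 0 $ 2) + (r * cos s) * (Ub (r * cos s) (r * sin s) 0 $ 1))"
      by (rule MVT2[OF t0]) (rule psi_curve_deriv)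
    then obtain s where "psi y0 (r * cos t) (r * sin t) 0 - psi y0 (r * cos 0) (r * sin 0) 0
       = (t - 0) * ((r * sin s) * (Ub (r * cos s) (r * sin s) 0 $ 2) + (r * cos s) * (Ub (r * cos s) (r * sin s) 0 $ 1))"
      by blast
    then have "\<bar>psi y0 (r * cos t) (r * sin t) 0 - psi y0 (r * cos 0) (r * sin 0) 0\<bar> \<le> t * N"
      using db[of s] t(1) by (simp add: abs_mult mult_left_mono)
    also have "\<dots> \<le> 7 * N" using t N0 pi_less_4 pi_approx by (intro mult_right_mono) auto
    finally show ?thesis .
  qed (use N0 in simp)
  then show ?thesis by (simp add: xy[symmetric] r_def[symmetric])
qed

text \<open>
  The reference value of the stream function on a circle is taken at \<open>(rad x y, 0)\<close> instead of \<open>(r, 0)\<close>: this is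
  smooth on the axis, and the distance of the two points is at most 1.
\<close>
definition rad :: "real \<Rightarrow> real \<Rightarrow> real" where "rad x y = sqrt (1 + x\<^sup>2 + y\<^sup>2)"

lemma rad_pos: "1 \<le> rad x y" "(rad x y)\<^sup>2 = 1 + x\<^sup>2 + y\<^sup>2" "\<bar>x\<bar> \<le> rad x y" "\<bar>y\<bar> \<le> rad x y"
proof -
  have p: "0 \<le> 1 + x\<^sup>2 + y\<^sup>2" by (simp add: add_nonneg_nonneg)
  show "(rad x y)\<^sup>2 = 1 + x\<^sup>2 + y\<^sup>2" unfolding rad_def using p by simp
  show "1 \<le> rad x y" "\<bar>x\<bar> \<le> rad x y" "\<bar>y\<bar> \<le> rad x y" unfolding rad_def by (auto intro!: real_le_rsqrt)
qed

text \<open>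
  The deviation of the stream function from a function of the radius.
\<close>
definition Xi :: "real \<Rightarrow> real \<Rightarrow> real \<Rightarrow> real" where "Xi x y z = psi 0 x y z - psi 0 (rad x y) 0 z"
definition Xix :: "real \<Rightarrow> real \<Rightarrow> real \<Rightarrow> real" where
  "Xix x y z = - (Ub x y z $ 2) + (Ub (rad x y) 0 z $ 2) * (x / rad x y)"
definition Xiy :: "real \<Rightarrow> real \<Rightarrow> real \<Rightarrow> real" where
  "Xiy x y z = (Ub x y z $ 1) + (Ub (rad x y) 0 z $ 2) * (y / rad x y)"

lemma rad_cont: "continuous_on S f \<Longrightarrow> continuous_on S g \<Longrightarrow> continuous_on S (\<lambda>s. rad (f s) (g s))"
  unfolding rad_def by (intro continuous_intros)

lemma C1_Xi: "C1 Xi Xix Xiy (\<lambda>x y z. 0)"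
proof (rule C1I)
  have rn: "rad x y \<noteq> 0" for x y using rad_pos(1)[of x y] by linarith
  note c = rad_cont continuous_on_divide cont3_comp[OF C1D(1)[OF C1_psi]] cont3_comp[OF cont3_zavg[OF C1D(1)[OF U]]]
  show "cont3 Xi" "cont3 Xix" "cont3 Xiy" "cont3 (\<lambda>x y z. 0::real)"
    unfolding Xi_def Xix_def Xiy_def by (intro cont3I continuous_intros c ballI rn)+
  fix x y z :: real assume z: "0 \<le> z" "z \<le> 1"
  have pos: "0 < 1 + x\<^sup>2 + y\<^sup>2" by (simp add: add_pos_nonneg)
  have "((\<lambda>x. rad x y) has_real_derivative (x / rad x y)) (at x)" "((\<lambda>y. rad x y) has_real_derivative (y / rad x y)) (at y)"
    unfolding rad_def using pos by (auto intro!: derivative_eq_intros simp: field_simps)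
  then have r: "((\<lambda>x. rad x y) has_vector_derivative (x / rad x y)) (at x)" "((\<lambda>y. rad x y) has_vector_derivative (y / rad x y)) (at y)"
    by (simp_all add: has_real_derivative_iff_has_vector_derivative)
  show "((\<lambda>s. Xi s y z) has_vector_derivative Xix x y z) (at x)"
    using has_vector_derivative_diff[OF C1D(5)[OF C1_psi z, of 0 y x] vector_diff_chain_at[OF r(1) C1D(5)[OF C1_psi z, of 0 0 "rad x y"]]]
    unfolding Xi_def Xix_def o_def by (simp add: mult.commute)
  show "((\<lambda>s. Xi x s z) has_vector_derivative Xiy x y z) (at y)"
    using has_vector_derivative_diff[OF C1D(6)[OF C1_psi z, of 0 x y] vector_diff_chain_at[OF r(2) C1D(5)[OF C1_psi z, of 0 0 "rad x y"]]]
    unfolding Xi_def Xiy_def o_def by (simp add: mult.commute)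
  show "((\<lambda>s. Xi x y s) has_vector_derivative 0) (at z within {0..1})"
    using has_vector_derivative_diff[OF C1D(7)[OF C1_psi z, of 0 x y] C1D(7)[OF C1_psi z, of 0 "rad x y" 0]]
    unfolding Xi_def by simp
qed

definition u0 :: "real \<Rightarrow> real \<Rightarrow> real \<Rightarrow> real^3" where "u0 x y z = U x y z - profile z *\<^sub>R hz (Ub x y z)"
definition u0x :: "real \<Rightarrow> real \<Rightarrow> real \<Rightarrow> real^3" where "u0x x y z = Ux x y z - profile z *\<^sub>R hz (zavg Ux x y z)"
definition u0y :: "real \<Rightarrow> real \<Rightarrow> real \<Rightarrow> real^3" where "u0y x y z = Uy x y z - profile z *\<^sub>R hz (zavg Uy x y z)"
definition u0z :: "real \<Rightarrow> real \<Rightarrow> real \<Rightarrow> real^3" where "u0z x y z = Uz x y z - dprofile z *\<^sub>R hz (Ub x y z)"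

lemma hz_zero: "hz 0 = 0" by (rule linear_0) (rule bounded_linear.linear[OF bounded_linear_hz])

lemma C1_u0: "C1 u0 u0x u0y u0z"
  by (rule C1_eq[OF C1_add[OF U C1_minus[OF C1_scaleR[OF C1_profile C1_linear[OF bounded_linear_hz C1_zavg[OF U]]]]]])
    (simp_all add: u0_def u0x_def u0y_def u0z_def hz_zero)

lemma u0_div: "0 \<le> z \<Longrightarrow> z \<le> 1 \<Longrightarrow> u0x x y z $ 1 + u0y x y z $ 2 + u0z x y z $ 3 = 0"
  using incompressible[of z x y] arg_cong[OF ubar_div[of x y z], of "(*) (profile z)"]
  by (simp add: u0x_def u0y_def u0z_def hz_def algebra_simps)

lemma u0_nth: "u0 x y z $ 1 = corr U 1 x y z" "u0 x y z $ 2 = corr U 2 x y z"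
  by (simp_all add: u0_def corr_def hz_def)

lemma u0_bd: "u0 x y 0 = 0" "u0 x y 1 = 0" by (simp_all add: u0_def noslip profile_def)

definition G0 :: "real \<Rightarrow> real \<Rightarrow> real \<Rightarrow> real" where
  "G0 x y z = (norm (u0x x y z))\<^sup>2 + (norm (u0y x y z))\<^sup>2 + (norm (u0z x y z))\<^sup>2"

lemma cont3_G0: "cont3 G0"
  unfolding G0_def by (intro cont3I continuous_intros cont3_comp[OF C1D(2)[OF C1_u0]] cont3_comp[OF C1D(3)[OF C1_u0]] cont3_comp[OF C1D(4)[OF C1_u0]])

lemma G0_nonneg: "0 \<le> G0 x y z" by (simp add: G0_def)

lemma G0_le:
  assumes z: "0 \<le> z" "z \<le> 1" shows "G0 x y z \<le> 2 * gsq x y z + 81 * dsq x y z"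
proof -
  have b: "(norm (A - h *\<^sub>R hz B))\<^sup>2 \<le> 2 * (norm A)\<^sup>2 + 2 * (H\<^sup>2 * D)" if "\<bar>h\<bar> \<le> H" "(norm B)\<^sup>2 \<le> D" for A B :: "real^3" and h H D
  proof -
    have "norm (A - h *\<^sub>R hz B) \<le> norm A + norm (h *\<^sub>R hz B)" by (rule norm_triangle_ineq4)
    then have "(norm (A - h *\<^sub>R hz B))\<^sup>2 \<le> (norm A + norm (h *\<^sub>R hz B))\<^sup>2" by (intro power_mono) auto
    also have "\<dots> \<le> 2 * (norm A)\<^sup>2 + 2 * (norm (h *\<^sub>R hz B))\<^sup>2"
      using two_mult_le_squares[of "norm A" "norm (h *\<^sub>R hz B)"] by (simp add: power2_sum)
    also have "(norm (h *\<^sub>R hz B))\<^sup>2 \<le> (H * norm B)\<^sup>2"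
      using that norm_hz_le[of B] by (intro power_mono) (auto intro!: mult_mono)
    also have "\<dots> \<le> H\<^sup>2 * D" using that by (simp add: power_mult_distrib mult_left_mono)
    finally show ?thesis by simp
  qed
  have h: "\<bar>profile z\<bar> \<le> 3/2" "\<bar>dprofile z\<bar> \<le> 6" using profile_range[OF z] by auto
  have V: "(norm (zavg V x y z))\<^sup>2 \<le> dsq x y z" if V: "cont3 V" and Vg: "\<And>x y z. (norm (V x y z))\<^sup>2 \<le> gsq x y z" for V :: "real \<Rightarrow> real \<Rightarrow> real \<Rightarrow> real^3"
  proof -
    have "(norm (zavg V x y z))\<^sup>2 \<le> zavg (\<lambda>x y z. (norm (V x y z))\<^sup>2) x y z" by (rule zavg_norm_sq[OF V])
    also have "\<dots> \<le> dsq x y z" by (rule zavg_mono[OF _ cont3_gsq Vg]) (intro cont3I continuous_intros cont3_comp[OF V])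
    finally show ?thesis .
  qed
  have "(norm (Ub x y z))\<^sup>2 \<le> dsq x y z"
    using zavg_norm_sq[OF C1D(1)[OF U], of x y z] qsq_le_dsq[of x y z] unfolding qsq_def by linarith
  note bs = b[OF h(1) V[OF C1D(2)[OF U] norm_le_gsq(1)], of "Ux x y z"] b[OF h(1) V[OF C1D(3)[OF U] norm_le_gsq(2)], of "Uy x y z"]
    b[OF h(2) this, of "Uz x y z"]
  show ?thesis using bs unfolding G0_def gsq_def u0x_def u0y_def u0z_def by (simp add: power2_eq_square)
qed

end

text \<open>
  The hypothesis of case (b) at a fixed scale. The radial velocity times \<open>r\<close> enters because it is the angular
  derivative of the stream function.
\<close>
locale bounded_flow = slab_flow +
  fixes R N :: real
  assumes R: "1 \<le> R" and N: "1 \<le> N"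
    and bnd: "\<And>x y z. \<lbrakk>x\<^sup>2 + y\<^sup>2 \<le> (8*R)\<^sup>2; 0 \<le> z; z \<le> 1\<rbrakk> \<Longrightarrow> norm (U x y z) \<le> N"
    and bnd_r: "\<And>x y z. \<lbrakk>x\<^sup>2 + y\<^sup>2 \<le> (8*R)\<^sup>2; 0 \<le> z; z \<le> 1\<rbrakk> \<Longrightarrow> \<bar>x * U x y z $ 1 + y * U x y z $ 2\<bar> \<le> N"
begin

lemma region: "\<bar>x\<bar> \<le> 5*R \<Longrightarrow> \<bar>y\<bar> \<le> 5*R \<Longrightarrow> x\<^sup>2 + y\<^sup>2 \<le> (8*R)\<^sup>2"
proof -
  assume xy: "\<bar>x\<bar> \<le> 5*R" "\<bar>y\<bar> \<le> 5*R"
  have "x\<^sup>2 \<le> 25*R\<^sup>2" "y\<^sup>2 \<le> 25*R\<^sup>2" "(8*R)\<^sup>2 = 64 * R\<^sup>2" "0 \<le> R\<^sup>2"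
    using power_mono[OF xy(1), of 2] power_mono[OF xy(2), of 2] by (simp_all add: power_mult_distrib)
  then show ?thesis by linarith
qed

lemma zavg_bound:
  fixes f :: "real \<Rightarrow> real \<Rightarrow> real \<Rightarrow> 'b::euclidean_space"
  assumes f: "cont3 f" and b: "\<And>z. 0 \<le> z \<Longrightarrow> z \<le> 1 \<Longrightarrow> norm (f x y z) \<le> M"
  shows "norm (zavg f x y w) \<le> M"
proof -
  have "norm (zavg f x y w) \<le> integral {0..1} (\<lambda>z::real. M)" unfolding zavg_def
    by (rule integral_norm_bound_integral) (use b in \<open>auto intro!: integrable_continuous_real cont3_slices(3)[OF f]\<close>)
  then show ?thesis by simp
qed

lemma Ub_bound: assumes "x\<^sup>2 + y\<^sup>2 \<le> (8*R)\<^sup>2" shows "norm (Ub x y w) \<le> N" "\<bar>Ub x y w $ i\<bar> \<le> N"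
    "\<bar>x * (Ub x y w $ 1) + y * (Ub x y w $ 2)\<bar> \<le> N"
proof -
  show 1: "norm (Ub x y w) \<le> N" by (rule zavg_bound[OF C1D(1)[OF U] bnd[OF assms]])
  show "\<bar>Ub x y w $ i\<bar> \<le> N" using 1 component_le_norm_cart[of "Ub x y w" i] by linarith
  have bl: "bounded_linear (\<lambda>v::real^3. x * v $ 1 + y * v $ 2)"
    by (intro bounded_linear_add bounded_linear_const_mult bounded_linear_vec_nth)
  have "x * (Ub x y w $ 1) + y * (Ub x y w $ 2) = integral {0..1} (\<lambda>z. x * U x y z $ 1 + y * U x y z $ 2)"
    using integral_linear[OF integrable_continuous_real[OF cont3_slices(3)[OF C1D(1)[OF U], of "{0..1}" x y]] bl]
    by (simp add: o_def zavg_def)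
  also have "norm \<dots> \<le> integral {0..1} (\<lambda>z::real. N)"
    by (rule integral_norm_bound_integral) (use bnd_r[OF assms] in \<open>auto intro!: integrable_continuous_real continuous_intros cU\<close>)
  finally show "\<bar>x * (Ub x y w $ 1) + y * (Ub x y w $ 2)\<bar> \<le> N" by simp
qed

lemma u0_bound: assumes xy: "x\<^sup>2 + y\<^sup>2 \<le> (8*R)\<^sup>2" and z: "0 \<le> z" "z \<le> 1"
  shows "norm (u0 x y z) \<le> 5/2 * N" "\<bar>corr U i x y z\<bar> \<le> 5/2 * N"
proof -
  have "norm (profile z *\<^sub>R hz (Ub x y z)) \<le> 3/2 * N"
    unfolding norm_scaleR using profile_range[OF z] Ub_bound(1)[OF xy, of z] norm_hz_le[of "Ub x y z"] N by (intro mult_mono) auto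
  then show "norm (u0 x y z) \<le> 5/2 * N"
    unfolding u0_def using norm_triangle_ineq4[of "U x y z" "profile z *\<^sub>R hz (Ub x y z)"] bnd[OF xy z] by linarith
  have "\<bar>profile z * (Ub x y z $ i)\<bar> \<le> 3/2 * N"
    unfolding abs_mult using profile_range[OF z] Ub_bound(2)[OF xy, of z i] N by (intro mult_mono) auto
  then show "\<bar>corr U i x y z\<bar> \<le> 5/2 * N"
    unfolding corr_def using component_le_norm_cart[of "U x y z" i] bnd[OF xy z] by linarith
qed

lemma Xi_bound: assumes xy: "\<bar>x\<bar> \<le> 4*R" "\<bar>y\<bar> \<le> 4*R"
  shows "\<bar>Xi x y z\<bar> \<le> 8 * N" "\<bar>Xix x y z\<bar> \<le> 2 * N" "\<bar>Xiy x y z\<bar> \<le> 2 * N"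
proof -
  have x2: "x\<^sup>2 \<le> 16*R\<^sup>2" "y\<^sup>2 \<le> 16*R\<^sup>2" "(8*R)\<^sup>2 = 64 * R\<^sup>2" "1 \<le> R\<^sup>2"
    using power_mono[OF xy(1), of 2] power_mono[OF xy(2), of 2] R by (simp_all add: power_mult_distrib one_le_power)
  then have reg: "x\<^sup>2 + y\<^sup>2 \<le> (8*R)\<^sup>2" "(rad x y)\<^sup>2 + 0\<^sup>2 \<le> (8*R)\<^sup>2" unfolding rad_pos(2) by auto
  define r where "r = sqrt (x\<^sup>2 + y\<^sup>2)"
  have r: "0 \<le> r" "r\<^sup>2 = x\<^sup>2 + y\<^sup>2" by (auto simp: r_def)
  have "\<bar>psi 0 x y 0 - psi 0 r 0 0\<bar> \<le> 7 * N"
    unfolding r_def by (rule psi_circle) (use Ub_bound(3) reg(1) in auto)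
  moreover have "\<bar>psi 0 (rad x y) 0 0 - psi 0 r 0 0\<bar> \<le> N"
  proof -
    have lt: "r < rad x y" unfolding r_def rad_def by (intro real_sqrt_less_mono) simp
    have le1: "rad x y - r \<le> 1"
    proof -
      have "(rad x y)\<^sup>2 \<le> (r + 1)\<^sup>2" unfolding rad_pos(2) power2_sum r(2) using r(1) by simp
      then have "rad x y \<le> r + 1" by (rule power2_le_imp_le) (use r(1) in simp)
      then show ?thesis by simp
    qed
    have "\<And>t. r \<le> t \<Longrightarrow> t \<le> rad x y \<Longrightarrow> DERIV (\<lambda>t. psi 0 t 0 0) t :> - (Ub t 0 0 $ 2)"
      unfolding has_real_derivative_iff_has_vector_derivative by (rule C1D(5)[OF C1_psi]) auto
    from MVT2[OF lt this] obtain t where t: "r < t" "t < rad x y" "psi 0 (rad x y) 0 0 - psi 0 r 0 0 = (rad x y - r) * - (Ub t 0 0 $ 2)" by blast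
    have "t\<^sup>2 \<le> (rad x y)\<^sup>2" using t r(1) by (intro power_mono) auto
    then have "\<bar>Ub t 0 0 $ 2\<bar> \<le> N" using reg(2) by (intro Ub_bound(2)) auto
    then have "\<bar>psi 0 (rad x y) 0 0 - psi 0 r 0 0\<bar> \<le> 1 * N"
      unfolding t(3) abs_mult using le1 lt by (intro mult_mono) auto
    then show ?thesis by simp
  qed
  moreover have "Xi x y z = psi 0 x y 0 - psi 0 (rad x y) 0 0" by (simp add: Xi_def psi_def)
  ultimately show "\<bar>Xi x y z\<bar> \<le> 8 * N" by linarith
  have "\<bar>Ub (rad x y) 0 z $ 2 * (v / rad x y)\<bar> \<le> N * 1" if "\<bar>v\<bar> \<le> rad x y" for v
    unfolding abs_mult using that Ub_bound(2)[OF reg(2), of z 2] rad_pos(1)[of x y] N by (intro mult_mono) (auto simp: divide_le_eq)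
  from this[OF rad_pos(3)] this[OF rad_pos(4)] show "\<bar>Xix x y z\<bar> \<le> 2 * N" "\<bar>Xiy x y z\<bar> \<le> 2 * N"
    unfolding Xix_def Xiy_def using Ub_bound(2)[OF reg(1), of z 1] Ub_bound(2)[OF reg(1), of z 2] by linarith+
qed

end

lemma shy_nth:
  fixes f :: "real \<Rightarrow> real \<Rightarrow> real \<Rightarrow> real^3"
  assumes "cont3 f" "continuous_on UNIV w"
  shows "shy w e f x y z $ i = shy w e (\<lambda>x y z. f x y z $ i) x y z"
  unfolding shy_shx by (rule shx_nth[OF cont3_swap[OF assms(1)] assms(2)])

lemma norm_Ty_le:
  fixes f :: "real \<Rightarrow> real \<Rightarrow> real \<Rightarrow> 'b::euclidean_space"
  assumes c: "cont3 f" and M: "\<And>t. 0 \<le> t \<Longrightarrow> t \<le> 1 \<Longrightarrow> norm (f x (y + e * t) z) \<le> M"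
  shows "norm (Ty e f x y z) \<le> M"
  unfolding shy_shx by (rule norm_Tx_le[OF cont3_swap[OF c]]) (rule M)

lemma norm_Ky_le:
  fixes f :: "real \<Rightarrow> real \<Rightarrow> real \<Rightarrow> 'b::euclidean_space"
  assumes c: "cont3 f" and e: "0 \<le> e" and M: "\<And>t. 0 \<le> t \<Longrightarrow> t \<le> 1 \<Longrightarrow> norm (f x (y + e * t) z) \<le> M"
  shows "norm (Ky e f x y z) \<le> e * M"
  unfolding shy_shx by (rule norm_Kx_le[OF cont3_swap[OF c] e]) (rule M)

lemma Ty_FTC:
  fixes f :: "real \<Rightarrow> real \<Rightarrow> real \<Rightarrow> 'b::euclidean_space"
  assumes f: "C1 f fx fy fz" and z: "0 \<le> z" "z \<le> 1"
  shows "e *\<^sub>R Ty e fy x y z = f x (y + e) z - f x y z"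
  unfolding shy_shx by (rule Tx_FTC[OF C1_swap[OF f] z])

lemma shy_div_free:
  fixes f g h :: "real \<Rightarrow> real \<Rightarrow> real \<Rightarrow> real^3"
  assumes c: "cont3 f" "cont3 g" "cont3 h" and w: "continuous_on UNIV w"
    and z: "\<And>x y. f x y z $ 1 + g x y z $ 2 + h x y z $ 3 = 0"
  shows "shy w e f x y z $ 1 + shy w e g x y z $ 2 + shy w e h x y z $ 3 = 0"
  unfolding shy_shx by (rule shx_div_free[OF cont3_swap[OF c(1)] cont3_swap[OF c(2)] cont3_swap[OF c(3)] w]) (rule z)

lemma zprim_bound:
  fixes f :: "real \<Rightarrow> real \<Rightarrow> real \<Rightarrow> real"
  assumes f: "cont3 f" and z: "0 \<le> z" "z \<le> 1" and b: "\<And>z. 0 \<le> z \<Longrightarrow> z \<le> 1 \<Longrightarrow> \<bar>f x y z\<bar> \<le> M"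
  shows "\<bar>zprim f x y z\<bar> \<le> M"
proof -
  have "norm (zprim f x y z) \<le> integral {0..1} (\<lambda>t. norm (f x y t))"
    unfolding zprim_def by (rule norm_lint_le[OF cont3_slices(3)[OF f]]) (use z in auto)
  also have "\<dots> \<le> integral {0..1} (\<lambda>t::real. M)"
    by (intro integral_le integrable_continuous_real continuous_intros cont3_slices(3)[OF f]) (use b in auto)
  finally show ?thesis by simp
qed

lemma cutoff_radial: "y * cutoff_x s t x y z = x * cutoff_y s t x y z"
  by (simp add: cutoff_x_def cutoff_y_def)

section \<open>Energy growth of flows with small radial velocity\<close>

lemma abs_sum4: "\<bar>p\<bar> \<le> A \<Longrightarrow> \<bar>q\<bar> \<le> B \<Longrightarrow> \<bar>r\<bar> \<le> A \<Longrightarrow> \<bar>s\<bar> \<le> B \<Longrightarrow> \<bar>(p + q) + (r + s)\<bar> \<le> 2 * A + 2 * B" for p :: real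
  by linarith

lemma norm_sum4: "norm p \<le> A \<Longrightarrow> norm q \<le> B \<Longrightarrow> norm r \<le> C \<Longrightarrow> norm s \<le> B \<Longrightarrow> norm ((p + q) + (r + s)) \<le> A + C + 2 * B"
  for p :: "'a::real_normed_vector"
  using norm_triangle_ineq[of "p + q" "r + s"] norm_triangle_ineq[of p q] norm_triangle_ineq[of r s] by linarith

lemma group_sum: "A1 \<le> X \<Longrightarrow> A2 \<le> X \<Longrightarrow> A3 \<le> Y \<Longrightarrow> A4 \<le> Z \<Longrightarrow> 0 \<le> c \<Longrightarrow> c * (A1 + A2) + A3 + A4 \<le> c * (2 * X) + Y + Z" for A1 :: real
  by (intro add_mono mult_left_mono) auto

lemma transp_zero: "transp 0 0 0 E v = 0" by (simp add: transp_def)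

text \<open>
  A field of size \<open>e\<close> times a derivative is absorbed: the factor \<open>e\<close> survives in front of both squares.
\<close>
lemma absorb:
  fixes \<gamma> k e A T :: real
  assumes "0 < e" "0 \<le> k" "A\<^sup>2 \<le> e\<^sup>2 * T"
  shows "3 * k * (\<gamma> * A) \<le> 3/2 * k * e * (\<gamma>\<^sup>2 + T)"
proof -
  have "2 * ((e * \<gamma>) * A) \<le> (e * \<gamma>)\<^sup>2 + A\<^sup>2" by (rule two_mult_le_squares)
  also have "\<dots> \<le> e * (e * (\<gamma>\<^sup>2 + T))" using assms(3) by (simp add: power2_eq_square algebra_simps)
  finally have "e * (2 * (\<gamma> * A)) \<le> e * (e * (\<gamma>\<^sup>2 + T))" by (simp add: algebra_simps)
  then have "2 * (\<gamma> * A) \<le> e * (\<gamma>\<^sup>2 + T)" using assms(1) by simp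
  then have "(3/2 * k) * (2 * (\<gamma> * A)) \<le> (3/2 * k) * (e * (\<gamma>\<^sup>2 + T))" using assms(2) by (intro mult_left_mono) auto
  then show ?thesis by (simp add: algebra_simps)
qed

text \<open>
  The coefficients grow by 16 per step while the recursion gains 32, so the errors sum to a geometric
  series; the boundedness of \<open>f\<close>, with whatever bound, kills the remainder.
\<close>
lemma iterate_bound:
  fixes f :: "nat \<Rightarrow> real"
  assumes step: "\<And>n. f n \<le> f (Suc n) / 32 + A * 16 ^ n" and B: "\<And>n. f n \<le> B"
  shows "f 0 \<le> 2 * A"
proof -
  have *: "f 0 \<le> f n / 32 ^ n + A * (2 - 2 * (1/2) ^ n)" for n
  proof (induction n)
    case (Suc n)
    have "f n / 32 ^ n \<le> (f (Suc n) / 32 + A * 16 ^ n) / 32 ^ n"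
      by (rule divide_right_mono[OF step]) simp
    also have "\<dots> = f (Suc n) / 32 ^ Suc n + A * (1/2) ^ n"
    proof -
      have "(16::real) ^ n / 32 ^ n = (1/2) ^ n" by (simp add: power_divide[symmetric])
      then have "A * 16 ^ n / 32 ^ n = A * (1/2) ^ n" by (metis times_divide_eq_right)
      then show ?thesis by (simp add: add_divide_distrib)
    qed
    finally show ?case using Suc by (simp add: algebra_simps)
  qed simp
  have le: "f 0 - 2 * A \<le> B * (1/32) ^ n + (- 2 * A) * (1/2) ^ n" for n
  proof -
    have "f n / 32 ^ n \<le> B / 32 ^ n" by (rule divide_right_mono[OF B]) simp
    then have "f n / 32 ^ n \<le> B * (1/32) ^ n" by (simp add: power_divide)
    then show ?thesis using *[of n] by (simp add: algebra_simps)
  qed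
  have "(\<lambda>n. B * (1/32) ^ n + (- 2 * A) * (1/2) ^ n) \<longlonglongrightarrow> B * 0 + (- 2 * A) * 0"
    by (intro tendsto_intros LIMSEQ_power_zero) auto
  from LIMSEQ_le_const[OF this, of "f 0 - 2 * A"] le have "f 0 - 2 * A \<le> 0" by auto
  then show ?thesis by simp
qed

definition growth_const :: real where "growth_const = 1024 * 18000000000000\<^sup>2"

context bounded_flow
begin

text \<open>
  Here \<open>U - profile Ub\<close> is split into its double mollification \<open>p\<close>, which goes into the vertical primitive, and
  \<open>-\<partial>\<^sub>x a - \<partial>\<^sub>y b\<close>, for which \<open>transp\<close> gives a correction. All terms are bounded by \<open>K\<close> times \<open>|\<nabla>u|\<close>, except those with
  derivatives of \<open>a\<close> and \<open>b\<close>; these are shifted gradients times \<open>k e\<close> and are absorbed in the energy of the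
  larger disc, which contains all shifts of the smaller one.
\<close>
lemma caccioppoli_step:
  assumes st: "0 \<le> s" "s < t" and e: "0 < e" "e \<le> 1" and st': "t + 2 * e \<le> s'" "s' < t'" "t' \<le> 4 * R"
    and l: "l = t - s" and k: "k = 1000 / l" and K: "K = k * N\<^sup>2 * (379 + 88 / l + 20 / e)"
  shows "I3 (4*R) (\<lambda>x y z. cutoff s t x y z * gsq x y z) \<le> (1/64 + 756 * (k * e)) * I3 (4*R) (\<lambda>x y z. cutoff s' t' x y z * gsq x y z) + 1024 * R\<^sup>2 * K\<^sup>2"
proof -
  define L where "L = 4 * R"
  have L0: "0 \<le> L" using R by (simp add: L_def)
  have l0: "0 < l" using st by (simp add: l)
  have k0: "0 \<le> k" using l0 by (simp add: k)
  have N0: "0 \<le> N" using N by simp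
  have tL: "t \<le> L" using st' e by (simp add: L_def)
  define \<phi> \<phi>x \<phi>y \<phi>xx \<phi>xy \<phi>yy where "\<phi> = cutoff s t" and "\<phi>x = cutoff_x s t" and "\<phi>y = cutoff_y s t" and "\<phi>xx = cutoff_xx s t" and "\<phi>xy = cutoff_xy s t" and "\<phi>yy = cutoff_yy s t"
  note folds = \<phi>_def[symmetric] \<phi>x_def[symmetric] \<phi>y_def[symmetric] \<phi>xx_def[symmetric] \<phi>xy_def[symmetric] \<phi>yy_def[symmetric]
  define w where "w = cutoff s' t'"
  have phib: "\<bar>\<phi>x x y z\<bar> \<le> k" "\<bar>\<phi>y x y z\<bar> \<le> k" "\<bar>\<phi>xx x y z\<bar> \<le> k / l" "\<bar>\<phi>xy x y z\<bar> \<le> k / l" "\<bar>\<phi>yy x y z\<bar> \<le> k / l" for x y z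
    using cutoff_x_bounds[OF st, of x y z] cutoff_y_bounds[OF st, of x y z] unfolding folds k l[symmetric] by (auto simp: power2_eq_square)
  have zero: "\<phi> x y z = 0" "\<phi>x x y z = 0" "\<phi>y x y z = 0" "\<phi>xx x y z = 0" "\<phi>xy x y z = 0" "\<phi>yy x y z = 0" if "t\<^sup>2 \<le> x\<^sup>2 + y\<^sup>2" for x y z
    using cutoff_zero[OF st that, of z] by (simp_all add: folds)
  note Cphi = C1_cutoff[of s t, unfolded folds] C1_cutoff_x[of s t, unfolded folds] C1_cutoff_y[of s t, unfolded folds]
  have cw: "cont3 w" unfolding w_def by (rule cont3_cutoff)
  have w01: "0 \<le> w x y z" "w x y z \<le> 1" for x y z unfolding w_def by (rule cutoff_range)+
  have wz: "w x y z = w x y 0" for x y z unfolding w_def cutoff_def ..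
  have wzero: "w x y z = 0" if "L \<le> x \<or> L \<le> y" for x y z
  proof -
    have "t'\<^sup>2 \<le> L\<^sup>2" using st st' e by (intro power_mono) (auto simp: L_def)
    also have "L\<^sup>2 \<le> x\<^sup>2 + y\<^sup>2"
    proof (rule disjE[OF that])
      assume "L \<le> x" from power_mono[OF this L0, of 2] show ?thesis using zero_le_power2[of y] by linarith
    next
      assume "L \<le> y" from power_mono[OF this L0, of 2] show ?thesis using zero_le_power2[of x] by linarith
    qed
    finally show ?thesis unfolding w_def using st st' e by (intro cutoff_zero) auto
  qed
  define a ax ay az where "a = Kx e u0" and "ax = Kx e u0x" and "ay = Kx e u0y" and "az = Kx e u0z"
  define b bx by' bz where "b = Ky e (Tx e u0)" and "bx = Ky e (Tx e u0x)" and "by' = Ky e (Tx e u0y)" and "bz = Ky e (Tx e u0z)"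
  note cu = C1D(1-4)[OF C1_u0]
  note CT = C1_shx[OF weights_cont(1) C1_u0, of e]
  have Ca: "C1 a ax ay az" unfolding a_def ax_def ay_def az_def by (rule C1_shx[OF weights_cont(2) C1_u0])
  have Cb: "C1 b bx by' bz" unfolding b_def bx_def by'_def bz_def by (rule C1_shy[OF weights_cont(2) CT])
  define p px py pz where "p i = Ty e (Tx e (corr U i))" and "px i = Ty e (Tx e (corr Ux i))" and "py i = Ty e (Tx e (corr Uy i))"
    and "pz i = Ty e (Tx e (\<lambda>x y z. Uz x y z $ i - dprofile z * (Ub x y z $ i)))" for i
  have Cp: "C1 (p i) (px i) (py i) (pz i)" for i unfolding p_def px_def py_def pz_def
    by (intro C1_shy C1_shx weights_cont C1_corr_U)
  have CV1: "C1 (\<lambda>x y z. - (Xi x y z * \<phi>y x y z)) (\<lambda>x y z. - (Xi x y z * \<phi>xy x y z + Xix x y z * \<phi>y x y z))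
      (\<lambda>x y z. - (Xi x y z * \<phi>yy x y z + Xiy x y z * \<phi>y x y z)) (\<lambda>x y z. 0)"
    by (rule C1_eq[OF C1_minus[OF C1_mult[OF C1_Xi Cphi(3)]]]) simp_all
  have CV2: "C1 (\<lambda>x y z. Xi x y z * \<phi>x x y z) (\<lambda>x y z. Xi x y z * \<phi>xx x y z + Xix x y z * \<phi>x x y z)
      (\<lambda>x y z. Xi x y z * \<phi>xy x y z + Xiy x y z * \<phi>x x y z) (\<lambda>x y z. 0)"
    by (rule C1_eq[OF C1_mult[OF C1_Xi Cphi(2)]]) simp_all
  let ?e1 = "axis 1 1 :: real^3" and ?e2 = "axis 2 1 :: real^3"
  note CQ = C1_add[OF C1_transp[OF Cphi(2) Cphi(3) Cphi(2) Ca, of ?e1] C1_transp[OF Cphi(2) Cphi(3) Cphi(3) Cb, of ?e2]]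
  define G where "G = (\<lambda>x y z. w x y z * G0 x y z)"
  have cG: "cont3 G" unfolding G_def by (intro cont3_comps cw cont3_G0)
  have G_nonneg: "0 \<le> G x y z" for x y z unfolding G_def by (intro mult_nonneg_nonneg w01 G0_nonneg)
  have cTG: "cont3 (Tx e G)" "cont3 (Ty e (Tx e G))"
    by (intro cont3_shx cont3_shy weights_cont cG)+
  have TG_nonneg: "0 \<le> Tx e G x y z" for x y z
    unfolding shx_def by (rule integral_nonneg[OF integrable_continuous_real[OF cont_shx_integrand[OF cG weights_cont(1)]]]) (use G_nonneg in simp)
  have TTG_nonneg: "0 \<le> Ty e (Tx e G) x y z" for x y z
    unfolding shy_shx[of _ _ "Tx e G"] shx_def[of _ _ "\<lambda>x y z. Tx e G y x z"]
    by (rule integral_nonneg[OF integrable_continuous_real[OF cont_shx_integrand[OF cont3_swap[OF cTG(1)] weights_cont(1)]]]) (use TG_nonneg in simp)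
  define B where "B x y z = (1/64 + 9 * (k * e)) * (w x y z * gsq x y z) + 16 * K\<^sup>2 + 9/2 * (k * e) * Tx e G x y z + 9/2 * (k * e) * Ty e (Tx e G) x y z" for x y z
  have cB: "cont3 B" unfolding B_def
    by (intro cont3I continuous_intros cont3_comp[OF cw] cont3_comp[OF cont3_gsq] cont3_comp[OF cTG(1)] cont3_comp[OF cTG(2)])
  have "I3 L (\<lambda>x y z. \<phi> x y z * gsq x y z) \<le> I3 L B"
  proof (rule assembled_inequality[OF Cphi CV1 CV2 _ Cp[of 1] Cp[of 2] _ _ CQ _ _ _ L0 _ cB], goal_cases)
    case (1 x y z)
    \<comment> \<open>the divergence of the horizontal field: the radial reference value in \<open>Xi\<close> drops out, as \<open>\<phi>\<close> is radial\<close>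
    have "y * \<phi>x x y z = x * \<phi>y x y z" unfolding \<phi>x_def \<phi>y_def by (rule cutoff_radial)
    then show ?case unfolding Xix_def Xiy_def by (simp add: field_simps)
  next
    case (2 x y)
    \<comment> \<open>horizontal averages of functions with vertical mean zero have vertical mean zero\<close>
    have "zavg (p 1) x y 0 = 0"
      unfolding p_def zavg_shy[OF cont3_shx[OF weights_cont(1) cont3_corr[OF C1D(1)[OF U]]] weights_cont(1)]
      unfolding shy_def zavg_shx[OF cont3_corr[OF C1D(1)[OF U]] weights_cont(1)] shx_def
      using zprim_corr_one[OF C1D(1)[OF U], of 1] zprim_at_one[OF cont3_corr[OF C1D(1)[OF U]], of 1] by simp
    then show ?case using zprim_at_one[OF C1D(1)[OF Cp], of 1 x y 0] by simp
  next
    case (3 x y)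
    have "zavg (p 2) x y 0 = 0"
      unfolding p_def zavg_shy[OF cont3_shx[OF weights_cont(1) cont3_corr[OF C1D(1)[OF U]]] weights_cont(1)]
      unfolding shy_def zavg_shx[OF cont3_corr[OF C1D(1)[OF U]] weights_cont(1)] shx_def
      using zprim_corr_one[OF C1D(1)[OF U], of 2] zprim_at_one[OF cont3_corr[OF C1D(1)[OF U]], of 2] by simp
    then show ?case using zprim_at_one[OF C1D(1)[OF Cp], of 2 x y 0] by simp
  next
    case (4 x y)
    show ?case by (simp add: a_def b_def shx_def shy_def u0_bd transp_def)
  next
    case (5 x y)
    show ?case by (simp add: a_def b_def shx_def shy_def u0_bd transp_def)
  next
    case (6 x y z)
    \<comment> \<open>the divergence of \<open>Q\<close>: \<open>transp\<close> turns it into \<open>\<nabla>\<phi> \<cdot> (\<partial>\<^sub>x a + \<partial>\<^sub>y b)\<close>, and the sum of derivatives telescopes to the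
      difference between double mollification and function\<close>
    have da: "ax x y z $ 1 + ay x y z $ 2 + az x y z $ 3 = 0"
      unfolding ax_def ay_def az_def by (rule shx_div_free[OF cu(2-4) weights_cont(2) u0_div[OF 6]])
    have db: "bx x y z $ 1 + by' x y z $ 2 + bz x y z $ 3 = 0"
      unfolding bx_def by'_def bz_def
      by (rule shy_div_free[OF C1D(2-4)[OF CT] weights_cont(2) shx_div_free[OF cu(2-4) weights_cont(1) u0_div[OF 6]]])
    have fa: "ax x y z = Tx e u0 x y z - u0 x y z" unfolding ax_def by (rule Kx_FTC[OF C1_u0 6])
    have fb: "by' x y z = Ty e (Tx e u0) x y z - Tx e u0 x y z" unfolding by'_def by (rule Ky_FTC[OF CT 6])
    have n: "Ty e (Tx e u0) x y z $ i = Ty e (Tx e (\<lambda>x y z. u0 x y z $ i)) x y z" for i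
      unfolding shy_nth[OF C1D(1)[OF CT] weights_cont(1)] shx_nth[OF cu(1) weights_cont(1)] ..
    have n1: "Ty e (Tx e u0) x y z $ 1 = p 1 x y z" "Ty e (Tx e u0) x y z $ 2 = p 2 x y z"
      unfolding n p_def u0_nth by simp_all
    have s1: "(ax x y z + by' x y z) $ 1 = p 1 x y z - corr U 1 x y z" "(ax x y z + by' x y z) $ 2 = p 2 x y z - corr U 2 x y z"
      unfolding fa fb using n1 by (simp_all add: u0_nth)
    have ea: "az x y z $ 3 = - (ax x y z $ 1) - ay x y z $ 2" "bz x y z $ 3 = - (bx x y z $ 1) - by' x y z $ 2"
      using da db by simp_all
    have "?case \<longleftrightarrow> \<phi>x x y z * (ax x y z + by' x y z) $ 1 + \<phi>y x y z * (ax x y z + by' x y z) $ 2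
        = - (\<phi>x x y z * (corr U 1 x y z - p 1 x y z) + \<phi>y x y z * (corr U 2 x y z - p 2 x y z))"
      unfolding corr_def by (simp add: transp_def axis_def ea algebra_simps)
    then show ?case unfolding s1 by (simp add: algebra_simps)
  next
    case (7 x y z)
    have "t\<^sup>2 \<le> L\<^sup>2" using tL st by (intro power_mono) auto
    also have "L\<^sup>2 \<le> x\<^sup>2 + y\<^sup>2" using 7 by (metis add_increasing add_increasing2 order_refl power2_abs zero_le_power2)
    finally show ?case by (simp add: zero transp_zero)
  next
    case (8 x y z)
    show ?case
    \<comment> \<open>the pointwise bound; outside the support of \<open>\<phi>\<close> its left side is zero\<close>
    proof (cases "t\<^sup>2 \<le> x\<^sup>2 + y\<^sup>2")
      case True
      have "0 \<le> B x y z" unfolding B_def using k0 e w01 gsq_nonneg TG_nonneg TTG_nonneg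
        by (intro add_nonneg_nonneg mult_nonneg_nonneg) auto
      then show ?thesis by (simp add: zero[OF True] transp_zero)
    next
      case False
      have xy4: "\<bar>x\<bar> \<le> 4*R" "\<bar>y\<bar> \<le> 4*R" using 8 by (auto simp: L_def)
      have reg: "(x + c)\<^sup>2 + (y + d)\<^sup>2 \<le> (8*R)\<^sup>2" if "0 \<le> c" "c \<le> e" "0 \<le> d" "d \<le> e" for c d
        using xy4 that e R by (intro region) auto
      have reg0: "x\<^sup>2 + y\<^sup>2 \<le> (8*R)\<^sup>2" using reg[of 0 0] e by simp
      \<comment> \<open>a shifted point stays within \<open>t + 2e \<le> s'\<close> of the axis\<close>
      have w1: "w (x + c) (y + d) v = 1" if "0 \<le> c" "c \<le> e" "0 \<le> d" "d \<le> e" for c d v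
      proof -
        have "sqrt ((x + c)\<^sup>2 + (y + d)\<^sup>2) \<le> sqrt (x\<^sup>2 + y\<^sup>2) + sqrt (c\<^sup>2 + d\<^sup>2)" by (rule real_sqrt_sum_squares_triangle_ineq)
        also have "sqrt (x\<^sup>2 + y\<^sup>2) \<le> t" using False st by (intro real_le_lsqrt) auto
        also have "sqrt (c\<^sup>2 + d\<^sup>2) \<le> \<bar>c\<bar> + \<bar>d\<bar>" by (rule sqrt_sum_squares_le_sum_abs)
        finally have "sqrt ((x + c)\<^sup>2 + (y + d)\<^sup>2) \<le> s'" using that st' by simp
        then have "(x + c)\<^sup>2 + (y + d)\<^sup>2 \<le> s'\<^sup>2" by (rule sqrt_le_D)
        then show ?thesis unfolding w_def using st st' e by (intro cutoff_one) auto
      qed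
      have et: "0 \<le> e * \<tau>" "e * \<tau> \<le> e" if "0 \<le> \<tau>" "\<tau> \<le> 1" for \<tau> using that e by (auto simp: mult_left_le)
      define \<gamma> n where "\<gamma> = sqrt (gsq x y z)" and "n = norm (U x y z)"
      have gam: "0 \<le> \<gamma>" "\<gamma>\<^sup>2 = gsq x y z" unfolding \<gamma>_def by (auto simp: gsq_nonneg)
      have n: "0 \<le> n" "n \<le> N" unfolding n_def using bnd[OF reg0 8(3,4)] by auto
      have m: "\<bar>\<alpha> * \<beta>\<bar> \<le> A * C" if "\<bar>\<alpha>\<bar> \<le> A" "\<bar>\<beta>\<bar> \<le> C" for \<alpha> \<beta> A C :: real
        unfolding abs_mult using that by (intro mult_mono) auto
      have m': "\<bar>\<alpha> * \<beta>\<bar> \<le> D" if "\<bar>\<alpha>\<bar> \<le> A" "\<bar>\<beta>\<bar> \<le> C" "A * C = D" for \<alpha> \<beta> A C D :: real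
        using m[OF that(1,2)] that(3) by simp
      note Xb = Xi_bound[OF xy4, of z]
      \<comment> \<open>the derivatives of \<open>p\<close> are difference quotients with step \<open>e\<close>\<close>
      have pb: "\<bar>p i x y v\<bar> \<le> 5/2 * N" "\<bar>px i x y v\<bar> \<le> 5 * N / e" "\<bar>py i x y v\<bar> \<le> 5 * N / e" if v: "0 \<le> v" "v \<le> 1" for i v
      proof -
        note cc = cont3_corr[OF C1D(1)[OF U], of i]
        have cb: "\<bar>corr U i (x + c) (y + d) v\<bar> \<le> 5/2 * N" if "0 \<le> c" "c \<le> e" "0 \<le> d" "d \<le> e" for c d
          by (rule u0_bound(2)[OF reg[OF that] v])
        have Tb: "\<bar>Tx e (corr U i) x (y + d) v\<bar> \<le> 5/2 * N" if d: "0 \<le> d" "d \<le> e" for d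
          using norm_Tx_le[OF cc, of x e "y + d" v "5/2 * N"] cb[OF et d] by simp
        show "\<bar>p i x y v\<bar> \<le> 5/2 * N" unfolding p_def
          using norm_Ty_le[OF cont3_shx[OF weights_cont(1) cc, of e], of x y e v "5/2 * N"] Tb et by simp
        have "\<bar>Tx e (corr Ux i) x (y + d) v\<bar> \<le> 5 * N / e" if d: "0 \<le> d" "d \<le> e" for d
        proof -
          have "e * Tx e (corr Ux i) x (y + d) v = corr U i (x + e) (y + d) v - corr U i x (y + d) v"
            using Tx_FTC[OF C1_corr_U[of i] v, of e x "y + d"] by simp
          then have "\<bar>e * Tx e (corr Ux i) x (y + d) v\<bar> \<le> 5 * N"
            using cb[of e d] cb[of 0 d] d e by simp
          then show ?thesis using e by (simp add: abs_mult field_simps)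
        qed
        then show "\<bar>px i x y v\<bar> \<le> 5 * N / e" unfolding px_def
          using norm_Ty_le[OF cont3_shx[OF weights_cont(1) cont3_corr[OF C1D(2)[OF U], of i], of e], of x y e v "5 * N / e"] et by simp
        have "e * py i x y v = Tx e (corr U i) x (y + e) v - Tx e (corr U i) x y v"
          unfolding py_def using Ty_FTC[OF C1_shx[OF weights_cont(1) C1_corr_U[of i], of e] v, of e x y] by simp
        then have "\<bar>e * py i x y v\<bar> \<le> 5 * N" using Tb[of e] Tb[of 0] e by simp
        then show "\<bar>py i x y v\<bar> \<le> 5 * N / e" using e by (simp add: abs_mult field_simps)
      qed
      have zb: "\<bar>zprim (p i) x y z\<bar> \<le> 5/2 * N" "\<bar>zprim (px i) x y z\<bar> \<le> 5 * N / e" "\<bar>zprim (py i) x y z\<bar> \<le> 5 * N / e" for i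
        by (rule zprim_bound[OF C1D(1)[OF Cp] 8(3,4) pb(1)] zprim_bound[OF C1D(2)[OF Cp] 8(3,4) pb(2)] zprim_bound[OF C1D(3)[OF Cp] 8(3,4) pb(3)]; assumption)+
      \<comment> \<open>\<open>a\<close> and \<open>b\<close> carry a factor \<open>e \<le> 1\<close>; their derivatives are shifted gradients, and all points reached
        by the shifts lie where \<open>w = 1\<close>\<close>
      have Tub: "norm (Tx e u0 x (y + d) z) \<le> 5/2 * N" if d: "0 \<le> d" "d \<le> e" for d
        by (rule norm_Tx_le[OF cu(1)]) (rule u0_bound(1)[OF reg[OF et d] 8(3,4)])
      have ab: "norm (a x y z) \<le> 5/2 * N" "norm (b x y z) \<le> 5/2 * N"
      proof -
        have "norm (a x y z) \<le> e * (5/2 * N)" unfolding a_def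
          using u0_bound(1)[OF reg[OF et order_refl] 8(3,4)] e by (intro norm_Kx_le[OF cu(1)]) auto
        also have "\<dots> \<le> 1 * (5/2 * N)" using e N0 by (intro mult_right_mono) auto
        finally show "norm (a x y z) \<le> 5/2 * N" by simp
        have "norm (b x y z) \<le> e * (5/2 * N)" unfolding b_def
          using Tub et e by (intro norm_Ky_le[OF C1D(1)[OF CT]]) auto
        also have "\<dots> \<le> 1 * (5/2 * N)" using e N0 by (intro mult_right_mono) auto
        finally show "norm (b x y z) \<le> 5/2 * N" by simp
      qed
      have TG: "Tx e (\<lambda>x y z. (norm (v x y z))\<^sup>2) x (y + d) z \<le> Tx e G x (y + d) z"
        if v: "cont3 v" "\<And>x y z. (norm (v x y z))\<^sup>2 \<le> G0 x y z" and d: "0 \<le> d" "d \<le> e" for v :: "real \<Rightarrow> real \<Rightarrow> real \<Rightarrow> real^3" and d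
      proof (rule Tx_mono[OF _ cG])
        show "cont3 (\<lambda>x y z. (norm (v x y z))\<^sup>2)" by (intro cont3I continuous_intros cont3_comp[OF v(1)])
        show "(norm (v (x + e * \<tau>) (y + d) z))\<^sup>2 \<le> G (x + e * \<tau>) (y + d) z" if "0 \<le> \<tau>" "\<tau> \<le> 1" for \<tau>
          unfolding G_def w1[OF et[OF that] d] using v(2) by simp
      qed
      have Asq: "(norm (Kx e v x y z))\<^sup>2 \<le> e\<^sup>2 * Tx e G x y z"
        if v: "cont3 v" "\<And>x y z. (norm (v x y z))\<^sup>2 \<le> G0 x y z" for v :: "real \<Rightarrow> real \<Rightarrow> real \<Rightarrow> real^3"
      proof -
        have "Tx e (\<lambda>x y z. (norm (v x y z))\<^sup>2) x y z \<le> Tx e G x y z" using TG[OF v, of 0] e by simp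
        then show ?thesis using e by (intro order_trans[OF norm_Kx_sq_le[OF v(1)] mult_left_mono]) auto
      qed
      have Bsq: "(norm (Ky e (Tx e v) x y z))\<^sup>2 \<le> e\<^sup>2 * Ty e (Tx e G) x y z"
        if v: "cont3 v" "\<And>x y z. (norm (v x y z))\<^sup>2 \<le> G0 x y z" for v :: "real \<Rightarrow> real \<Rightarrow> real \<Rightarrow> real^3"
      proof -
        have cT: "cont3 (Tx e v)" by (rule cont3_shx[OF weights_cont(1) v(1)])
        have "Ty e (\<lambda>x y z. (norm (Tx e v x y z))\<^sup>2) x y z \<le> Ty e (Tx e G) x y z"
        proof (rule Ty_mono[OF _ cTG(1)])
          show "cont3 (\<lambda>x y z. (norm (Tx e v x y z))\<^sup>2)" by (intro cont3I continuous_intros cont3_comp[OF cT])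
          show "(norm (Tx e v x (y + e * \<tau>) z))\<^sup>2 \<le> Tx e G x (y + e * \<tau>) z" if "0 \<le> \<tau>" "\<tau> \<le> 1" for \<tau>
            using norm_Tx_sq_le[OF v(1), of e x "y + e * \<tau>" z] TG[OF v et[OF that]] by linarith
        qed
        then show ?thesis using e by (intro order_trans[OF norm_Ky_sq_le[OF cT] mult_left_mono]) auto
      qed
      have G0j: "(norm (u0x x y z))\<^sup>2 \<le> G0 x y z" "(norm (u0y x y z))\<^sup>2 \<le> G0 x y z" "(norm (u0z x y z))\<^sup>2 \<le> G0 x y z" for x y z
        by (simp_all add: G0_def)
      have abs_a: "3 * k * (\<gamma> * norm (ax x y z)) \<le> 3/2 * k * e * (\<gamma>\<^sup>2 + Tx e G x y z)"
          "3 * k * (\<gamma> * norm (ay x y z)) \<le> 3/2 * k * e * (\<gamma>\<^sup>2 + Tx e G x y z)"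
          "3 * k * (\<gamma> * norm (az x y z)) \<le> 3/2 * k * e * (\<gamma>\<^sup>2 + Tx e G x y z)"
        unfolding ax_def ay_def az_def by (rule absorb[OF e(1) k0]; rule Asq; rule cu G0j)+
      have abs_b: "3 * k * (\<gamma> * norm (bx x y z)) \<le> 3/2 * k * e * (\<gamma>\<^sup>2 + Ty e (Tx e G) x y z)"
          "3 * k * (\<gamma> * norm (by' x y z)) \<le> 3/2 * k * e * (\<gamma>\<^sup>2 + Ty e (Tx e G) x y z)"
          "3 * k * (\<gamma> * norm (bz x y z)) \<le> 3/2 * k * e * (\<gamma>\<^sup>2 + Ty e (Tx e G) x y z)"
        unfolding bx_def by'_def bz_def by (rule absorb[OF e(1) k0]; rule Bsq; rule cu G0j)+
      \<comment> \<open>the groups of terms in \<open>assembled_inequality\<close>, one by one, with the derivatives of \<open>a\<close> and \<open>b\<close> kept\<close>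
      have c1: "(\<bar>\<phi>x x y z\<bar> + \<bar>\<phi>y x y z\<bar>) * norm (U x y z) \<le> 2 * k * N"
        unfolding n_def[symmetric] using phib(1,2)[of x y z] n k0 by (intro mult_mono) auto
      have Vd: "\<bar>- (Xi x y z * F1 + H * F2)\<bar> \<le> 8 * (k * N / l) + 2 * (k * N)" "\<bar>Xi x y z * F1 + H * F2\<bar> \<le> 8 * (k * N / l) + 2 * (k * N)"
        if "\<bar>F1\<bar> \<le> k / l" "\<bar>H\<bar> \<le> 2 * N" "\<bar>F2\<bar> \<le> k" for F1 H F2
      proof -
        have "\<bar>Xi x y z * F1\<bar> \<le> 8 * (k * N / l)" "\<bar>H * F2\<bar> \<le> 2 * (k * N)"
          by (rule m'[OF Xb(1) that(1)], simp) (rule m'[OF that(2,3)], simp)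
        then show "\<bar>- (Xi x y z * F1 + H * F2)\<bar> \<le> 8 * (k * N / l) + 2 * (k * N)" "\<bar>Xi x y z * F1 + H * F2\<bar> \<le> 8 * (k * N / l) + 2 * (k * N)"
          by linarith+
      qed
      have V0: "\<bar>- (Xi x y z * \<phi>y x y z)\<bar> \<le> 8 * (k * N)" "\<bar>Xi x y z * \<phi>x x y z\<bar> \<le> 8 * (k * N)"
      proof -
        have "\<bar>Xi x y z * \<phi>y x y z\<bar> \<le> 8 * (k * N)" by (rule m'[OF Xb(1) phib(2)]) simp
        then show "\<bar>- (Xi x y z * \<phi>y x y z)\<bar> \<le> 8 * (k * N)" by simp
        show "\<bar>Xi x y z * \<phi>x x y z\<bar> \<le> 8 * (k * N)" by (rule m'[OF Xb(1) phib(1)]) simp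
      qed
      have Gd: "\<bar>(F1 * M1 + F2 * M2) + (F3 * M3 + F4 * M4)\<bar> \<le> 10 * (k * N / e) + 5 * (k * N / l)"
        if "\<bar>F1\<bar> \<le> k" "\<bar>F2\<bar> \<le> k / l" "\<bar>F3\<bar> \<le> k" "\<bar>F4\<bar> \<le> k / l" "\<bar>M1\<bar> \<le> 5 * N / e" "\<bar>M2\<bar> \<le> 5/2 * N" "\<bar>M3\<bar> \<le> 5 * N / e" "\<bar>M4\<bar> \<le> 5/2 * N"
        for F1 F2 F3 F4 M1 M2 M3 M4 :: real
      proof -
        have b4: "\<bar>F1 * M1\<bar> \<le> 5 * (k * N / e)" "\<bar>F3 * M3\<bar> \<le> 5 * (k * N / e)" "\<bar>F2 * M2\<bar> \<le> 5/2 * (k * N / l)" "\<bar>F4 * M4\<bar> \<le> 5/2 * (k * N / l)"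
          by (rule m'[OF that(1,5)], simp) (rule m'[OF that(3,7)], simp, rule m'[OF that(2,6)], simp, rule m'[OF that(4,8)], simp)
        from abs_sum4[OF b4(1,3,2,4)] show ?thesis by (simp add: ac_simps)
      qed
      have G2: "\<bar>F1 * M1 + F2 * M2\<bar> \<le> 5 * (k * N)" if "\<bar>F1\<bar> \<le> k" "\<bar>F2\<bar> \<le> k" "\<bar>M1\<bar> \<le> 5/2 * N" "\<bar>M2\<bar> \<le> 5/2 * N" for F1 M1 F2 M2 :: real
      proof -
        have "\<bar>F1 * M1\<bar> \<le> 5/2 * (k * N)" "\<bar>F2 * M2\<bar> \<le> 5/2 * (k * N)"
          by (rule m'[OF that(1,3)], simp) (rule m'[OF that(2,4)], simp)
        then show ?thesis by linarith
      qed
      have ne: "norm ?e1 = 1" "norm ?e2 = 1" by simp_all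
      have Qd: "norm ((transp F1 F2 F3 ?e1 v1 + transp F4 F5 F6 ?e1 (a x y z)) + (transp F7 F8 F9 ?e2 v2 + transp F10 F11 F12 ?e2 (b x y z)))
          \<le> 3 * k * norm v1 + 3 * k * norm v2 + 15 * (k * N / l)"
        if "\<bar>F1\<bar> \<le> k" "\<bar>F2\<bar> \<le> k" "\<bar>F3\<bar> \<le> k" "\<bar>F4\<bar> \<le> k/l" "\<bar>F5\<bar> \<le> k/l" "\<bar>F6\<bar> \<le> k/l" "\<bar>F7\<bar> \<le> k" "\<bar>F8\<bar> \<le> k" "\<bar>F9\<bar> \<le> k" "\<bar>F10\<bar> \<le> k/l" "\<bar>F11\<bar> \<le> k/l" "\<bar>F12\<bar> \<le> k/l"
        for F1 F2 F3 F4 F5 F6 F7 F8 F9 F10 F11 F12 v1 v2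
      proof -
        have "3 * (k / l) * norm (a x y z) \<le> 3 * (k / l) * (5/2 * N)" "3 * (k / l) * norm (b x y z) \<le> 3 * (k / l) * (5/2 * N)"
          using ab k0 l0 by (intro mult_left_mono; simp)+
        then have "norm (transp F4 F5 F6 ?e1 (a x y z)) \<le> 15/2 * (k * N / l)" "norm (transp F10 F11 F12 ?e2 (b x y z)) \<le> 15/2 * (k * N / l)"
          using norm_transp_le[OF that(4-6) ne(1), of "a x y z"] norm_transp_le[OF that(10-12) ne(2), of "b x y z"] by simp_all
        from norm_sum4[OF norm_transp_le[OF that(1-3) ne(1), of v1] this(1) norm_transp_le[OF that(7-9) ne(2), of v2] this(2)]
        show ?thesis by (simp add: ac_simps)
      qed
      have Q0: "norm (transp F1 F2 F3 ?e1 v1 + transp F7 F8 F9 ?e2 v2) \<le> 3 * k * norm v1 + 3 * k * norm v2"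
        if "\<bar>F1\<bar> \<le> k" "\<bar>F2\<bar> \<le> k" "\<bar>F3\<bar> \<le> k" "\<bar>F7\<bar> \<le> k" "\<bar>F8\<bar> \<le> k" "\<bar>F9\<bar> \<le> k" for F1 F2 F3 F7 F8 F9 v1 v2
        by (intro order_trans[OF norm_triangle_ineq] add_mono norm_transp_le that ne)
      have c2: "3/2 * (A1 + A2) + A3 + A4 \<le> 6 * (k * N) + 44 * (k * N / l) + 10 * (k * N / e) + 3 * k * v1 + 3 * k * v2"
        if "A1 \<le> 8 * (k * N / l) + 2 * (k * N)" "A2 \<le> 8 * (k * N / l) + 2 * (k * N)" "A3 \<le> 10 * (k * N / e) + 5 * (k * N / l)"
          "A4 \<le> 3 * k * v1 + 3 * k * v2 + 15 * (k * N / l)" for A1 A2 A3 A4 v1 v2 :: real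
        using group_sum[OF that, of "3/2"] by (simp add: algebra_simps)
      have c4: "6 * (A1 + A2) + A3 + A4 \<le> 101 * (k * N) + 3 * k * v1 + 3 * k * v2"
        if "A1 \<le> 8 * (k * N)" "A2 \<le> 8 * (k * N)" "A3 \<le> 5 * (k * N)" "A4 \<le> 3 * k * v1 + 3 * k * v2" for A1 A2 A3 A4 v1 v2 :: real
        using group_sum[OF that, of 6] by (simp add: algebra_simps)
      have c5: "6 * norm (U x y z) * (3/2 * (A1 + A2) + A3 + A4) \<le> 6 * N * (44 * (k * N))"
        if "A1 \<le> 8 * (k * N)" "A2 \<le> 8 * (k * N)" "A3 \<le> 5 * (k * N)" "A4 \<le> 3 * k * norm (a x y z) + 3 * k * norm (b x y z)" for A1 A2 A3 A4 :: real
      proof -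
        have "3 * k * norm (a x y z) \<le> 3 * k * (5/2 * N)" "3 * k * norm (b x y z) \<le> 3 * k * (5/2 * N)"
          using ab k0 by (intro mult_left_mono; simp)+
        from order_trans[OF that(4) add_mono[OF this]] have "A4 \<le> 15 * (k * N)" by (simp add: ac_simps)
        from group_sum[OF that(1-3) this, of "3/2"] have "3/2 * (A1 + A2) + A3 + A4 \<le> 44 * (k * N)" by (simp add: ac_simps)
        then show ?thesis unfolding n_def[symmetric] using n k0 N0
          by (intro order_trans[OF mult_left_mono mult_right_mono]) auto
      qed
      define T where "T = 2 * k * N + (6 * (k * N) + 44 * (k * N / l) + 10 * (k * N / e) + 3 * k * norm (ax x y z) + 3 * k * norm (bx x y z))
         + (6 * (k * N) + 44 * (k * N / l) + 10 * (k * N / e) + 3 * k * norm (ay x y z) + 3 * k * norm (by' x y z))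
         + (101 * (k * N) + 3 * k * norm (az x y z) + 3 * k * norm (bz x y z)) + 6 * N * (44 * (k * N))"
      have h1: "\<gamma> * T \<le> B x y z"
      proof -
        define S where "S = norm (ax x y z) + norm (ay x y z) + norm (az x y z) + norm (bx x y z) + norm (by' x y z) + norm (bz x y z)"
        \<comment> \<open>so that the linear terms, of order \<open>N\<close>, and the convective one, of order \<open>N\<^sup>2\<close>, fit into one constant\<close>
        have NN: "N \<le> N\<^sup>2" using N by (simp add: power2_eq_square)
        have "T = k * N * (115 + 88 / l + 20 / e) + 264 * (k * N\<^sup>2) + 3 * k * S"
          unfolding T_def S_def by (simp add: algebra_simps power2_eq_square)
        also have "k * N * (115 + 88 / l + 20 / e) \<le> k * N\<^sup>2 * (115 + 88 / l + 20 / e)"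
          using NN k0 l0 e by (intro mult_right_mono mult_left_mono) auto
        also have "k * N\<^sup>2 * (115 + 88 / l + 20 / e) + 264 * (k * N\<^sup>2) = K" unfolding K by (simp add: algebra_simps)
        finally have "T \<le> K + 3 * k * S" by simp
        then have "\<gamma> * T \<le> \<gamma> * (K + 3 * k * S)" using gam by (intro mult_left_mono) auto
        also have "\<dots> = \<gamma> * K + (3 * k * (\<gamma> * norm (ax x y z)) + 3 * k * (\<gamma> * norm (ay x y z)) + 3 * k * (\<gamma> * norm (az x y z))
            + 3 * k * (\<gamma> * norm (bx x y z)) + 3 * k * (\<gamma> * norm (by' x y z)) + 3 * k * (\<gamma> * norm (bz x y z)))"
          unfolding S_def by (simp add: algebra_simps)
        also have "\<dots> \<le> (1/64 * \<gamma>\<^sup>2 + 16 * K\<^sup>2) + (3/2 * k * e * (\<gamma>\<^sup>2 + Tx e G x y z) + 3/2 * k * e * (\<gamma>\<^sup>2 + Tx e G x y z) + 3/2 * k * e * (\<gamma>\<^sup>2 + Tx e G x y z)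
           + 3/2 * k * e * (\<gamma>\<^sup>2 + Ty e (Tx e G) x y z) + 3/2 * k * e * (\<gamma>\<^sup>2 + Ty e (Tx e G) x y z) + 3/2 * k * e * (\<gamma>\<^sup>2 + Ty e (Tx e G) x y z))"
          using two_mult_le_squares[of "\<gamma> / 8" "4 * K"] by (intro add_mono abs_a abs_b) (simp add: power_divide power_mult_distrib mult.commute[of K])
        also have "\<dots> = B x y z"
          using w1[of 0 0 z] e unfolding B_def gam(2) by (simp add: algebra_simps)
        finally show ?thesis .
      qed
      have h2: "sqrt (gsq x y z) * ((\<bar>\<phi>x x y z\<bar> + \<bar>\<phi>y x y z\<bar>) * norm (U x y z) + Z2 + Z3 + Z4 + Z5) \<le> \<gamma> * T"
        if "Z2 \<le> 6 * (k * N) + 44 * (k * N / l) + 10 * (k * N / e) + 3 * k * norm (ax x y z) + 3 * k * norm (bx x y z)"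
          "Z3 \<le> 6 * (k * N) + 44 * (k * N / l) + 10 * (k * N / e) + 3 * k * norm (ay x y z) + 3 * k * norm (by' x y z)"
          "Z4 \<le> 101 * (k * N) + 3 * k * norm (az x y z) + 3 * k * norm (bz x y z)" "Z5 \<le> 6 * N * (44 * (k * N))" for Z2 Z3 Z4 Z5
        unfolding \<gamma>_def[symmetric] T_def by (intro mult_left_mono add_mono c1 that gam)
      show ?thesis
        by (rule order_trans[OF h2 h1]) (intro c2 c4 c5 Vd V0 Gd G2 Qd Q0 phib zb pb(1) 8(3,4) Xb)+
    qed
  qed
  also have "I3 L B \<le> (1/64 + 756 * (k * e)) * I3 L (\<lambda>x y z. w x y z * gsq x y z) + 1024 * R\<^sup>2 * K\<^sup>2"
  proof -
    define f where "f = I3 L (\<lambda>x y z. w x y z * gsq x y z)"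
    have cwg: "cont3 (\<lambda>x y z. w x y z * gsq x y z)" "cont3 (\<lambda>x y z. w x y z * dsq x y z)" by (intro cont3_comps cw cont3_gsq cont3_dsq)+
    have "I3 L G \<le> I3 L (\<lambda>x y z. 2 * (w x y z * gsq x y z) + 81 * (w x y z * dsq x y z))"
    proof (rule I3_mono[OF cG])
      show "cont3 (\<lambda>x y z. 2 * (w x y z * gsq x y z) + 81 * (w x y z * dsq x y z))"
        by (intro cont3I continuous_intros cont3_comp[OF cwg(1)] cont3_comp[OF cwg(2)])
      fix x y z :: real assume z: "0 \<le> z" "z \<le> 1"
      show "G x y z \<le> 2 * (w x y z * gsq x y z) + 81 * (w x y z * dsq x y z)"
        unfolding G_def using mult_left_mono[OF G0_le[OF z, of x y] w01(1)[of x y z]] by (simp add: algebra_simps)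
    qed
    also have "\<dots> = 2 * f + 81 * I3 L (\<lambda>x y z. w x y z * dsq x y z)"
      unfolding f_def I3_cmul[symmetric]
      by (rule I3_add) (intro cont3I continuous_intros cont3_comp[OF cwg(1)] cont3_comp[OF cwg(2)])+
    also have "I3 L (\<lambda>x y z. w x y z * dsq x y z) = f"
      unfolding f_def by (rule I3_weight_zavg[OF cont3_gsq cw wz])
    finally have IG: "I3 L G \<le> 83 * f" by simp
    have T1: "I3 L (Tx e G) \<le> 83 * f"
      using I3_Tx_le[OF cG _ L0 G_nonneg, of e] wzero e IG by (force simp: G_def)
    have "I3 L (Ty e (Tx e G)) \<le> I3 L (Tx e G)"
      by (rule I3_Ty_le[OF cTG(1) _ L0 TG_nonneg]) (use e wzero in \<open>auto simp: G_def shx_def\<close>)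
    then have T2: "I3 L (Ty e (Tx e G)) \<le> 83 * f" using T1 by simp
    have ke: "0 \<le> k * e" using k0 e by simp
    have cTG': "cont3 (\<lambda>x y z. Tx e G x y z)" "cont3 (\<lambda>x y z. Ty e (Tx e G) x y z)" using cTG by simp_all
    have "I3 L B = (1/64 + 9 * (k * e)) * f + I3 L (\<lambda>x y z. 16 * K\<^sup>2) + 9/2 * (k * e) * I3 L (Tx e G) + 9/2 * (k * e) * I3 L (Ty e (Tx e G))"
      unfolding B_def f_def I3_cmul[symmetric]
      by (subst I3_add, (intro cont3I continuous_intros cont3_comp[OF cwg(1)] cont3_comp[OF cTG(1)] cont3_comp[OF cTG(2)])[1],
          (intro cont3I continuous_intros cont3_comp[OF cwg(1)] cont3_comp[OF cTG(1)] cont3_comp[OF cTG(2)])[1])+ (rule refl)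
    also have "I3 L (\<lambda>x y z. 16 * K\<^sup>2) = 1024 * R\<^sup>2 * K\<^sup>2"
      unfolding I3_const[OF L0] by (simp add: L_def power_mult_distrib)
    also have "(1/64 + 9 * (k * e)) * f + 1024 * R\<^sup>2 * K\<^sup>2 + 9/2 * (k * e) * I3 L (Tx e G) + 9/2 * (k * e) * I3 L (Ty e (Tx e G))
       \<le> (1/64 + 9 * (k * e)) * f + 1024 * R\<^sup>2 * K\<^sup>2 + 9/2 * (k * e) * (83 * f) + 9/2 * (k * e) * (83 * f)"
      using T1 T2 ke by (intro add_mono mult_left_mono order_refl) auto
    also have "\<dots> = (1/64 + 756 * (k * e)) * f + 1024 * R\<^sup>2 * K\<^sup>2" by (simp add: algebra_simps)
    finally show ?thesis unfolding f_def .
  qed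
  finally show ?thesis unfolding \<phi>_def w_def L_def .
qed

text \<open>
  Radii increase from \<open>2R\<close> to \<open>4R\<close> with widths of order \<open>R 2\<^sup>-\<^sup>n\<close>, and the shift is a fixed small fraction of the width,
  but at most of order 1. The latter keeps the correction of size \<open>N / l\<close> also for wide cutoffs.
\<close>
lemma F_growth: "F R \<le> 2 * (growth_const * N ^ 4)"
proof -
  define rho tau where "rho n = 4 * R - 2 * R * (1/2) ^ n" and "tau n = 4 * R - 3/2 * R * (1/2) ^ n" for n :: nat
  define f where "f n = I3 (4*R) (\<lambda>x y z. cutoff (rho n) (tau n) x y z * gsq x y z)" for n
  have R0: "0 < R" using R by simp
  have h: "0 < (1/2::real) ^ n" "(1/2::real) ^ n \<le> 1" for n by (auto simp: power_le_one)
  have Rh: "0 < R * (1/2) ^ n" "R * (1/2) ^ n \<le> R" for n using h[of n] R0 by (auto simp: mult_left_le)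
  have rt: "0 \<le> rho n" "rho n < tau n" "tau n \<le> 4 * R" for n
    using Rh[of n] R0 by (simp_all add: rho_def tau_def)
  have step: "f n \<le> f (Suc n) / 32 + (growth_const * N ^ 4) * 16 ^ n" for n
  proof -
    define l where "l = tau n - rho n"
    have l: "l = R * (1/2) ^ n / 2" by (simp add: l_def tau_def rho_def)
    have l0: "0 < l" using Rh[of n] by (simp add: l)
    define e where "e = min 1 l / 100000000"
    have e: "0 < e" "e \<le> 1" "2 * e \<le> l" "e \<le> l / 100000000" using l0 by (auto simp: e_def)
    have ie: "1 / e \<le> 100000000 * (1 + 1 / l)"
    proof (cases "l \<le> 1")
      case True then have b: "1 / e = 100000000 * (1 / l)" by (simp add: e_def)
      show ?thesis unfolding b by (intro mult_left_mono) auto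
    next
      case False then have b: "1 / e = 100000000 * 1" by (simp add: e_def)
      show ?thesis unfolding b using l0 by (intro mult_left_mono) auto
    qed
    define k where "k = 1000 / l"
    define K where "K = k * N\<^sup>2 * (379 + 88 / l + 20 / e)"
    \<comment> \<open>half of the distance between the radii is left for the shifts\<close>
    have sn: "tau n + 2 * e \<le> rho (Suc n)" using e(3) unfolding l by (simp add: tau_def rho_def)
    have "f n \<le> (1/64 + 756 * (k * e)) * f (Suc n) + 1024 * R\<^sup>2 * K\<^sup>2"
      unfolding f_def by (rule caccioppoli_step[OF rt(1,2) e(1,2) sn rt(2,3) l_def k_def K_def])
    also have "\<dots> \<le> (1/32) * f (Suc n) + 1024 * R\<^sup>2 * K\<^sup>2"
    proof (intro add_right_mono mult_right_mono)
      have "k * e \<le> k * (l / 100000000)" using e(4) l0 by (intro mult_left_mono) (auto simp: k_def)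
      also have "\<dots> = 1 / 100000" using l0 by (simp add: k_def)
      finally show "1/64 + 756 * (k * e) \<le> 1/32" by simp
      show "0 \<le> f (Suc n)" unfolding f_def by (intro I3_nonneg cont3_cutoff_gsq cutoff_gsq_nonneg)
    qed
    also have "1024 * R\<^sup>2 * K\<^sup>2 \<le> (growth_const * N ^ 4) * 16 ^ n"
    proof -
      define m where "m = (2::real) ^ n"
      have m1: "1 \<le> m" by (simp add: m_def one_le_power)
      have il: "1 / l = 2 * m / R" using R0 by (simp add: l m_def power_divide)
      have il2: "1 / l \<le> 2 * m" unfolding il using R m1 by (simp add: divide_le_eq mult_le_cancel_left1)
      have bb: "379 + 88 / l + 20 / e \<le> 3000000000 * (1 + 1 / l)"
      proof -
        define a c where "a = 1 / l" and "c = 1 / e"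
        have "0 \<le> a" "c \<le> 100000000 * (1 + a)" using l0 ie by (simp_all add: a_def c_def)
        then have "379 + 88 * a + 20 * c \<le> 3000000000 * (1 + a)" unfolding distrib_left by linarith
        then show ?thesis by (simp add: a_def c_def)
      qed
      also have "\<dots> \<le> 3000000000 * (3 * m)" using il2 m1 by (intro mult_left_mono) auto
      finally have b1: "379 + 88 / l + 20 / e \<le> 9000000000 * m" by simp
      have "R * k = 1000 * (R * (1 / l))" by (simp add: k_def)
      then have Rk: "R * k = 2000 * m" unfolding il using R0 by simp
      have "R * K = (R * k) * N\<^sup>2 * (379 + 88 / l + 20 / e)" by (simp add: K_def)
      also have "\<dots> \<le> (2000 * m) * N\<^sup>2 * (9000000000 * m)"
        unfolding Rk using b1 m1 by (intro mult_left_mono) auto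
      also have "\<dots> = 18000000000000 * (N\<^sup>2 * m\<^sup>2)" by (simp add: power2_eq_square)
      finally have le: "R * K \<le> 18000000000000 * (N\<^sup>2 * m\<^sup>2)" .
      have "0 \<le> K" unfolding K_def using l0 e by (simp add: k_def)
      then have "(R * K)\<^sup>2 \<le> (18000000000000 * (N\<^sup>2 * m\<^sup>2))\<^sup>2" using le R0 by (intro power_mono) auto
      also have "\<dots> = 18000000000000\<^sup>2 * (N ^ 4 * m ^ 4)" by (simp add: power_mult_distrib flip: power_mult)
      also have "m ^ 4 = 16 ^ n" unfolding m_def by (simp add: power_mult[symmetric] mult.commute[of n] power_mult)
      finally have "(R * K)\<^sup>2 \<le> 18000000000000\<^sup>2 * (N ^ 4 * 16 ^ n)" .
      then have "1024 * (R * K)\<^sup>2 \<le> 1024 * (18000000000000\<^sup>2 * (N ^ 4 * 16 ^ n))" by (intro mult_left_mono) auto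
      then show ?thesis unfolding growth_const_def by (simp only: power_mult_distrib mult.assoc)
    qed
    finally show ?thesis by simp
  qed
  have "f n \<le> I3 (4*R) gsq" for n
    unfolding f_def
    by (rule I3_mono[OF cont3_cutoff_gsq cont3_gsq]) (use cutoff_range gsq_nonneg in \<open>simp add: mult_left_le_one_le\<close>)
  from iterate_bound[OF step this] have "f 0 \<le> 2 * (growth_const * N ^ 4)" .
  moreover have "F R \<le> f 0"
  proof -
    have "F R \<le> I3 (4*R) (\<lambda>x y z. cutoff R (2*R) x y z * gsq x y z)"
      unfolding F_def using R0 by (intro I3_mono_box cont3_cutoff_gsq cutoff_gsq_nonneg) auto
    also have "\<dots> \<le> f 0"
      unfolding f_def
    proof (rule I3_mono[OF cont3_cutoff_gsq cont3_cutoff_gsq], rule mult_right_mono[OF _ gsq_nonneg])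
      fix x y z :: real
      show "cutoff R (2 * R) x y z \<le> cutoff (rho 0) (tau 0) x y z"
      proof (cases "x\<^sup>2 + y\<^sup>2 \<le> (2*R)\<^sup>2")
        case True
        then have "cutoff (rho 0) (tau 0) x y z = 1" using R0 by (intro cutoff_one) (auto simp: rho_def tau_def)
        then show ?thesis using cutoff_range by simp
      next
        case False
        then have "cutoff R (2*R) x y z = 0" using R0 by (intro cutoff_zero(1)) auto
        then show ?thesis using cutoff_range by simp
      qed
    qed
    finally show ?thesis .
  qed
  ultimately show ?thesis by linarith
qed

end

section \<open>From vector fields on the closed slab to coordinates\<close>

definition v3 :: "real \<Rightarrow> real \<Rightarrow> real \<Rightarrow> real^3" where "v3 x y z = vector [x, y, z]"
definition clamp01 :: "real \<Rightarrow> real" where "clamp01 z = max 0 (min 1 z)"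
definition coords :: "(real^3 \<Rightarrow> 'b) \<Rightarrow> real \<Rightarrow> real \<Rightarrow> real \<Rightarrow> 'b" where "coords f x y z = f (v3 x y (clamp01 z))"

lemma v3_nth [simp]: "v3 x y z $ 1 = x" "v3 x y z $ 2 = y" "v3 x y z $ 3 = z" by (simp_all add: v3_def)
lemma v3_eta: "v3 (p $ 1) (p $ 2) (p $ 3) = p" by (simp add: v3_def vec_eq_iff forall_3)
lemma clamp01_simps: "0 \<le> clamp01 z" "clamp01 z \<le> 1" "0 \<le> z \<Longrightarrow> z \<le> 1 \<Longrightarrow> clamp01 z = z" by (auto simp: clamp01_def)
lemma v3_in: "0 \<le> z \<Longrightarrow> z \<le> 1 \<Longrightarrow> v3 x y z \<in> closed_slab" by (simp add: closed_slab_def)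
lemma v3_slab: "0 < z \<Longrightarrow> z < 1 \<Longrightarrow> v3 x y z \<in> slab" by (simp add: slab_def)

lemma v3_cont: "continuous_on S f \<Longrightarrow> continuous_on S g \<Longrightarrow> continuous_on S h \<Longrightarrow> continuous_on S (\<lambda>s. v3 (f s) (g s) (h s))"
  unfolding v3_def vector3_eq by (intro continuous_intros)

lemma cont3_coords: assumes "continuous_on closed_slab f" shows "cont3 (coords f)"
  unfolding coords_def
  by (intro cont3I continuous_on_compose2[OF assms] v3_cont) (auto intro!: continuous_intros v3_in clamp01_simps simp: clamp01_def[abs_def])

lemma v3_deriv:
  "((\<lambda>s. v3 s y z) has_vector_derivative axis 1 1) (at x within S)"
  "((\<lambda>s. v3 x s z) has_vector_derivative axis 2 1) (at y within S)"
  "((\<lambda>s. v3 x y s) has_vector_derivative axis 3 1) (at z within S)"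
  unfolding v3_def vector3_eq by (auto intro!: derivative_eq_intros)

lemma C1_coords:
  fixes f :: "real^3 \<Rightarrow> 'b::real_normed_vector"
  assumes d: "\<And>p. p \<in> closed_slab \<Longrightarrow> (f has_derivative f' p) (at p within closed_slab)"
    and c: "\<And>v. continuous_on closed_slab (\<lambda>p. f' p v)"
  shows "C1 (coords f) (coords (\<lambda>p. f' p (axis 1 1))) (coords (\<lambda>p. f' p (axis 2 1))) (coords (\<lambda>p. f' p (axis 3 1)))"
proof (rule C1I)
  show "cont3 (coords f)" by (rule cont3_coords) (rule has_derivative_continuous_on[OF d])
  show "cont3 (coords (\<lambda>p. f' p (axis 1 1)))" "cont3 (coords (\<lambda>p. f' p (axis 2 1)))" "cont3 (coords (\<lambda>p. f' p (axis 3 1)))"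
    by (intro cont3_coords c)+
  fix x y z :: real assume z: "0 \<le> z" "z \<le> 1"
  have chain: "((\<lambda>s. f (g s)) has_vector_derivative f' (g t) v) (at t within S)"
    if "(g has_vector_derivative v) (at t within S)" "g ` S \<subseteq> closed_slab" "t \<in> S" for g :: "real \<Rightarrow> real^3" and v t S
  proof -
    have "(f has_derivative f' (g t)) (at (g t) within g ` S)"
      by (rule has_derivative_subset[OF d]) (use that in auto)
    from vector_derivative_diff_chain_within[OF that(1) this] show ?thesis by (simp add: o_def)
  qed
  have rg: "range (\<lambda>s. v3 s y z) \<subseteq> closed_slab" "range (\<lambda>s. v3 x s z) \<subseteq> closed_slab" using v3_in[OF z] by auto
  show "((\<lambda>s. coords f s y z) has_vector_derivative coords (\<lambda>p. f' p (axis 1 1)) x y z) (at x)"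
    "((\<lambda>s. coords f x s z) has_vector_derivative coords (\<lambda>p. f' p (axis 2 1)) x y z) (at y)"
    using chain[OF v3_deriv(1) rg(1) UNIV_I] chain[OF v3_deriv(2) rg(2) UNIV_I] z by (simp_all add: coords_def clamp01_simps)
  have "((\<lambda>s. f (v3 x y s)) has_vector_derivative f' (v3 x y z) (axis 3 1)) (at z within {0..1})"
    by (rule chain[OF v3_deriv(3)]) (use z in \<open>auto simp: v3_in\<close>)
  then have "((\<lambda>s. coords f x y s) has_vector_derivative f' (v3 x y z) (axis 3 1)) (at z within {0..1})"
    by (rule has_vector_derivative_transform[rotated 2]) (use z in \<open>auto simp: coords_def clamp01_simps\<close>)
  then show "((\<lambda>s. coords f x y s) has_vector_derivative coords (\<lambda>p. f' p (axis 3 1)) x y z) (at z within {0..1})"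
    using z by (simp add: coords_def clamp01_simps)
qed

lemma open_slab: "open slab"
  unfolding slab_def by (intro open_Collect_conj open_Collect_less continuous_intros)

lemma at_slab: "p \<in> slab \<Longrightarrow> at p within closed_slab = at p"
  by (rule at_within_open_subset[OF _ open_slab]) (auto simp: slab_def closed_slab_def)

lemma slab_subset: "p \<in> slab \<Longrightarrow> p \<in> closed_slab" by (auto simp: slab_def closed_slab_def)

lemma partial_eq:
  fixes f :: "real^3 \<Rightarrow> 'b::real_normed_vector"
  assumes d: "\<And>p. p \<in> closed_slab \<Longrightarrow> (f has_derivative f' p) (at p within closed_slab)" and p: "p \<in> slab"
  shows "partial j f p = f' p (axis j 1)"
proof -
  have "(f has_derivative f' p) (at p)" using d[OF slab_subset[OF p]] by (simp add: at_slab[OF p])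
  from frechet_derivative_at[OF this] show ?thesis by (simp add: partial_def)
qed

lemma partial2_eq:
  fixes f :: "real^3 \<Rightarrow> 'b::real_normed_vector"
  assumes d: "\<And>p. p \<in> closed_slab \<Longrightarrow> (f has_derivative f' p) (at p within closed_slab)"
    and d2: "\<And>p. p \<in> closed_slab \<Longrightarrow> ((\<lambda>p. f' p (axis j 1)) has_derivative g p) (at p within closed_slab)" and p: "p \<in> slab"
  shows "partial j (partial j f) p = g p (axis j 1)"
proof -
  have "((\<lambda>p. f' p (axis j 1)) has_derivative g p) (at p)" using d2[OF slab_subset[OF p]] by (simp add: at_slab[OF p])
  then have "(partial j f has_derivative g p) (at p)"
    by (rule has_derivative_transform_within_open[OF _ open_slab p]) (simp add: partial_eq[OF d])
  from frechet_derivative_at[OF this] show ?thesis by (simp add: partial_def[of j "partial j f"])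
qed

text \<open>
  The equations hold in the open slab only; by continuity of all derivatives they extend to the faces.
\<close>
lemma extend_closed:
  fixes D :: "real \<Rightarrow> 'b::real_normed_vector"
  assumes c: "continuous_on UNIV D" and D: "\<And>z. 0 < z \<Longrightarrow> z < 1 \<Longrightarrow> D z = 0" and z: "0 \<le> z" "z \<le> 1"
  shows "D z = 0"
  by (rule continuous_constant_on_closure[of "{0<..<1}" D]) (use assms in \<open>auto intro: continuous_on_subset\<close>)

text \<open>
  The derivatives within the closed slab agree with the full derivatives in the open slab, where the differential
  operators are evaluated.
\<close>
lemma slab_flow_of_solution:
  assumes sol: "smooth_NS_solution u" and ns: "no_slip u"
  obtains Ux Uy Uz Uxx Uyy Uzz P Px Py Pz where "slab_flow (coords u) Ux Uy Uz Uxx Uyy Uzz P Px Py Pz"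
    "\<And>p. p \<in> slab \<Longrightarrow> grad_norm_sq u p = slab_flow.gsq Ux Uy Uz (p $ 1) (p $ 2) (p $ 3)"
proof -
  from sol obtain P where su: "smooth_on u closed_slab" and sP: "smooth_on P closed_slab"
    and eq: "\<And>p. p \<in> slab \<Longrightarrow> - laplacian u p + advect u u p + grad P p = 0 \<and> divergence u p = 0"
    unfolding smooth_NS_solution_def by blast
  have "Ck_on (Suc (Suc 0)) u closed_slab" "Ck_on (Suc 0) P closed_slab" using su sP by (simp_all only: smooth_on_def)
  note Ck = iffD1[OF Ck_on.simps(2) this(1)] iffD1[OF Ck_on.simps(2) this(2)]
  obtain u' where u': "\<And>p. p \<in> closed_slab \<Longrightarrow> (u has_derivative u' p) (at p within closed_slab)"
      "\<And>v. Ck_on (Suc 0) (\<lambda>p. u' p v) closed_slab"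
    using Ck(1) by blast
  obtain P' where P': "\<And>p. p \<in> closed_slab \<Longrightarrow> (P has_derivative P' p) (at p within closed_slab)"
      "\<And>v. continuous_on closed_slab (\<lambda>p. P' p v)"
    using Ck(2) unfolding Ck_on.simps(1) by blast
  have "\<forall>v. \<exists>g. (\<forall>p\<in>closed_slab. ((\<lambda>p. u' p v) has_derivative g p) (at p within closed_slab)) \<and> (\<forall>w. continuous_on closed_slab (\<lambda>p. g p w))"
    using u'(2) by (simp only: Ck_on.simps) blast
  then obtain g where g: "\<And>v p. p \<in> closed_slab \<Longrightarrow> ((\<lambda>p. u' p v) has_derivative g v p) (at p within closed_slab)"
      "\<And>v w. continuous_on closed_slab (\<lambda>p. g v p w)"
    by metis
  have u'c: "continuous_on closed_slab (\<lambda>p. u' p v)" for v by (rule has_derivative_continuous_on[OF g(1)])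
  define Du where "Du i = coords (\<lambda>p. u' p (axis i 1))" for i :: 3
  define DDu where "DDu i = coords (\<lambda>p. g (axis i 1) p (axis i 1))" for i :: 3
  define DP where "DP i = coords (\<lambda>p. P' p (axis i 1))" for i :: 3
  have CU: "C1 (coords u) (Du 1) (Du 2) (Du 3)" unfolding Du_def by (rule C1_coords[OF u'(1) u'c])
  have CP: "C1 (coords P) (DP 1) (DP 2) (DP 3)" unfolding DP_def by (rule C1_coords[OF P'])
  have CD: "C1 (Du i) (coords (\<lambda>p. g (axis i 1) p (axis 1 1))) (coords (\<lambda>p. g (axis i 1) p (axis 2 1))) (coords (\<lambda>p. g (axis i 1) p (axis 3 1)))" for i
    unfolding Du_def by (rule C1_coords[OF g])
  have cDD: "cont3 (DDu i)" for i unfolding DDu_def by (intro cont3_coords g(2))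
  note cc = cont3_slices(3)[OF C1D(1)[OF CU], of UNIV] cont3_slices(3)[OF C1D(2)[OF CU], of UNIV] cont3_slices(3)[OF C1D(3)[OF CU], of UNIV] cont3_slices(3)[OF C1D(4)[OF CU], of UNIV]
    cont3_slices(3)[OF C1D(2)[OF CP], of UNIV] cont3_slices(3)[OF C1D(3)[OF CP], of UNIV] cont3_slices(3)[OF C1D(4)[OF CP], of UNIV] cont3_slices(3)[OF cDD, of UNIV]
  have pde: "DDu 1 x y z + DDu 2 x y z + DDu 3 x y z = (coords u x y z $ 1) *\<^sub>R Du 1 x y z + (coords u x y z $ 2) *\<^sub>R Du 2 x y z + (coords u x y z $ 3) *\<^sub>R Du 3 x y z
        + vector [DP 1 x y z, DP 2 x y z, DP 3 x y z]" if z: "0 \<le> z" "z \<le> 1" for x y z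
  proof -
    have "DDu 1 x y z + DDu 2 x y z + DDu 3 x y z - ((coords u x y z $ 1) *\<^sub>R Du 1 x y z + (coords u x y z $ 2) *\<^sub>R Du 2 x y z + (coords u x y z $ 3) *\<^sub>R Du 3 x y z
        + vector [DP 1 x y z, DP 2 x y z, DP 3 x y z]) = 0"
    proof (rule extend_closed[OF _ _ z])
      show "continuous_on UNIV (\<lambda>z. DDu 1 x y z + DDu 2 x y z + DDu 3 x y z - ((coords u x y z $ 1) *\<^sub>R Du 1 x y z + (coords u x y z $ 2) *\<^sub>R Du 2 x y z + (coords u x y z $ 3) *\<^sub>R Du 3 x y z
        + vector [DP 1 x y z, DP 2 x y z, DP 3 x y z]))"
        unfolding vector3_eq by (intro continuous_intros cc)
      fix z :: real assume z: "0 < z" "z < 1"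
      define p where "p = v3 x y z"
      have p: "p \<in> slab" unfolding p_def by (rule v3_slab[OF z])
      have "clamp01 z = z" using z by (intro clamp01_simps) auto
      then have e: "Du i x y z = partial i u p" "DDu i x y z = partial i (partial i u) p" "DP i x y z = partial i P p" "coords u x y z = u p" for i
        unfolding Du_def DDu_def DP_def coords_def p_def[symmetric]
        using partial_eq[OF u'(1) p] partial2_eq[OF u'(1) g(1) p] partial_eq[OF P'(1) p] by (simp_all add: p_def)
      have gr: "vector [partial 1 P p, partial 2 P p, partial 3 P p] = grad P p"
        by (simp add: vec_eq_iff forall_3 grad_def)
      show "DDu 1 x y z + DDu 2 x y z + DDu 3 x y z - ((coords u x y z $ 1) *\<^sub>R Du 1 x y z + (coords u x y z $ 2) *\<^sub>R Du 2 x y z + (coords u x y z $ 3) *\<^sub>R Du 3 x y z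
        + vector [DP 1 x y z, DP 2 x y z, DP 3 x y z]) = 0"
        unfolding e gr using eq[OF p] by (simp add: laplacian_def advect_def sum_3 algebra_simps)
    qed
    then show ?thesis by simp
  qed
  have div: "Du 1 x y z $ 1 + Du 2 x y z $ 2 + Du 3 x y z $ 3 = 0" if z: "0 \<le> z" "z \<le> 1" for x y z
  proof (rule extend_closed[OF _ _ z])
    show "continuous_on UNIV (\<lambda>z. Du 1 x y z $ 1 + Du 2 x y z $ 2 + Du 3 x y z $ 3)" by (intro continuous_intros cc)
    fix z :: real assume z: "0 < z" "z < 1"
    have p: "v3 x y z \<in> slab" by (rule v3_slab[OF z])
    have "clamp01 z = z" using z by (intro clamp01_simps) auto
    then have "Du i x y z = partial i u (v3 x y z)" for i
      unfolding Du_def coords_def using partial_eq[OF u'(1) p] by simp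
    then show "Du 1 x y z $ 1 + Du 2 x y z $ 2 + Du 3 x y z $ 3 = 0"
      using eq[OF p] by (simp add: divergence_def sum_3)
  qed
  have flow: "slab_flow (coords u) (Du 1) (Du 2) (Du 3) (DDu 1) (DDu 2) (DDu 3) (coords P) (DP 1) (DP 2) (DP 3)"
  proof
    show "coords u x y 0 = 0" "coords u x y 1 = 0" for x y
      using ns unfolding no_slip_def coords_def by (simp_all add: clamp01_def)
    fix x y z :: real assume z: "0 \<le> z" "z \<le> 1"
    show "((\<lambda>s. Du 1 s y z) has_vector_derivative DDu 1 x y z) (at x)" unfolding DDu_def by (rule C1D(5)[OF CD z])
    show "((\<lambda>s. Du 2 x s z) has_vector_derivative DDu 2 x y z) (at y)" unfolding DDu_def by (rule C1D(6)[OF CD z])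
    show "((\<lambda>s. Du 3 x y s) has_vector_derivative DDu 3 x y z) (at z within {0..1})" unfolding DDu_def by (rule C1D(7)[OF CD z])
  qed (fact CU CP cDD pde div)+
  show thesis
  proof (rule that[OF flow])
    fix p :: "real^3" assume p: "p \<in> slab"
    have "clamp01 (p $ 3) = p $ 3" using p by (intro clamp01_simps) (auto simp: slab_def)
    then have "Du i (p $ 1) (p $ 2) (p $ 3) = partial i u p" for i
      unfolding Du_def coords_def using partial_eq[OF u'(1) p] by (simp add: v3_eta)
    then show "grad_norm_sq u p = slab_flow.gsq (Du 1) (Du 2) (Du 3) (p $ 1) (p $ 2) (p $ 3)"
      unfolding slab_flow.gsq_def[OF flow] grad_norm_sq_def power2_norm_eq_inner
      by (simp add: inner_vec_def sum_3 power2_eq_square)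
  qed
qed

text \<open>
  Needed to compare the Lebesgue integral over \<open>real^3\<close> in the definition of the energy with box integrals.
\<close>
lemma lborel_v3: "(lborel :: (real^3) measure) = distr (lborel :: (real\<times>real\<times>real) measure) borel (\<lambda>q. v3 (fst q) (fst (snd q)) (snd (snd q)))"
proof (rule lborel_eqI)
  let ?T = "\<lambda>q. v3 (fst q) (fst (snd q)) (snd (snd q))"
  have m: "?T \<in> borel_measurable borel" by (intro borel_measurable_continuous_onI v3_cont continuous_intros)
  fix l u :: "real^3" assume lu: "\<And>b. b \<in> Basis \<Longrightarrow> l \<bullet> b \<le> u \<bullet> b"
  have B3: "Basis = {axis 1 1, axis 2 1, axis 3 1 :: real^3}" by (auto simp: Basis_vec_def UNIV_3)
  have BP: "Basis = {(1,0,0), (0,1,0), (0,0,1) :: real\<times>real\<times>real}" by (auto simp: Basis_prod_def zero_prod_def)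
  have pre: "?T -` box l u = box (l $ 1, l $ 2, l $ 3) (u $ 1, u $ 2, u $ 3)"
    by (auto simp: box_def B3 BP inner_axis)
  have le: "l $ i \<le> u $ i" for i using lu[of "axis i 1"] by (simp add: inner_axis)
  have "emeasure (distr lborel borel ?T) (box l u) = emeasure lborel (box (l $ 1, l $ 2, l $ 3) (u $ 1, u $ 2, u $ 3))"
    using m by (subst emeasure_distr) (auto simp: pre)
  also have "\<dots> = ennreal (\<Prod>b\<in>Basis. ((u $ 1, u $ 2, u $ 3) - (l $ 1, l $ 2, l $ 3)) \<bullet> b)"
    by (rule emeasure_lborel_box) (auto simp: BP le)
  also have "(\<Prod>b\<in>Basis. ((u $ 1, u $ 2, u $ 3) - (l $ 1, l $ 2, l $ 3)) \<bullet> b) = (\<Prod>b\<in>Basis. (u - l) \<bullet> b)"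
    unfolding B3 BP by (simp add: axis_eq_axis inner_axis)
  finally show "emeasure (distr lborel borel ?T) (box l u) = ennreal (\<Prod>b\<in>Basis. (u - l) \<bullet> b)" .
qed simp

text \<open>
  The cutoff at scale \<open>R\<close> is at most the indicator of the cylinder of radius \<open>2R\<close>.
\<close>
lemma energy_ge:
  assumes flow: "slab_flow U Ux Uy Uz Uxx Uyy Uzz P Px Py Pz"
    and g: "\<And>p. p \<in> slab \<Longrightarrow> grad_norm_sq u p = slab_flow.gsq Ux Uy Uz (p $ 1) (p $ 2) (p $ 3)" and R: "0 < R"
  shows "slab_flow.F Ux Uy Uz R \<le> energy u (2*R)"
proof -
  interpret slab_flow U Ux Uy Uz Uxx Uyy Uzz P Px Py Pz by (rule flow)
  let ?T = "\<lambda>q. v3 (fst q) (fst (snd q)) (snd (snd q))"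
  have m: "?T \<in> borel_measurable borel" by (intro borel_measurable_continuous_onI v3_cont continuous_intros)
  define A where "A = {x \<in> slab. (x $ 1)\<^sup>2 + (x $ 2)\<^sup>2 < (2*R)\<^sup>2}"
  define A' where "A' = {q::real\<times>real\<times>real. 0 < snd (snd q) \<and> snd (snd q) < 1 \<and> (fst q)\<^sup>2 + (fst (snd q))\<^sup>2 < (2*R)\<^sup>2}"
  define gq where "gq = (\<lambda>q. gsq (fst q) (fst (snd q)) (snd (snd q)))"
  define hq where "hq = (\<lambda>q. cutoff R (2*R) (fst q) (fst (snd q)) (snd (snd q)) * gq q)"
  let ?a = "(-(2*R), -(2*R), 0) :: real\<times>real\<times>real" and ?b = "(2*R, 2*R, 1) :: real\<times>real\<times>real"
  have cg: "continuous_on S gq" for S unfolding gq_def by (intro cont3_comp[OF cont3_gsq] continuous_intros)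
  have ch: "continuous_on S hq" for S unfolding hq_def by (intro continuous_intros cont3_comp[OF cont3_cutoff(1)] cg)
  have openA: "open A" "open A'"
    unfolding A_def A'_def slab_def by (intro open_Collect_conj open_Collect_less continuous_intros | simp)+
  have sub: "A' \<subseteq> cbox ?a ?b"
  proof
    fix q assume q: "q \<in> A'"
    have "(fst q)\<^sup>2 \<le> (2*R)\<^sup>2" "(fst (snd q))\<^sup>2 \<le> (2*R)\<^sup>2"
      using q zero_le_power2[of "fst q"] zero_le_power2[of "fst (snd q)"] unfolding A'_def mem_Collect_eq by linarith+
    then have "\<bar>fst q\<bar> \<le> 2*R" "\<bar>fst (snd q)\<bar> \<le> 2*R" using R by (auto intro: abs_le_of_sq)
    then show "q \<in> cbox ?a ?b" using q by (cases q) (auto simp: A'_def cbox_Pair_eq abs_le_iff)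
  qed
  have TA: "?T q \<in> A \<longleftrightarrow> q \<in> A'" for q by (auto simp: A_def A'_def slab_def)
  define G where "G = (\<lambda>p::real^3. indicator A p *\<^sub>R gsq (p $ 1) (p $ 2) (p $ 3))"
  have mG: "G \<in> borel_measurable borel"
  proof -
    have "(\<lambda>p::real^3. gsq (p $ 1) (p $ 2) (p $ 3)) \<in> borel_measurable borel"
      by (intro borel_measurable_continuous_onI cont3_comp[OF cont3_gsq] continuous_intros)
    then show ?thesis unfolding G_def using openA(1) by (intro borel_measurable_scaleR borel_measurable_indicator) auto
  qed
  have "energy u (2*R) = integral\<^sup>L lborel G"
    unfolding energy_def set_lebesgue_integral_def A_def[symmetric] G_def
    by (intro Bochner_Integration.integral_cong) (auto simp: indicator_def A_def g)
  also have "\<dots> = integral\<^sup>L lborel (\<lambda>q. G (?T q))"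
    by (subst lborel_v3, subst integral_distr) (use m mG in auto)
  also have "(\<lambda>q. G (?T q)) = (\<lambda>q. indicator A' q *\<^sub>R gq q)"
    by (auto simp: G_def TA gq_def indicator_def fun_eq_iff)
  finally have E: "energy u (2*R) = (LINT q:A'|lborel. gq q)" by (simp add: set_lebesgue_integral_def)
  have ic: "set_integrable lborel (cbox ?a ?b) f" if "\<And>S. continuous_on S f" for f :: "real\<times>real\<times>real \<Rightarrow> real"
    unfolding set_integrable_def by (rule borel_integrable_compact[OF compact_cbox that])
  have ib: "set_integrable lborel (box ?a ?b) hq"
    by (rule set_integrable_subset[OF ic[OF ch]]) (auto simp: box_subset_cbox)
  have iA: "set_integrable lborel A' gq"
    by (rule set_integrable_subset[OF ic[OF cg] _ sub]) (use openA(2) in simp)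
  have "F R = integral (cbox ?a ?b) hq"
    unfolding F_def I3_def hq_def gq_def by (simp add: case_prod_beta')
  also have "\<dots> = integral (box ?a ?b) hq" by (rule integral_open_interval[symmetric])
  also have "\<dots> = (LINT q:box ?a ?b|lborel. hq q)" by (rule set_borel_integral_eq_integral(2)[OF ib, symmetric])
  also have "\<dots> \<le> (LINT q:A'|lborel. gq q)"
    unfolding set_lebesgue_integral_def
  proof (rule integral_mono)
    show "integrable lborel (\<lambda>q. indicator (box ?a ?b) q *\<^sub>R hq q)" "integrable lborel (\<lambda>q. indicator A' q *\<^sub>R gq q)"
      using ib iA by (simp_all add: set_integrable_def)
    fix q :: "real\<times>real\<times>real"
    have gn: "0 \<le> gq q" unfolding gq_def by (rule gsq_nonneg)
    show "indicator (box ?a ?b) q *\<^sub>R hq q \<le> indicator A' q *\<^sub>R gq q"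
    proof (cases "q \<in> box ?a ?b")
      case True
      show ?thesis
      proof (cases "q \<in> A'")
        case True
        then show ?thesis using gn cutoff_range by (auto simp: hq_def indicator_def mult_left_le_one_le)
      next
        case False
        have "0 < snd (snd q)" "snd (snd q) < 1" using True by (cases q; auto simp: box_def Basis_prod_def)+
        then have "(2*R)\<^sup>2 \<le> (fst q)\<^sup>2 + (fst (snd q))\<^sup>2" using False by (auto simp: A'_def)
        then have "cutoff R (2*R) (fst q) (fst (snd q)) (snd (snd q)) = 0" using R by (intro cutoff_zero(1)) auto
        then show ?thesis using False by (simp add: hq_def)
      qed
    qed (use gn in \<open>simp add: indicator_def\<close>)
  qed
  finally show ?thesis unfolding E .
qed

section \<open>The Liouville theorem\<close>

text \<open>
  A vanishing lower limit makes the energy smaller than the given power at arbitrarily large radii.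
\<close>
lemma growth_of_energy_condition:
  assumes flow: "slab_flow U Ux Uy Uz Uxx Uyy Uzz P Px Py Pz"
    and g: "\<And>p. p \<in> slab \<Longrightarrow> grad_norm_sq u p = slab_flow.gsq Ux Uy Uz (p $ 1) (p $ 2) (p $ 3)"
    and \<alpha>: "0 < \<alpha>" "\<alpha> \<le> growth_exp" and ec: "energy_condition \<alpha> u"
  shows "\<exists>T\<ge>T0. slab_flow.F Ux Uy Uz T \<le> 2 * T powr growth_exp"
proof -
  have "\<not> eventually (\<lambda>R. 1 \<le> ereal (R powr (-\<alpha>) * energy u R)) at_top"
  proof
    assume "eventually (\<lambda>R. 1 \<le> ereal (R powr (-\<alpha>) * energy u R)) at_top"
    then have "1 \<le> Liminf at_top (\<lambda>R. ereal (R powr (-\<alpha>) * energy u R))" by (rule Liminf_bounded)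
    then show False using ec unfolding energy_condition_def by simp
  qed
  then obtain R where R: "2 * max 1 T0 \<le> R" "R powr (-\<alpha>) * energy u R < 1"
    by (auto simp: eventually_at_top_linorder not_le one_ereal_def)
  define T where "T = R / 2"
  have T: "1 \<le> T" "T0 \<le> T" using R(1) by (auto simp: T_def)
  have R0: "0 < R" using R(1) by linarith
  have ge1: "growth_exp \<le> 1/8" by (rule growth_exp_bounds(2))
  have "energy u R < R powr \<alpha>"
    using R(2) R0 by (simp add: powr_minus field_simps)
  also have "R powr \<alpha> = 2 powr \<alpha> * T powr \<alpha>" using R0 by (simp add: T_def powr_mult[symmetric])
  also have "\<dots> \<le> 2 powr 1 * T powr growth_exp"
    using \<alpha> ge1 T(1) by (intro mult_mono powr_mono) auto
  finally have "energy u (2 * T) \<le> 2 * T powr growth_exp" by (simp add: T_def)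
  moreover have "slab_flow.F Ux Uy Uz T \<le> energy u (2 * T)"
    by (rule energy_ge[OF flow g]) (use T in auto)
  ultimately show ?thesis using T(2) by fastforce
qed

text \<open>
  In the estimates below \<open>\<beta>\<close> disappears: \<open>r\<^sup>\<beta> \<le> r\<^sup>\<alpha>\<^sup>/\<^sup>2\<close> far out, and \<open>r |u\<^sup>r| \<le> m r\<^sup>\<alpha>\<^sup>/\<^sup>2\<^sup>-\<^sup>\<beta>\<close> with a nonnegative exponent.
\<close>
lemma bounds_of_decay_condition:
  assumes cu: "continuous_on closed_slab u" and ns: "no_slip u" and \<alpha>: "0 < \<alpha>" and dc: "decay_condition \<alpha> u"
  shows "\<exists>M\<ge>1. \<forall>R x y z. 1 \<le> R \<longrightarrow> x\<^sup>2 + y\<^sup>2 \<le> (8*R)\<^sup>2 \<longrightarrow> 0 \<le> z \<longrightarrow> z \<le> 1 \<longrightarrow>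
     norm (u (v3 x y z)) \<le> M * (8*R) powr (\<alpha>/2) \<and> \<bar>x * u (v3 x y z) $ 1 + y * u (v3 x y z) $ 2\<bar> \<le> M * (8*R) powr (\<alpha>/2)"
proof -
  let ?a = "\<alpha>/2"
  have cylv: "cyl r t z = v3 (r * cos t) (r * sin t) z" for r t z by (simp add: cyl_def v3_def)
  obtain \<beta> where \<beta>: "0 \<le> \<beta>" "\<beta> \<le> ?a"
    and lim: "((\<lambda>r. r powr (-\<beta>) * (SUP (\<theta>, z)\<in>{0..<2*pi} \<times> {0..1}. norm (u (cyl r \<theta> z)))) \<longlongrightarrow> 0) at_top"
    and sup: "(SUP (r, \<theta>, z)\<in>{0<..} \<times> {0..<2*pi} \<times> {0<..<1}. ereal (r powr (1 + \<beta> - ?a) * \<bar>radial u r \<theta> z\<bar>)) < \<infinity>"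
    using dc unfolding decay_condition_def by auto
  have polar: "\<exists>t. 0 \<le> t \<and> t < 2 * pi \<and> x = r * cos t \<and> y = r * sin t" if r: "0 < r" "r\<^sup>2 = x\<^sup>2 + y\<^sup>2" for x y r :: real
  proof -
    have "(x / r)\<^sup>2 + (y / r)\<^sup>2 = r\<^sup>2 / r\<^sup>2" unfolding r(2) by (simp only: power_divide add_divide_distrib[symmetric] r(2))
    then have "(x / r)\<^sup>2 + (y / r)\<^sup>2 = 1" using r(1) by simp
    then obtain t where "0 \<le> t" "t < 2 * pi" "x / r = cos t" "y / r = sin t" using sincos_total_2pi by metis
    then show ?thesis using r(1) by (intro exI[of _ t]) (auto simp: field_simps)
  qed
  \<comment> \<open>beyond some radius the first limit bounds the velocity by \<open>r powr \<beta>\<close>; inside, compactness does\<close>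
  have "eventually (\<lambda>r. r powr (-\<beta>) * (SUP (\<theta>, z)\<in>{0..<2*pi} \<times> {0..1}. norm (u (cyl r \<theta> z))) < 1) at_top"
    by (rule order_tendstoD(2)[OF lim]) simp
  then obtain r0 where r0: "\<And>r. r0 \<le> r \<Longrightarrow> r powr (-\<beta>) * (SUP (\<theta>, z)\<in>{0..<2*pi} \<times> {0..1}. norm (u (cyl r \<theta> z))) < 1"
    by (auto simp: eventually_at_top_linorder)
  define \<rho> where "\<rho> = max 1 r0"
  have far: "norm (u (cyl r t z)) \<le> r powr ?a" if r: "\<rho> \<le> r" and t: "0 \<le> t" "t < 2*pi" and z: "0 \<le> z" "z \<le> 1" for r t z
  proof -
    have c: "continuous_on ({0..2*pi} \<times> {0..1}) (\<lambda>(t, z). norm (u (cyl r t z)))"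
      unfolding case_prod_beta' cylv
      by (intro continuous_on_norm continuous_on_compose2[OF cu] v3_cont continuous_intros) (auto intro!: v3_in)
    have "compact ((\<lambda>(t, z). norm (u (cyl r t z))) ` ({0..2*pi} \<times> {0..1}))"
      by (intro compact_continuous_image c compact_Times compact_Icc)
    then have "bdd_above ((\<lambda>(t, z). norm (u (cyl r t z))) ` ({0..2*pi} \<times> {0..1}))"
      by (intro bounded_imp_bdd_above compact_imp_bounded)
    then have bdd: "bdd_above ((\<lambda>(t, z). norm (u (cyl r t z))) ` ({0..<2*pi} \<times> {0..1}))"
      by (rule bdd_above_mono) auto
    have "(\<lambda>(t, z). norm (u (cyl r t z))) (t, z) \<le> (SUP (\<theta>, z)\<in>{0..<2*pi} \<times> {0..1}. norm (u (cyl r \<theta> z)))"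
      by (rule cSUP_upper[OF _ bdd]) (use t z in auto)
    moreover have "(SUP (\<theta>, z)\<in>{0..<2*pi} \<times> {0..1}. norm (u (cyl r \<theta> z))) < r powr \<beta>"
      using r0[of r] r by (simp add: \<rho>_def powr_minus field_simps)
    moreover have "r powr \<beta> \<le> r powr ?a" using r \<beta> by (intro powr_mono) (auto simp: \<rho>_def)
    ultimately show ?thesis by simp
  qed
  have "continuous_on (cbox (v3 (-\<rho>) (-\<rho>) 0) (v3 \<rho> \<rho> 1)) u"
    by (rule continuous_on_subset[OF cu]) (auto simp: closed_slab_def mem_box_cart forall_3)
  from compact_imp_bounded[OF compact_continuous_image[OF this compact_cbox]]
  obtain M1 where M1: "\<And>p. p \<in> cbox (v3 (-\<rho>) (-\<rho>) 0) (v3 \<rho> \<rho> 1) \<Longrightarrow> norm (u p) \<le> M1"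
    unfolding bounded_iff by auto
  have bound1: "norm (u (v3 x y z)) \<le> max 1 M1 * (8*R) powr ?a"
    if R: "1 \<le> R" and xy: "x\<^sup>2 + y\<^sup>2 \<le> (8*R)\<^sup>2" and z: "0 \<le> z" "z \<le> 1" for R x y z
  proof -
    have one: "1 \<le> (8*R) powr ?a" using R \<alpha> by (intro ge_one_powr_ge_zero) auto
    define r where "r = sqrt (x\<^sup>2 + y\<^sup>2)"
    have r: "0 \<le> r" "r\<^sup>2 = x\<^sup>2 + y\<^sup>2" by (auto simp: r_def)
    show ?thesis
    proof (cases "\<rho> \<le> r")
      case True
      then have rp: "0 < r" by (simp add: \<rho>_def)
      obtain t where t: "0 \<le> t" "t < 2*pi" "x = r * cos t" "y = r * sin t" using polar[OF rp r(2)] by blast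
      have "norm (u (v3 x y z)) \<le> r powr ?a" using far[OF True t(1,2) z] by (simp add: cylv t)
      also have "\<dots> \<le> (8*R) powr ?a"
      proof (rule powr_mono2)
        show "r \<le> 8*R" by (rule power2_le_imp_le) (use r xy R in auto)
      qed (use \<alpha> r in auto)
      also have "\<dots> \<le> max 1 M1 * (8*R) powr ?a" using mult_right_mono[of 1 "max 1 M1" "(8*R) powr ?a"] by simp
      finally show ?thesis .
    next
      case False
      have "\<bar>x\<bar> \<le> r" "\<bar>y\<bar> \<le> r" unfolding r_def by (auto intro!: real_le_rsqrt)
      then have "norm (u (v3 x y z)) \<le> M1" using False z by (intro M1) (auto simp: mem_box_cart forall_3 abs_le_iff)
      also have "\<dots> \<le> max 1 M1 * 1" by simp
      also have "\<dots> \<le> max 1 M1 * (8*R) powr ?a" using one by (intro mult_left_mono) auto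
      finally show ?thesis .
    qed
  qed
  \<comment> \<open>a finite supremum in the extended reals is below some natural number\<close>
  obtain m :: nat where m: "(SUP (r, \<theta>, z)\<in>{0<..} \<times> {0..<2*pi} \<times> {0<..<1}. ereal (r powr (1 + \<beta> - ?a) * \<bar>radial u r \<theta> z\<bar>)) < ereal (real m)"
    using sup less_PInf_Ex_of_nat by auto
  have rad: "r powr (1 + \<beta> - ?a) * \<bar>radial u r t z\<bar> \<le> real m" if "0 < r" "0 \<le> t" "t < 2*pi" "0 < z" "z < 1" for r t z
  proof -
    have "(\<lambda>(r, \<theta>, z). ereal (r powr (1 + \<beta> - ?a) * \<bar>radial u r \<theta> z\<bar>)) (r, t, z) \<le> (SUP (r, \<theta>, z)\<in>{0<..} \<times> {0..<2*pi} \<times> {0<..<1}. ereal (r powr (1 + \<beta> - ?a) * \<bar>radial u r \<theta> z\<bar>))"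
      by (rule SUP_upper) (use that in auto)
    from le_less_trans[OF this m] show ?thesis by simp
  qed
  have bound2: "\<bar>x * u (v3 x y z) $ 1 + y * u (v3 x y z) $ 2\<bar> \<le> real m * (8*R) powr ?a"
    if R: "1 \<le> R" and xy: "x\<^sup>2 + y\<^sup>2 \<le> (8*R)\<^sup>2" and z: "0 \<le> z" "z \<le> 1" for R x y z
  proof -
    consider "z = 0 \<or> z = 1" | "x\<^sup>2 + y\<^sup>2 = 0" | "0 < z" "z < 1" "x\<^sup>2 + y\<^sup>2 \<noteq> 0" using z by linarith
    then show ?thesis
    proof cases
      case 1
      then have "u (v3 x y z) = 0" using ns unfolding no_slip_def by auto
      then show ?thesis by simp
    next
      case 2
      then have "x = 0" "y = 0" by (auto simp: sum_power2_eq_zero_iff)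
      then show ?thesis by simp
    next
      case 3
      define r where "r = sqrt (x\<^sup>2 + y\<^sup>2)"
      have r: "0 < r" "r\<^sup>2 = x\<^sup>2 + y\<^sup>2" using 3(3) zero_le_power2[of x] zero_le_power2[of y] by (auto simp: r_def sum_power2_gt_zero_iff)
      obtain t where t: "0 \<le> t" "t < 2*pi" "x = r * cos t" "y = r * sin t" using polar[OF r] by blast
      have "radial u r t z = u (v3 x y z) $ 1 * cos t + u (v3 x y z) $ 2 * sin t"
        by (simp add: radial_def cylv t e_r_def inner_vec_def sum_3)
      then have e: "x * u (v3 x y z) $ 1 + y * u (v3 x y z) $ 2 = r * radial u r t z"
        by (simp add: t(3,4) algebra_simps)
      have p: "r = r powr (?a - \<beta>) * r powr (1 + \<beta> - ?a)" using r(1) by (simp add: powr_add[symmetric])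
      have "\<bar>r * radial u r t z\<bar> = r powr (?a - \<beta>) * (r powr (1 + \<beta> - ?a) * \<bar>radial u r t z\<bar>)"
        using r(1) p by (simp add: abs_mult mult.assoc[symmetric])
      also have "\<dots> \<le> r powr (?a - \<beta>) * real m" using rad[OF r(1) t(1,2) 3(1,2)] by (intro mult_left_mono) auto
      also have "\<dots> \<le> (8*R) powr ?a * real m"
      proof (intro mult_right_mono)
        have "r \<le> 8*R" by (rule power2_le_imp_le) (use r xy R in auto)
        then have "r powr (?a - \<beta>) \<le> (8*R) powr (?a - \<beta>)" using r \<beta> by (intro powr_mono2) auto
        also have "\<dots> \<le> (8*R) powr ?a" using R \<beta> by (intro powr_mono) auto
        finally show "r powr (?a - \<beta>) \<le> (8*R) powr ?a" .
      qed simp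
      finally show ?thesis unfolding e by (simp add: mult.commute)
    qed
  qed
  define M where "M = max (max 1 M1) (real m)"
  have w: "max 1 M1 * (8*R) powr ?a \<le> M * (8*R) powr ?a" "real m * (8*R) powr ?a \<le> M * (8*R) powr ?a" for R
    unfolding M_def by (intro mult_right_mono; simp)+
  show ?thesis
    by (intro exI[of _ M] conjI allI impI order_trans[OF bound1 w(1)] order_trans[OF bound2 w(2)]; (assumption | simp add: M_def))
qed

text \<open>
  Under (b) the energy is of order \<open>N\<^sup>4\<close> with \<open>N\<close> of order \<open>R\<^sup>\<alpha>\<^sup>/\<^sup>2\<close>, that is, of order \<open>R\<^sup>2\<^sup>\<alpha>\<close>; hence \<open>\<alpha>\<close> is half of the
  decisive power.
\<close>
theorem theorem1p2:
  shows "\<exists>\<alpha>::real. 0 < \<alpha> \<and> \<alpha> < 1 \<and>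
    (\<forall>u :: real^3 \<Rightarrow> real^3.
       smooth_NS_solution u \<and> no_slip u \<and> (energy_condition \<alpha> u \<or> decay_condition \<alpha> u)
       \<longrightarrow> (\<forall>x\<in>closed_slab. u x = 0))"
proof (intro exI conjI allI impI ballI)
  let ?\<alpha> = "growth_exp / 2"
  show a0: "0 < ?\<alpha>" and "?\<alpha> < 1" using growth_exp_bounds by auto
  fix u :: "real^3 \<Rightarrow> real^3" and p :: "real^3"
  assume h: "smooth_NS_solution u \<and> no_slip u \<and> (energy_condition ?\<alpha> u \<or> decay_condition ?\<alpha> u)" and p: "p \<in> closed_slab"
  then obtain Ux Uy Uz Uxx Uyy Uzz P Px Py Pz where flow: "slab_flow (coords u) Ux Uy Uz Uxx Uyy Uzz P Px Py Pz"
    and g: "\<And>p. p \<in> slab \<Longrightarrow> grad_norm_sq u p = slab_flow.gsq Ux Uy Uz (p $ 1) (p $ 2) (p $ 3)"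
    using slab_flow_of_solution by blast
  have z: "0 \<le> p $ 3" "p $ 3 \<le> 1" using p by (auto simp: closed_slab_def)
  have "coords u (p $ 1) (p $ 2) (p $ 3) = 0"
    using h
  proof (elim conjE disjE)
    assume ec: "energy_condition ?\<alpha> u"
    show ?thesis
      by (rule slab_flow.liouville_of_growth[OF flow _ growth_of_energy_condition[OF flow g a0 _ ec] z])
        (use a0 in auto)
  next
    assume dc: "decay_condition ?\<alpha> u"
    have "Ck_on 0 u closed_slab" using h unfolding smooth_NS_solution_def smooth_on_def by blast
    then have cu: "continuous_on closed_slab u" by simp
    obtain M where M: "1 \<le> M" and b: "\<And>R x y z. 1 \<le> R \<Longrightarrow> x\<^sup>2 + y\<^sup>2 \<le> (8*R)\<^sup>2 \<Longrightarrow> 0 \<le> z \<Longrightarrow> z \<le> 1 \<Longrightarrow>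
        norm (u (v3 x y z)) \<le> M * (8*R) powr (?\<alpha>/2) \<and> \<bar>x * u (v3 x y z) $ 1 + y * u (v3 x y z) $ 2\<bar> \<le> M * (8*R) powr (?\<alpha>/2)"
      using bounds_of_decay_condition[OF cu _ a0 dc] h by blast
    have "slab_flow.F Ux Uy Uz R \<le> (16 * growth_const * M ^ 4) * R powr growth_exp" if R: "1 \<le> R" for R
    proof -
      define N where "N = M * (8*R) powr (?\<alpha>/2)"
      have "1 * 1 \<le> N" unfolding N_def using M R a0 by (intro mult_mono ge_one_powr_ge_zero) auto
      then have "bounded_flow (coords u) Ux Uy Uz Uxx Uyy Uzz P Px Py Pz R N"
        unfolding bounded_flow_def bounded_flow_axioms_def using flow R b[OF R] by (auto simp: coords_def clamp01_simps N_def)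
      then have "slab_flow.F Ux Uy Uz R \<le> 2 * (growth_const * N ^ 4)" by (rule bounded_flow.F_growth)
      also have "N ^ 4 = M ^ 4 * ((8*R) powr growth_exp)"
      proof -
        have "((8*R) powr (?\<alpha>/2)) ^ 4 = ((8*R) powr (?\<alpha>/2)) powr 4" by (rule powr_numeral[symmetric]) simp
        also have "\<dots> = (8*R) powr growth_exp" unfolding powr_powr by simp
        finally have "((8*R) powr (?\<alpha>/2)) ^ 4 = (8*R) powr growth_exp" .
        then show ?thesis by (simp add: N_def power_mult_distrib)
      qed
      also have "2 * (growth_const * (M ^ 4 * ((8*R) powr growth_exp))) \<le> 2 * (growth_const * (M ^ 4 * (8 * R powr growth_exp)))"
      proof (intro mult_left_mono)
        have "(8::real) powr growth_exp \<le> 8 powr 1" using growth_exp_bounds(2) by (intro powr_mono) auto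
        then show "(8*R) powr growth_exp \<le> 8 * R powr growth_exp" using R by (simp add: powr_mult mult_right_mono)
      qed (use M in \<open>auto simp: growth_const_def\<close>)
      also have "\<dots> = (16 * growth_const * M ^ 4) * R powr growth_exp" by simp
      finally show ?thesis .
    qed
    then have often: "\<exists>T\<ge>T0. slab_flow.F Ux Uy Uz T \<le> (16 * growth_const * M ^ 4) * T powr growth_exp" for T0
      by (intro exI[of _ "max 1 T0"]) auto
    show ?thesis
      by (rule slab_flow.liouville_of_growth[OF flow _ often z]) (use M in \<open>simp add: growth_const_def\<close>)
  qed
  then show "u p = 0" using z by (simp add: coords_def clamp01_simps v3_eta)
qed

end
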